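(* If $G=\mathrm{SU}(p,1)$ or $G=\mathrm{SO}_0(p,1)$ for a positive integer $p$, or $G=\mathrm{SO}_0(2,2)$, then any irreducible admissible representation of $G$ has multiplicity-free restriction to a maximal compact subgroup $K$ of $G$; i.e. every irreducible representation of $K$ occurs with multiplicity $0$ or $1$.
   Context: $\mathrm{SO}_0(p,q)$ denotes the identity component of $\mathrm{SO}(p,q)$. *)

theory Defs
  imports "HOL-Analysis.Analysis" "HOL-Library.Function_Algebras" "HOL-Algebra.Group" "Jordan_Normal_Form.Matrix"
begin

no_notation Matrix.vec_index (infixl \<open>$\<close> 100)

section \<open>The groups\<close>

text \<open>
  Matrices of signature \<open>(p, q)\<close> are indexed by the sum type \<open>'p + 'q\<close>, where
  \<open>p = CARD('p)\<close> and \<open>q = CARD('q)\<close>.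
\<close>

definition signature_form :: "'a::ring_1 ^ ('p::finite + 'q::finite) ^ ('p + 'q)" where
  "signature_form =
     (\<chi> i j. if i = j then (case i of Inl _ \<Rightarrow> 1 | Inr _ \<Rightarrow> - 1) else 0)"

definition adjoint_matrix :: "complex ^ 'n ^ 'm \<Rightarrow> complex ^ 'm ^ 'n" where
  "adjoint_matrix A = (\<chi> i j. cnj (A $ j $ i))"

definition SU :: "(complex ^ ('p::finite + 'q::finite) ^ ('p + 'q)) set" where
  "SU = {A. adjoint_matrix A ** signature_form ** A = signature_form \<and> det A = 1}"

definition SO :: "(real ^ ('p::finite + 'q::finite) ^ ('p + 'q)) set" where
  "SO = {A. transpose A ** signature_form ** A = signature_form \<and> det A = 1}"

definition SO0 :: "(real ^ ('p::finite + 'q::finite) ^ ('p + 'q)) set" where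
  "SO0 = connected_component_set SO (Finite_Cartesian_Product.mat 1)"

definition matrix_monoid :: "('a::semiring_1 ^ 'n ^ 'n) set \<Rightarrow> ('a ^ 'n ^ 'n) monoid" where
  "matrix_monoid G =
     \<lparr>carrier = G, monoid.mult = (**), one = Finite_Cartesian_Product.mat 1\<rparr>"

definition compact_subgroup ::
    "('a::{semiring_1, topological_space} ^ 'n ^ 'n) set \<Rightarrow> ('a ^ 'n ^ 'n) set \<Rightarrow> bool" where
  "compact_subgroup G K \<longleftrightarrow> subgroup K (matrix_monoid G) \<and> compact K"

definition maximal_compact_subgroup ::
    "('a::{semiring_1, topological_space} ^ 'n ^ 'n) set \<Rightarrow> ('a ^ 'n ^ 'n) set \<Rightarrow> bool" where
  "maximal_compact_subgroup G K \<longleftrightarrow>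
     compact_subgroup G K \<and> (\<forall>L. compact_subgroup G L \<and> K \<subseteq> L \<longrightarrow> L = K)"


section \<open>Complex Hilbert spaces\<close>

text \<open>
  The class \<open>real_inner\<close> supplies the norm and the topology; its inner product is the real
  part of the Hermitian one. The latter is linear in its first argument.
\<close>

class complex_hilbert_space = real_inner + complete_space +
  fixes scaleC :: "complex \<Rightarrow> 'a \<Rightarrow> 'a"
    and cinner :: "'a \<Rightarrow> 'a \<Rightarrow> complex"
  assumes scaleC_add_right: "scaleC c (x + y) = scaleC c x + scaleC c y"
    and scaleC_add_left: "scaleC (c + d) x = scaleC c x + scaleC d x"
    and scaleC_scaleC: "scaleC c (scaleC d x) = scaleC (c * d) x"
    and scaleC_of_real: "scaleC (complex_of_real r) x = scaleR r x"
    and cinner_commute: "cinner x y = cnj (cinner y x)"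
    and cinner_add_left: "cinner (x + y) z = cinner x z + cinner y z"
    and cinner_scaleC_left: "cinner (scaleC c x) y = c * cinner x y"
    and Re_cinner: "Re (cinner x y) = inner x y"


section \<open>Hilbert space representations\<close>

definition hilbert_representation ::
    "('a::{semiring_1, topological_space} ^ 'n ^ 'n) set
      \<Rightarrow> ('a ^ 'n ^ 'n \<Rightarrow> 'v::complex_hilbert_space \<Rightarrow> 'v) \<Rightarrow> bool" where
  "hilbert_representation G \<pi> \<longleftrightarrow>
     (\<forall>g\<in>G. bounded_linear (\<pi> g) \<and> (\<forall>c x. \<pi> g (scaleC c x) = scaleC c (\<pi> g x))) \<and>
     (\<forall>x. \<pi> (Finite_Cartesian_Product.mat 1) x = x) \<and>
     (\<forall>g\<in>G. \<forall>h\<in>G. \<forall>x. \<pi> (g ** h) x = \<pi> g (\<pi> h x)) \<and>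
     continuous_on (G \<times> UNIV) (\<lambda>(g, x). \<pi> g x)"

definition closed_invariant_subspace ::
    "('a ^ 'n ^ 'n) set \<Rightarrow> ('a ^ 'n ^ 'n \<Rightarrow> 'v::complex_hilbert_space \<Rightarrow> 'v)
      \<Rightarrow> 'v set \<Rightarrow> bool" where
  "closed_invariant_subspace G \<pi> W \<longleftrightarrow>
     closed W \<and> 0 \<in> W \<and> (\<forall>x\<in>W. \<forall>y\<in>W. x + y \<in> W) \<and> (\<forall>c. \<forall>x\<in>W. scaleC c x \<in> W) \<and>
     (\<forall>g\<in>G. \<forall>x\<in>W. \<pi> g x \<in> W)"

definition irreducible_hilbert_representation ::
    "('a::{semiring_1, topological_space} ^ 'n ^ 'n) set
      \<Rightarrow> ('a ^ 'n ^ 'n \<Rightarrow> 'v::complex_hilbert_space \<Rightarrow> 'v) \<Rightarrow> bool" where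
  "irreducible_hilbert_representation G \<pi> \<longleftrightarrow>
     hilbert_representation G \<pi> \<and> (UNIV :: 'v set) \<noteq> {0} \<and>
     (\<forall>W. closed_invariant_subspace G \<pi> W \<longrightarrow> W = {0} \<or> W = UNIV)"


section \<open>Irreducible representations of a compact group and their multiplicities\<close>

text \<open>
  Irreducible representations of a compact group are finite-dimensional, so up to equivalence
  they are given by \<open>n \<times> n\<close> matrices, \<open>n\<close> ranging over the positive integers.
\<close>

definition matrix_representation ::
    "('a::{semiring_1, topological_space} ^ 'n ^ 'n) set
      \<Rightarrow> nat \<Rightarrow> ('a ^ 'n ^ 'n \<Rightarrow> complex Matrix.mat) \<Rightarrow> bool" where
  "matrix_representation K n \<tau> \<longleftrightarrow>
     (\<forall>k\<in>K. \<tau> k \<in> carrier_mat n n) \<and>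
     \<tau> (Finite_Cartesian_Product.mat 1) = 1\<^sub>m n \<and>
     (\<forall>k\<in>K. \<forall>l\<in>K. \<tau> (k ** l) = \<tau> k * \<tau> l) \<and>
     (\<forall>i<n. \<forall>j<n. continuous_on K (\<lambda>k. \<tau> k $$ (i, j)))"

definition irreducible_matrix_representation ::
    "('a::{semiring_1, topological_space} ^ 'n ^ 'n) set
      \<Rightarrow> nat \<Rightarrow> ('a ^ 'n ^ 'n \<Rightarrow> complex Matrix.mat) \<Rightarrow> bool" where
  "irreducible_matrix_representation K n \<tau> \<longleftrightarrow>
     matrix_representation K n \<tau> \<and> 0 < n \<and>
     (\<forall>W \<subseteq> carrier_vec n.
        0\<^sub>v n \<in> W \<and> (\<forall>x\<in>W. \<forall>y\<in>W. x + y \<in> W) \<and> (\<forall>c. \<forall>x\<in>W. c \<cdot>\<^sub>v x \<in> W) \<and>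
        (\<forall>k\<in>K. \<forall>x\<in>W. \<tau> k *\<^sub>v x \<in> W)
        \<longrightarrow> W = {0\<^sub>v n} \<or> W = carrier_vec n)"

text \<open>
  The space of \<open>K\<close>-intertwiners from \<open>\<tau>\<close> to the restriction of \<open>\<pi>\<close>. Its elements are maps on
  the whole type of vectors of arbitrary length; setting them to \<open>0\<close> off \<open>carrier_vec n\<close> makes
  them correspond exactly to the maps on \<open>carrier_vec n\<close>.
\<close>

definition intertwiners ::
    "('a ^ 'n ^ 'n) set \<Rightarrow> nat \<Rightarrow> ('a ^ 'n ^ 'n \<Rightarrow> complex Matrix.mat)
      \<Rightarrow> ('a ^ 'n ^ 'n \<Rightarrow> 'v::complex_hilbert_space \<Rightarrow> 'v) \<Rightarrow> (complex Matrix.vec \<Rightarrow> 'v) set" where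
  "intertwiners K n \<tau> \<pi> =
     {T. (\<forall>x\<in>carrier_vec n. \<forall>y\<in>carrier_vec n. T (x + y) = T x + T y) \<and>
         (\<forall>c. \<forall>x\<in>carrier_vec n. T (c \<cdot>\<^sub>v x) = scaleC c (T x)) \<and>
         (\<forall>k\<in>K. \<forall>x\<in>carrier_vec n. T (\<tau> k *\<^sub>v x) = \<pi> k (T x)) \<and>
         (\<forall>x. x \<notin> carrier_vec n \<longrightarrow> T x = 0)}"

definition scale_map ::
    "complex \<Rightarrow> ('b \<Rightarrow> 'v::complex_hilbert_space) \<Rightarrow> 'b \<Rightarrow> 'v" where
  "scale_map c T = (\<lambda>x. scaleC c (T x))"

interpretation scale_map: Vector_Spaces.vector_space scale_map
proof
  fix a b :: complex and x y :: "'a \<Rightarrow> 'b"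
  show "scale_map 1 x = x"
    using scaleC_of_real[of 1, where ?'a = 'b] by (simp add: scale_map_def)
qed (simp_all add: scale_map_def fun_eq_iff scaleC_add_right scaleC_add_left scaleC_scaleC)

text \<open>
  Since \<open>dim\<close> is \<open>0\<close> on infinite-dimensional spaces, that case is treated separately.
\<close>

definition multiplicity_in ::
    "('a ^ 'n ^ 'n) set \<Rightarrow> nat \<Rightarrow> ('a ^ 'n ^ 'n \<Rightarrow> complex Matrix.mat)
      \<Rightarrow> ('a ^ 'n ^ 'n \<Rightarrow> 'v::complex_hilbert_space \<Rightarrow> 'v) \<Rightarrow> enat" where
  "multiplicity_in K n \<tau> \<pi> =
     (if \<exists>B. finite B \<and> intertwiners K n \<tau> \<pi> \<subseteq> scale_map.span B
      then enat (scale_map.dim (intertwiners K n \<tau> \<pi>)) else \<infinity>)"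

text \<open>
  It is not required that \<open>K\<close> act by unitary operators. As \<open>K\<close> is compact, this can always be
  achieved by passing to an equivalent Hermitian inner product.
\<close>

definition admissible ::
    "('a::{semiring_1, topological_space} ^ 'n ^ 'n) set
      \<Rightarrow> ('a ^ 'n ^ 'n \<Rightarrow> 'v::complex_hilbert_space \<Rightarrow> 'v) \<Rightarrow> bool" where
  "admissible K \<pi> \<longleftrightarrow>
     (\<forall>n \<tau>. irreducible_matrix_representation K n \<tau> \<longrightarrow> multiplicity_in K n \<tau> \<pi> \<noteq> \<infinity>)"

definition multiplicity_free ::
    "('a::{semiring_1, topological_space} ^ 'n ^ 'n) set
      \<Rightarrow> ('a ^ 'n ^ 'n \<Rightarrow> 'v::complex_hilbert_space \<Rightarrow> 'v) \<Rightarrow> bool" where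
  "multiplicity_free K \<pi> \<longleftrightarrow>
     (\<forall>n \<tau>. irreducible_matrix_representation K n \<tau> \<longrightarrow> multiplicity_in K n \<tau> \<pi> \<in> {0, 1})"

end

theory Submission
  imports Defs "Jordan_Normal_Form.Spectral_Radius"
begin

text \<open>
  Gelfand's trick relative to \<open>K\<close>-types. The operators \<open>A\<^sub>g = \<integral> \<pi> (k g k\<inverse>) dk\<close> commute with \<open>K\<close>; if an
  anti-automorphism maps every \<open>g\<close> to a \<open>K\<close>-conjugate of itself, they also commute with each other.
  A common eigenvector of theirs in the finite-dimensional space of intertwiners of \<open>\<tau>\<close> generates
  \<open>\<pi>\<close>, and projecting its orbit to the first row of \<open>\<tau>\<close> stays in a line, so that the intertwiner is
  unique up to scalars. Minimizing \<open>\<integral> norm (k h)\<^sup>2 dk\<close> over isometries \<open>h\<close> of the indefinite form shows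
  that every maximal compact subgroup is conjugate to the standard one.

  For \<open>U(p,1)\<close> and \<open>O(p,1)\<close> the anti-automorphism comes from writing an isometry as a product of
  quasi-reflections, which yields an isometry fixing the negative axis and conjugating \<open>g\<close> to the
  (complex conjugate of the) inverse; in the real case its determinant has to be controlled as
  well. For \<open>SO\<^sub>0(2,2)\<close> the conjugating pair of rotations is computed from the blocks of \<open>g\<close>.
\<close>

no_notation Matrix.vec_index (infixl \<open>$\<close> 100)

text \<open>The conjugating element has to lie in \<open>K\<close>, not merely among the isometries,
  and this shapes the three cases. For \<open>SU\<close> a reversing isometry is rescaled by a
  scalar phase to have determinant one. In the real case of signature (p,1) no such rescaling is
  available; instead the determinant of the reversing isometry is arranged to be a sign that depends
  on p only. If this sign is negative, one fixed reflection \<open>e\<close> is built into the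
  anti-involution, which then sends g to the conjugate by \<open>e\<close> of the inverse of g. In
  signature (2,2) the standard maximal compact subgroup is a torus. Conjugation by its elements is
  trivial on it, so a suitable anti-involution must fix it pointwise; composing inversion with
  complex conjugation in both planes achieves this. The minimizer of the averaged norm is found
  among all isometries of the form and may lie outside the group. Conjugating by it is harmless
  because each of the groups is stable under conjugation by every isometry.\<close>

abbreviation mone :: "'a::semiring_1 ^ 'n ^ 'n" where
  "mone \<equiv> Finite_Cartesian_Product.mat 1"

section \<open>Invariant means on compact matrix groups\<close>

text \<open>Halmos-Vaughan induction on \<open>card A\<close>. If a proper nonempty subset
  \<open>S\<close> has exactly as many neighbours as elements, \<open>S\<close> and its complement
  are matched separately, the latter avoiding the neighbours of \<open>S\<close>. Otherwise every
  proper nonempty subset has a neighbour to spare, and one arbitrary pair can be removed. The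
  theorem serves to match minimal nets.\<close>

theorem hall_marriage:
  assumes "finite A" "\<And>a. a \<in> A \<Longrightarrow> finite (R a)"
    and "\<And>S. S \<subseteq> A \<Longrightarrow> card S \<le> card (\<Union>a\<in>S. R a)"
  shows "\<exists>f. inj_on f A \<and> (\<forall>a\<in>A. f a \<in> R a)"
  using assms
proof (induction "card A" arbitrary: A R rule: less_induct)
  case less
  note fin = less.prems(1,2) and hall = less.prems(3)
  show ?case
  proof (cases "A = {}")
    case False
    show ?thesis
    proof (cases "\<exists>S. S \<subset> A \<and> S \<noteq> {} \<and> card S = card (\<Union>a\<in>S. R a)")
      case True
      then obtain S where S: "S \<subset> A" "S \<noteq> {}" "card S = card (\<Union>a\<in>S. R a)" by blast
      define N where "N = (\<Union>a\<in>S. R a)"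
      have finS: "finite S" using S(1) fin(1) by (meson finite_subset psubset_imp_subset)
      have finN: "finite N" unfolding N_def using finS S(1) fin(2) by auto
      have lt: "card S < card A" using S(1) fin(1) by (simp add: psubset_card_mono)
      have "\<exists>f. inj_on f S \<and> (\<forall>a\<in>S. f a \<in> R a)"
        proof (rule less.hyps[OF lt finS])
        show "\<And>a. a \<in> S \<Longrightarrow> finite (R a)" using S(1) fin(2) by blast
        fix T assume "T \<subseteq> S"
        then show "card T \<le> card (\<Union>a\<in>T. R a)" using S(1) by (intro hall) blast
      qed
      then obtain f1 where f1: "inj_on f1 S" "\<forall>a\<in>S. f1 a \<in> R a" by blast
      have lt2: "card (A - S) < card A"
        using S fin(1) by (metis card_Diff_subset card_gt_0_iff diff_less finS lt not_less_zero psubset_imp_subset neq0_conv)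
      have "\<exists>f. inj_on f (A - S) \<and> (\<forall>a\<in>A - S. f a \<in> R a - N)"
      proof (rule less.hyps[OF lt2])
        show "finite (A - S)" using fin by simp
        show "\<And>a. a \<in> A - S \<Longrightarrow> finite (R a - N)" using fin by auto
        \<comment> \<open>Hall's condition for \<open>S \<union> T\<close>, minus the equality for
          \<open>S\<close>, leaves the condition for \<open>T\<close> after the neighbours of
          \<open>S\<close> are removed.\<close>
        fix T assume T: "T \<subseteq> A - S"
        have finT: "finite T" using T fin(1) by (meson finite_Diff finite_subset)
        have eq: "(\<Union>a\<in>S \<union> T. R a) = N \<union> (\<Union>a\<in>T. R a - N)" unfolding N_def by auto
        have "card S + card T = card (S \<union> T)"
          using T finS finT by (subst card_Un_disjoint) auto
        also have "\<dots> \<le> card (\<Union>a\<in>S \<union> T. R a)" using S(1) T by (intro hall) auto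
        also have "\<dots> \<le> card N + card (\<Union>a\<in>T. R a - N)" unfolding eq by (rule card_Un_le)
        finally show "card T \<le> card (\<Union>a\<in>T. R a - N)" using S(3) unfolding N_def by simp
      qed
      then obtain f2 where f2: "inj_on f2 (A - S)" "\<forall>a\<in>A - S. f2 a \<in> R a - N" by blast
      let ?f = "\<lambda>a. if a \<in> S then f1 a else f2 a"
      have "inj_on ?f A"
      proof (rule inj_onI)
        fix x y assume xy: "x \<in> A" "y \<in> A" "?f x = ?f y"
        have *: "\<And>z. z \<in> S \<Longrightarrow> f1 z \<in> N" using f1(2) N_def by auto
        show "x = y" using xy * f1(1) f2 by (auto split: if_splits dest: inj_onD) (metis Diff_iff)+
      qed
      moreover have "\<forall>a\<in>A. ?f a \<in> R a" using f1(2) f2(2) by auto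
      ultimately show ?thesis by blast
    next
      case tight: False
      obtain a where a: "a \<in> A" using False by blast
      have "card {a} \<le> card (\<Union>x\<in>{a}. R x)" using a by (intro hall) auto
      then obtain b where b: "b \<in> R a" by (metis SUP_insert Sup_empty card.empty card_1_singleton_iff image_empty not_one_le_zero sup_bot.right_neutral One_nat_def all_not_in_conv)
      have lt: "card (A - {a}) < card A" using card_Diff1_less[OF fin(1) a] .
      have "\<exists>f. inj_on f (A - {a}) \<and> (\<forall>x\<in>A - {a}. f x \<in> R x - {b})"
      proof (rule less.hyps[OF lt])
        show "finite (A - {a})" using fin by simp
        show "\<And>x. x \<in> A - {a} \<Longrightarrow> finite (R x - {b})" using fin by auto
        fix T assume T: "T \<subseteq> A - {a}"
        show "card T \<le> card (\<Union>x\<in>T. R x - {b})"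
        proof (cases "T = {}")
          case False
          have finT: "finite T" using T fin(1) by (meson finite_Diff finite_subset)
          have "T \<subset> A" using T a by blast
          then have "card T \<noteq> card (\<Union>a\<in>T. R a)" using tight False by blast
          then have "card T < card (\<Union>a\<in>T. R a)" using hall[of T] \<open>T \<subset> A\<close> by auto
          moreover have "(\<Union>x\<in>T. R x - {b}) = (\<Union>a\<in>T. R a) - {b}" by auto
          moreover have "finite (\<Union>a\<in>T. R a)" using finT T fin(2) by auto
          ultimately show ?thesis by (metis Diff_empty Diff_insert0 card_Diff_singleton less_Suc_eq_le Suc_pred card_gt_0_iff empty_iff less_imp_le One_nat_def)
        qed simp
      qed
      then obtain f where f: "inj_on f (A - {a})" "\<forall>x\<in>A - {a}. f x \<in> R x - {b}" by blast
      have "inj_on (f(a := b)) A" using f a by (auto simp: inj_on_def)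
      moreover have "\<forall>x\<in>A. (f(a := b)) x \<in> R x" using f b by auto
      ultimately show ?thesis by blast
    qed
  qed simp
qed

lemma continuous_on_matrix_mul [continuous_intros]:
  fixes f :: "'x::topological_space \<Rightarrow> 'a::real_normed_field ^ 'n::finite ^ 'm::finite"
    and g :: "'x \<Rightarrow> 'a ^ 'k::finite ^ 'n"
  assumes "continuous_on S f" "continuous_on S g"
  shows "continuous_on S (\<lambda>x. f x ** g x)"
  unfolding matrix_matrix_mult_def by (intro continuous_intros assms)

definition avg :: "'x set \<Rightarrow> ('x \<Rightarrow> 'b::real_vector) \<Rightarrow> 'b" where
  "avg N f = (1 / real (card N)) *\<^sub>R (\<Sum>x\<in>N. f x)"

lemma avg_norm_diff_le:
  fixes f g :: "'x \<Rightarrow> 'b::real_normed_vector"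
  assumes "\<And>x. x \<in> N \<Longrightarrow> norm (f x - g x) \<le> d" "d \<ge> 0"
  shows "norm (avg N f - avg N g) \<le> d"
proof (cases "card N = 0")
  case False
  have "norm (avg N f - avg N g) = (1 / real (card N)) * norm (\<Sum>x\<in>N. f x - g x)"
    by (simp add: avg_def sum_subtractf flip: scaleR_right_diff_distrib)
  also have "\<dots> \<le> (1 / real (card N)) * (real (card N) * d)"
    by (intro mult_left_mono sum_norm_bound assms) auto
  finally show ?thesis using False by simp
qed (use assms in \<open>simp add: avg_def\<close>)

lemma avg_const: "finite N \<Longrightarrow> N \<noteq> {} \<Longrightarrow> avg N (\<lambda>_. c) = c"
  by (simp add: avg_def sum_constant_scaleR)

lemma avg_swap: "avg N (\<lambda>x. avg N' (f x)) = avg N' (\<lambda>y. avg N (\<lambda>x. f x y))"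
  unfolding avg_def by (simp add: scaleR_sum_right mult.commute) (rule sum.swap)

lemma avg_image: "inj_on h N \<Longrightarrow> avg (h ` N) f = avg N (\<lambda>x. f (h x))"
  by (simp add: avg_def sum.reindex card_image)

section \<open>Minimal nets in a compact matrix group\<close>

locale compact_matrix_group =
  fixes K :: "('a::real_normed_field ^ 'n::finite ^ 'n) set"
  assumes compact: "compact K"
    and one_mem: "mone \<in> K"
    and mul_mem: "a \<in> K \<Longrightarrow> b \<in> K \<Longrightarrow> a ** b \<in> K"
    and ex_inv: "a \<in> K \<Longrightarrow> \<exists>b\<in>K. a ** b = mone \<and> b ** a = mone"
begin

text \<open>Quantifying over all two-sided translates makes closeness invariant under multiplication
  by \<open>K\<close> on either side, unlike the norm distance, which elements of \<open>K\<close>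
  may distort. Hence translates of nets are nets of the same scale.\<close>

definition near :: "real \<Rightarrow> 'a^'n^'n \<Rightarrow> 'a^'n^'n \<Rightarrow> bool" where
  "near e a b \<longleftrightarrow> (\<forall>k\<in>K. \<forall>l\<in>K. dist (k ** a ** l) (k ** b ** l) < e)"

lemma near_sym: "near e a b \<Longrightarrow> near e b a"
  by (simp add: near_def dist_commute)

lemma near_trans: "near d a b \<Longrightarrow> near e b c \<Longrightarrow> near (d + e) a c"
  unfolding near_def by (meson add_strict_mono dist_triangle le_less_trans)

lemma near_mul_left: "x \<in> K \<Longrightarrow> near e a b \<Longrightarrow> near e (x ** a) (x ** b)"
  unfolding near_def by (metis matrix_mul_assoc mul_mem)

lemma near_mul_right: "x \<in> K \<Longrightarrow> near e a b \<Longrightarrow> near e (a ** x) (b ** x)"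
  unfolding near_def by (metis matrix_mul_assoc mul_mem)

lemma near_imp_dist: "near e a b \<Longrightarrow> dist a b < e"
  unfolding near_def using one_mem by (metis matrix_mul_lid matrix_mul_rid)

text \<open>Uniform continuity of the triple product on the compact set K x K x K. Together with
  \<open>near_imp_dist\<close> this makes closeness in norm and \<open>near\<close>
  interchangeable.\<close>

lemma dist_imp_near:
  assumes "e > 0"
  obtains d where "d > 0" "\<And>a b. a \<in> K \<Longrightarrow> b \<in> K \<Longrightarrow> dist a b < d \<Longrightarrow> near e a b"
proof -
  have "uniformly_continuous_on (K \<times> K \<times> K) (\<lambda>(k, a, l). k ** a ** l)"
    unfolding case_prod_unfold
    by (intro compact_uniformly_continuous continuous_intros compact_Times compact)
  then obtain d where d: "d > 0" "\<And>p q. p \<in> K \<times> K \<times> K \<Longrightarrow> q \<in> K \<times> K \<times> K \<Longrightarrow> dist q p < d \<Longrightarrow>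
     dist ((\<lambda>(k, a, l). k ** a ** l) q) ((\<lambda>(k, a, l). k ** a ** l) p) < e"
    using assms unfolding uniformly_continuous_on_def by metis
  show thesis
  proof (rule that[OF d(1)])
    fix a b assume ab: "a \<in> K" "b \<in> K" "dist a b < d"
    show "near e a b" unfolding near_def
    proof (intro ballI)
      fix k l assume "k \<in> K" "l \<in> K"
      then show "dist (k ** a ** l) (k ** b ** l) < e"
        using d(2)[of "(k, b, l)" "(k, a, l)"] ab by (simp add: dist_prod_def)
    qed
  qed
qed

definition net :: "real \<Rightarrow> ('a^'n^'n) set \<Rightarrow> bool" where
  "net e N \<longleftrightarrow> finite N \<and> N \<subseteq> K \<and> (\<forall>x\<in>K. \<exists>y\<in>N. near e x y)"

text \<open>Counting the points of a smallest net is a finite substitute for Haar measure, because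
  translates of smallest nets are smallest nets.\<close>

definition minimal_net :: "real \<Rightarrow> ('a^'n^'n) set \<Rightarrow> bool" where
  "minimal_net e N \<longleftrightarrow> net e N \<and> (\<forall>N'. net e N' \<longrightarrow> card N \<le> card N')"

lemma net_ex: assumes "e > 0" shows "\<exists>N. net e N"
proof -
  obtain d where d: "d > 0" "\<And>a b. a \<in> K \<Longrightarrow> b \<in> K \<Longrightarrow> dist a b < d \<Longrightarrow> near e a b"
    using dist_imp_near[OF assms] by blast
  obtain N where N: "finite N" "N \<subseteq> K" "K \<subseteq> (\<Union>x\<in>N. ball x d)"
    using compactE_image[OF compact, of K "\<lambda>x. ball x d"] d(1) by (metis UN_I centre_in_ball open_ball subsetI)
  have "net e N" unfolding net_def
  proof (intro conjI ballI N)
    fix x assume "x \<in> K"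
    then obtain y where "y \<in> N" "dist y x < d" using N(3) by auto
    then show "\<exists>y\<in>N. near e x y" using d(2)[of x y] N(2) \<open>x \<in> K\<close> by (auto simp: dist_commute)
  qed
  then show ?thesis ..
qed

lemma minimal_net_ex: assumes "e > 0" shows "\<exists>N. minimal_net e N"
  using ex_has_least_nat[of "net e" _ card] net_ex[OF assms] unfolding minimal_net_def by blast

lemma minimal_netD:
  assumes "minimal_net e N"
  shows "finite N" "N \<subseteq> K" "N \<noteq> {}"
  using assms one_mem by (auto simp: minimal_net_def net_def)

lemma minimal_net_translate:
  assumes N: "minimal_net e N" and x: "x \<in> K"
  shows "minimal_net e ((**) x ` N)" "minimal_net e ((\<lambda>y. y ** x) ` N)"
    "inj_on ((**) x) N" "inj_on (\<lambda>y. y ** x) N"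
proof -
  obtain x' where x': "x' \<in> K" "x ** x' = mone" "x' ** x = mone" using ex_inv[OF x] by blast
  have c1: "x' ** (x ** y) = y" "x ** (x' ** y) = y" for y :: "'a^'n^'n"
    using x' by (simp_all add: matrix_mul_assoc)
  have c2: "y ** x ** x' = y" "y ** x' ** x = y" for y :: "'a^'n^'n"
    using x' by (simp_all flip: matrix_mul_assoc)
  show i: "inj_on ((**) x) N" "inj_on (\<lambda>y. y ** x) N"
    by (metis c1(1) inj_onI, metis c2(1) inj_onI)
  have n: "net e N" using N by (simp add: minimal_net_def)
  have "net e ((**) x ` N)" unfolding net_def
  proof (intro conjI ballI)
    fix z assume "z \<in> K"
    then obtain y where y: "y \<in> N" "near e (x' ** z) y"
      using n x' mul_mem unfolding net_def by meson
    show "\<exists>y\<in>(**) x ` N. near e z y" using near_mul_left[OF x y(2)] y(1) by (auto simp: c1)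
  qed (use n x mul_mem in \<open>auto simp: net_def\<close>)
  then show "minimal_net e ((**) x ` N)"
    using N by (simp add: minimal_net_def card_image[OF i(1)])
  have "net e ((\<lambda>y. y ** x) ` N)" unfolding net_def
  proof (intro conjI ballI)
    fix z assume "z \<in> K"
    then obtain y where y: "y \<in> N" "near e (z ** x') y"
      using n x' mul_mem unfolding net_def by meson
    show "\<exists>y\<in>(\<lambda>y. y ** x) ` N. near e z y" using near_mul_right[OF x y(2)] y(1) by (auto simp: c2)
  qed (use n x mul_mem in \<open>auto simp: net_def\<close>)
  then show "minimal_net e ((\<lambda>y. y ** x) ` N)"
    using N by (simp add: minimal_net_def card_image[OF i(2)])
qed

text \<open>
  Any two minimal nets are matched by a bijection moving points by at most \<open>2e\<close>: if some
  \<open>S \<subseteq> N\<close> had fewer neighbours than elements, replacing \<open>S\<close> by its neighbours would give a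
  smaller net, so Hall's condition holds.
\<close>

lemma minimal_nets_avg_close:
  fixes f :: "'a^'n^'n \<Rightarrow> 'b::real_normed_vector"
  assumes N: "minimal_net e N" and N': "minimal_net e N'" and e: "e > 0"
    and f: "\<And>a b. a \<in> K \<Longrightarrow> b \<in> K \<Longrightarrow> near (2 * e) a b \<Longrightarrow> norm (f a - f b) \<le> d" and d: "d \<ge> 0"
  shows "norm (avg N f - avg N' f) \<le> d"
proof -
  note D = minimal_netD[OF N] and D' = minimal_netD[OF N']
  let ?R = "\<lambda>a. {b \<in> N'. near (2 * e) a b}"
  have "\<exists>h. inj_on h N \<and> (\<forall>a\<in>N. h a \<in> ?R a)"
  proof (rule hall_marriage)
    fix S assume S: "S \<subseteq> N"
    let ?T = "(N - S) \<union> (\<Union>a\<in>S. ?R a)"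
    have fin: "finite S" "finite (\<Union>a\<in>S. ?R a)" using S D D' by (auto intro: finite_subset)
    have "net e ?T" unfolding net_def
    proof (intro conjI ballI)
      fix x assume x: "x \<in> K"
      obtain a where a: "a \<in> N" "near e x a" using N x by (auto simp: minimal_net_def net_def)
      show "\<exists>y\<in>?T. near e x y"
      proof (cases "a \<in> S")
        case True
        obtain b where b: "b \<in> N'" "near e x b" using N' x by (auto simp: minimal_net_def net_def)
        have "near (2 * e) a b" using near_trans[OF near_sym[OF a(2)] b(2)] by simp
        then show ?thesis using True b by blast
      qed (use a in blast)
    qed (use fin D D' in auto)
    then have "card N \<le> card ?T" using N by (simp add: minimal_net_def)
    also have "\<dots> \<le> card (N - S) + card (\<Union>a\<in>S. ?R a)" by (rule card_Un_le)
    also have "card (N - S) = card N - card S" using S fin by (simp add: card_Diff_subset)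
    finally show "card S \<le> card (\<Union>a\<in>S. ?R a)" using card_mono[OF D(1) S] by linarith
  qed (use D D' in auto)
  then obtain h where h: "inj_on h N" "\<And>a. a \<in> N \<Longrightarrow> h a \<in> N' \<and> near (2 * e) a (h a)" by auto
  have "card N = card N'" using N N' by (meson dual_order.antisym minimal_net_def)
  then have "h ` N = N'" using h D'(1) by (metis card_image card_subset_eq image_subsetI)
  then have "avg N' f = avg N (\<lambda>x. f (h x))" using avg_image[OF h(1)] by metis
  then show ?thesis using h D D' by (auto intro!: avg_norm_diff_le f d)
qed

text \<open>Nets of different scale may differ in size and cannot be matched directly. Both averages
  are therefore compared with the double average of \<open>f (x ** y)\<close>: for fixed
  \<open>y\<close> in \<open>N'\<close> it runs over a right translate of \<open>N\<close>, for
  fixed \<open>x\<close> in \<open>N\<close> over a left translate of \<open>N'\<close>, and these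
  are minimal nets of scale \<open>e\<close> and \<open>e'\<close>.\<close>

lemma avg_minimal_nets_close:
  fixes f :: "'a^'n^'n \<Rightarrow> 'b::real_normed_vector"
  assumes N: "minimal_net e N" and N': "minimal_net e' N'" and e: "e > 0" "e' > 0"
    and f: "\<And>a b. a \<in> K \<Longrightarrow> b \<in> K \<Longrightarrow> near (2 * e) a b \<Longrightarrow> norm (f a - f b) \<le> d" and d: "d \<ge> 0"
    and f': "\<And>a b. a \<in> K \<Longrightarrow> b \<in> K \<Longrightarrow> near (2 * e') a b \<Longrightarrow> norm (f a - f b) \<le> d'" and d': "d' \<ge> 0"
  shows "norm (avg N f - avg N' f) \<le> d + d'"
proof -
  note D = minimal_netD[OF N] and D' = minimal_netD[OF N']
  let ?D = "avg N (\<lambda>x. avg N' (\<lambda>y. f (x ** y)))"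
  have 1: "norm (avg N (\<lambda>x. f (x ** y)) - avg N f) \<le> d" if "y \<in> N'" for y
  proof -
    have y: "y \<in> K" using that D' by blast
    show ?thesis using minimal_nets_avg_close[OF minimal_net_translate(2)[OF N y] N e(1) f d]
      by (simp add: avg_image[OF minimal_net_translate(4)[OF N y]])
  qed
  have 2: "norm (avg N' (\<lambda>y. f (x ** y)) - avg N' f) \<le> d'" if "x \<in> N" for x
  proof -
    have y: "x \<in> K" using that D by blast
    show ?thesis using minimal_nets_avg_close[OF minimal_net_translate(1)[OF N' y] N' e(2) f' d']
      by (simp add: avg_image[OF minimal_net_translate(3)[OF N' y]])
  qed
  have "norm (?D - avg N f) \<le> d"
    using avg_norm_diff_le[of N' "\<lambda>y. avg N (\<lambda>x. f (x ** y))" "\<lambda>_. avg N f", OF 1 d] D'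
    by (simp add: avg_const avg_swap[of N])
  moreover have "norm (?D - avg N' f) \<le> d'"
    using avg_norm_diff_le[of N "\<lambda>x. avg N' (\<lambda>y. f (x ** y))" "\<lambda>_. avg N' f", OF 2 d'] D
    by (simp add: avg_const)
  ultimately show ?thesis
    using norm_triangle_le[of "avg N f - ?D" "?D - avg N' f" "d + d'"] by (simp add: norm_minus_commute)
qed

lemma continuous_imp_near:
  fixes f :: "'a^'n^'n \<Rightarrow> 'b::real_normed_vector"
  assumes "continuous_on K f" "d > 0"
  obtains e where "e > 0" "\<And>a b. a \<in> K \<Longrightarrow> b \<in> K \<Longrightarrow> near (2 * e) a b \<Longrightarrow> norm (f a - f b) \<le> d"
proof -
  have "uniformly_continuous_on K f" using assms(1) compact by (rule compact_uniformly_continuous)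
  then obtain e where e: "e > 0" "\<And>a b. a \<in> K \<Longrightarrow> b \<in> K \<Longrightarrow> dist b a < e \<Longrightarrow> dist (f b) (f a) < d"
    using assms(2) unfolding uniformly_continuous_on_def by metis
  show thesis
    using that[of "e/2"] e near_imp_dist[of e]
    by (metis dist_commute dist_norm field_sum_of_halves half_gt_zero less_imp_le mult_2)
qed

lemma near_mono: "near e a b \<Longrightarrow> e \<le> e' \<Longrightarrow> near e' a b"
  unfolding near_def by fastforce

section \<open>The mean as a limit over nets\<close>

definition std_net :: "nat \<Rightarrow> ('a^'n^'n) set" where
  "std_net n = (SOME N. minimal_net (inverse (real (Suc n))) N)"

lemma std_net: "minimal_net (inverse (real (Suc n))) (std_net n)"
  unfolding std_net_def by (rule someI_ex, rule minimal_net_ex) simp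

text \<open>On continuous functions with values in a Banach space this is the normalized Haar
  integral; for other arguments the limit may not exist.\<close>

definition mean :: "('a^'n^'n \<Rightarrow> 'b::real_normed_vector) \<Rightarrow> 'b" where
  "mean f = lim (\<lambda>n. avg (std_net n) f)"

lemma mean_tendsto:
  fixes f :: "'a^'n^'n \<Rightarrow> 'b::banach"
  assumes "continuous_on K f"
  shows "(\<lambda>n. avg (std_net n) f) \<longlonglongrightarrow> mean f"
proof -
  have "Cauchy (\<lambda>n. avg (std_net n) f)"
  proof (rule metric_CauchyI)
    fix r :: real assume r: "r > 0"
    obtain e where e: "e > 0" "\<And>a b. a \<in> K \<Longrightarrow> b \<in> K \<Longrightarrow> near (2 * e) a b \<Longrightarrow> norm (f a - f b) \<le> r/3"
      using continuous_imp_near[OF assms, of "r/3"] r by auto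
    obtain M where M: "inverse (real (Suc M)) < e" using reals_Archimedean[OF e(1)] by blast
    have *: "norm (f a - f b) \<le> r/3" if "m \<ge> M" "a \<in> K" "b \<in> K" "near (2 * inverse (real (Suc m))) a b" for a b m
    proof (rule e(2)[OF that(2,3) near_mono[OF that(4)]])
      have "inverse (real (Suc m)) \<le> inverse (real (Suc M))" using that(1) by (intro le_imp_inverse_le) auto
      then show "2 * inverse (real (Suc m)) \<le> 2 * e" using M by linarith
    qed
    have "dist (avg (std_net m) f) (avg (std_net n) f) < r" if mn: "m \<ge> M" "n \<ge> M" for m n
    proof -
      have "norm (avg (std_net m) f - avg (std_net n) f) \<le> r/3 + r/3"
        using r by (intro avg_minimal_nets_close[OF std_net std_net] *[OF mn(1)] *[OF mn(2)]) auto
      then show ?thesis using r by (simp add: dist_norm)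
    qed
    then show "\<exists>M. \<forall>m\<ge>M. \<forall>n\<ge>M. dist (avg (std_net m) f) (avg (std_net n) f) < r" by blast
  qed
  then show ?thesis unfolding mean_def using Cauchy_convergent_iff convergent_LIMSEQ_iff by blast
qed

text \<open>Any minimal net computes the mean up to the oscillation of \<open>f\<close> at its
  scale, not only the chosen nets \<open>std_net n\<close>. This independence of the choice is what
  yields invariance.\<close>

lemma mean_approx:
  fixes f :: "'a^'n^'n \<Rightarrow> 'b::banach"
  assumes f: "continuous_on K f" and N: "minimal_net e N" and e: "e > 0"
    and b: "\<And>a b. a \<in> K \<Longrightarrow> b \<in> K \<Longrightarrow> near (2 * e) a b \<Longrightarrow> norm (f a - f b) \<le> d" and d: "d \<ge> 0"
  shows "norm (mean f - avg N f) \<le> d"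
proof (rule field_le_epsilon)
  fix r :: real assume r: "r > 0"
  obtain e' where e': "e' > 0" "\<And>a b. a \<in> K \<Longrightarrow> b \<in> K \<Longrightarrow> near (2 * e') a b \<Longrightarrow> norm (f a - f b) \<le> r/2"
    using continuous_imp_near[OF f, of "r/2"] r by auto
  have ev1: "\<forall>\<^sub>F n in sequentially. inverse (real (Suc n)) < e'"
    using order_tendstoD(2)[OF LIMSEQ_inverse_real_of_nat e'(1)] by simp
  have ev2: "\<forall>\<^sub>F n in sequentially. dist (avg (std_net n) f) (mean f) < r/2"
    by (rule tendstoD[OF mean_tendsto[OF f]]) (use r in simp)
  obtain n where n: "inverse (real (Suc n)) < e'" "dist (avg (std_net n) f) (mean f) < r/2"
    using eventually_happens'[OF _ eventually_conj[OF ev1 ev2]] by auto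
  have "norm (avg (std_net n) f - avg N f) \<le> r/2 + d"
  proof (intro avg_minimal_nets_close[OF std_net N _ e _ _ b d])
    fix a b assume "a \<in> K" "b \<in> K" "near (2 * inverse (real (Suc n))) a b"
    then show "norm (f a - f b) \<le> r/2" using n(1) by (intro e'(2)) (auto elim: near_mono)
  qed (use r in auto)
  then show "norm (mean f - avg N f) \<le> d + r"
    using n(2) norm_triangle_le[of "mean f - avg (std_net n) f" "avg (std_net n) f - avg N f" "d + r"]
    by (simp add: dist_norm norm_minus_commute)
qed

lemma mean_cong: "(\<And>k. k \<in> K \<Longrightarrow> f k = g k) \<Longrightarrow> mean f = mean g"
proof -
  assume "\<And>k. k \<in> K \<Longrightarrow> f k = g k"
  then have "avg (std_net n) f = avg (std_net n) g" for n
    unfolding avg_def using minimal_netD(2)[OF std_net] by (metis (no_types, lifting) subsetD sum.cong)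
  then show ?thesis by (simp add: mean_def)
qed

lemma mean_const [simp]: "mean (\<lambda>_. c :: 'b::banach) = c"
  using minimal_netD[OF std_net] by (simp add: mean_def avg_const)

lemma mean_add:
  fixes f g :: "'a^'n^'n \<Rightarrow> 'b::banach"
  assumes "continuous_on K f" "continuous_on K g"
  shows "mean (\<lambda>k. f k + g k) = mean f + mean g"
proof (rule LIMSEQ_unique[OF mean_tendsto])
  show "(\<lambda>n. avg (std_net n) (\<lambda>k. f k + g k)) \<longlonglongrightarrow> mean f + mean g"
    using tendsto_add[OF mean_tendsto mean_tendsto, OF assms]
    by (simp add: avg_def sum.distrib scaleR_add_right)
qed (intro continuous_intros assms)

lemma mean_linear:
  fixes f :: "'a^'n^'n \<Rightarrow> 'b::banach" and L :: "'b \<Rightarrow> 'c::banach"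
  assumes "continuous_on K f" "bounded_linear L"
  shows "mean (\<lambda>k. L (f k)) = L (mean f)"
proof (rule LIMSEQ_unique[OF mean_tendsto])
  interpret L: bounded_linear L by fact
  show "(\<lambda>n. avg (std_net n) (\<lambda>k. L (f k))) \<longlonglongrightarrow> L (mean f)"
    using L.tendsto[OF mean_tendsto[OF assms(1)]]
    by (simp add: avg_def L.scaleR L.sum)
  show "continuous_on K (\<lambda>k. L (f k))" using assms(1) L.continuous_on by blast
qed

lemma mean_sum:
  fixes f :: "'i \<Rightarrow> 'a^'n^'n \<Rightarrow> 'b::banach"
  assumes "finite A" "\<And>i. i \<in> A \<Longrightarrow> continuous_on K (f i)"
  shows "mean (\<lambda>k. \<Sum>i\<in>A. f i k) = (\<Sum>i\<in>A. mean (f i))"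
  using assms
proof (induction A rule: finite_induct)
  case (insert x F)
  then show ?case by (simp add: mean_add continuous_on_sum)
qed simp

lemma mean_mono:
  fixes f g :: "'a^'n^'n \<Rightarrow> real"
  assumes "continuous_on K f" "continuous_on K g" "\<And>k. k \<in> K \<Longrightarrow> f k \<le> g k"
  shows "mean f \<le> mean g"
proof (rule LIMSEQ_le[OF mean_tendsto[OF assms(1)] mean_tendsto[OF assms(2)]])
  have "avg (std_net n) f \<le> avg (std_net n) g" for n
    unfolding avg_def using minimal_netD(2)[OF std_net[of n]]
    by (intro scaleR_left_mono sum_mono assms(3)) auto
  then show "\<exists>N. \<forall>n\<ge>N. avg (std_net n) f \<le> avg (std_net n) g" by blast
qed

lemma mean_norm_le:
  fixes f :: "'a^'n^'n \<Rightarrow> 'b::banach"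
  assumes "continuous_on K f" "\<And>k. k \<in> K \<Longrightarrow> norm (f k) \<le> c"
  shows "norm (mean f) \<le> c"
proof (rule LIMSEQ_le_const2[OF tendsto_norm[OF mean_tendsto[OF assms(1)]]])
  have "c \<ge> 0" using assms(2)[OF one_mem] norm_ge_zero order_trans by blast
  moreover have "\<And>x. x \<in> std_net n \<Longrightarrow> norm (f x - 0) \<le> c" for n
    using assms(2) minimal_netD(2)[OF std_net[of n]] by auto
  ultimately have "norm (avg (std_net n) f - avg (std_net n) (\<lambda>_. 0)) \<le> c" for n
    by (intro avg_norm_diff_le)
  then show "\<exists>N. \<forall>n\<ge>N. norm (avg (std_net n) f) \<le> c" by (simp add: avg_def)
qed

text \<open>The common core of left and right invariance: averaging a translated function over a
  minimal net is averaging the function itself over the translated net, which is minimal of the same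
  scale.\<close>

lemma mean_unique_translate:
  fixes f :: "'a^'n^'n \<Rightarrow> 'b::banach"
  assumes f: "continuous_on K f" and g: "continuous_on K g"
    and *: "\<And>e N. e > 0 \<Longrightarrow> minimal_net e N \<Longrightarrow> \<exists>N'. minimal_net e N' \<and> avg N g = avg N' f"
  shows "mean g = mean f"
proof -
  have "norm (mean g - mean f) \<le> r" if r: "r > 0" for r
  proof -
    obtain e1 where e1: "e1 > 0" "\<And>a b. a \<in> K \<Longrightarrow> b \<in> K \<Longrightarrow> near (2 * e1) a b \<Longrightarrow> norm (f a - f b) \<le> r/2"
      using continuous_imp_near[OF f, of "r/2"] r by auto
    obtain e2 where e2: "e2 > 0" "\<And>a b. a \<in> K \<Longrightarrow> b \<in> K \<Longrightarrow> near (2 * e2) a b \<Longrightarrow> norm (g a - g b) \<le> r/2"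
      using continuous_imp_near[OF g, of "r/2"] r by auto
    define e where "e = min e1 e2"
    have e: "e > 0" "2 * e \<le> 2 * e1" "2 * e \<le> 2 * e2" using e1 e2 e_def by simp_all
    obtain N where N: "minimal_net e N" using minimal_net_ex[OF e(1)] by blast
    obtain N' where N': "minimal_net e N'" "avg N g = avg N' f" using *[OF e(1) N] by blast
    have "norm (mean g - avg N g) \<le> r/2"
      using r e by (intro mean_approx[OF g N e(1)] e2(2)) (auto elim: near_mono)
    moreover have "norm (mean f - avg N' f) \<le> r/2"
      using r e by (intro mean_approx[OF f N'(1) e(1)] e1(2)) (auto elim: near_mono)
    ultimately show ?thesis
      using N'(2) norm_triangle_le[of "mean g - avg N g" "avg N g - mean f" r]
      by (simp add: norm_minus_commute)
  qed
  then have "norm (mean g - mean f) \<le> 0" by (rule field_le_epsilon[of _ 0, simplified])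
  then show ?thesis by simp
qed

lemma continuous_on_translate:
  fixes f :: "'a^'n^'n \<Rightarrow> 'b::topological_space"
  assumes "continuous_on K f" "a \<in> K"
  shows "continuous_on K (\<lambda>k. f (a ** k))" "continuous_on K (\<lambda>k. f (k ** a))"
  by (rule continuous_on_compose2[OF assms(1)]; use assms(2) in \<open>auto intro!: continuous_intros mul_mem\<close>)+

lemma mean_mul_left:
  fixes f :: "'a^'n^'n \<Rightarrow> 'b::banach"
  assumes "continuous_on K f" "a \<in> K"
  shows "mean (\<lambda>k. f (a ** k)) = mean f"
  using avg_image[OF minimal_net_translate(3)[OF _ assms(2)], symmetric]
    minimal_net_translate(1)[OF _ assms(2)]
  by (intro mean_unique_translate assms continuous_on_translate) blast

lemma mean_mul_right:
  fixes f :: "'a^'n^'n \<Rightarrow> 'b::banach"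
  assumes "continuous_on K f" "a \<in> K"
  shows "mean (\<lambda>k. f (k ** a)) = mean f"
  using avg_image[OF minimal_net_translate(4)[OF _ assms(2)], symmetric]
    minimal_net_translate(2)[OF _ assms(2)]
  by (intro mean_unique_translate assms continuous_on_translate) blast

lemma continuous_on_mean:
  fixes f :: "'x::topological_space \<Rightarrow> 'a^'n^'n \<Rightarrow> 'b::banach"
  assumes "continuous_on (X \<times> K) (\<lambda>(x, k). f x k)"
  shows "continuous_on X (\<lambda>x. mean (f x))"
  unfolding continuous_on_topological
proof (intro ballI allI impI)
  have cf: "continuous_on K (f x)" if "x \<in> X" for x
  proof -
    have "continuous_on K (\<lambda>k. case (x, k) of (x, k) \<Rightarrow> f x k)"
      by (rule continuous_on_compose2[OF assms continuous_on_Pair[OF continuous_on_const continuous_on_id]])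
        (use that in blast)
    then show ?thesis by simp
  qed
  fix x B assume x: "x \<in> X" and B: "open B" "mean (f x) \<in> B"
  obtain e where e: "e > 0" "ball (mean (f x)) e \<subseteq> B" using B openE by blast
  have e2: "e / 2 > 0" using e by simp
  obtain X0 where X0: "x \<in> X0" "open X0" "\<forall>y\<in>X0 \<inter> X. \<forall>t\<in>K. dist (f y t) (f x t) \<le> e/2"
    by (rule continuous_on_prod_compactE[OF assms compact x e2])
      (rule that, assumption, assumption, simp only: prod.case)
  show "\<exists>A. open A \<and> x \<in> A \<and> (\<forall>y\<in>X. y \<in> A \<longrightarrow> mean (f y) \<in> B)"
  proof (intro exI[of _ X0] conjI ballI impI X0)
    fix y assume y: "y \<in> X" "y \<in> X0"
    have c: "continuous_on K (\<lambda>k. - f x k)" by (intro continuous_intros cf x)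
    have "mean (\<lambda>k. f y k + - f x k) = mean (f y) - mean (f x)"
      using mean_linear[OF cf[OF x] bounded_linear_minus[OF bounded_linear_ident]]
      by (subst mean_add[OF cf[OF y(1)] c]) simp
    moreover have "norm (mean (\<lambda>k. f y k + - f x k)) \<le> e/2"
      using X0(3) y by (intro mean_norm_le continuous_intros cf x) (auto simp: dist_norm)
    ultimately have "dist (mean (f x)) (mean (f y)) < e"
      using e by (simp add: dist_norm norm_minus_commute)
    then show "mean (f y) \<in> B" using e(2) by auto
  qed
qed

text \<open>For a fine enough minimal net \<open>N\<close>, both iterated means are close to the
  double average over \<open>N\<close>, where the order of the two finite sums is immaterial. The
  bound \<open>gen\<close> is applied once in each order.\<close>

lemma mean_swap:
  fixes f :: "'a^'n^'n \<Rightarrow> 'a^'n^'n \<Rightarrow> 'b::banach"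
  assumes "continuous_on (K \<times> K) (\<lambda>(x, y). f x y)"
  shows "mean (\<lambda>x. mean (\<lambda>y. f x y)) = mean (\<lambda>y. mean (\<lambda>x. f x y))"
proof -
  have c': "continuous_on (K \<times> K) (\<lambda>(y, x). f x y)"
  proof -
    have "continuous_on (K \<times> K) ((\<lambda>(x, y). f x y) \<circ> prod.swap)"
      by (rule continuous_on_compose[OF continuous_on_swap]) (simp only: product_swap assms)
    then show ?thesis by (rule back_subst[of "continuous_on (K \<times> K)"]) auto
  qed
  have gen: "norm (mean (\<lambda>x. mean (\<lambda>y. g x y)) - avg N (\<lambda>x. avg N (\<lambda>y. g x y))) \<le> 2 * r"
    if c: "continuous_on (K \<times> K) (\<lambda>(x, y). g x y)" and N: "minimal_net e N" and e: "e > 0" and r: "r > 0"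
      and b: "\<And>a b a' b'. a \<in> K \<Longrightarrow> b \<in> K \<Longrightarrow> a' \<in> K \<Longrightarrow> b' \<in> K \<Longrightarrow> near (2 * e) a b \<Longrightarrow> near (2 * e) a' b'
         \<Longrightarrow> norm (g a a' - g b b') \<le> r"
    for g :: "'a^'n^'n \<Rightarrow> 'a^'n^'n \<Rightarrow> 'b" and e N r
  proof -
    have refl: "near (2 * e) a a" for a using e by (simp add: near_def)
    have cg: "continuous_on K (g x)" if "x \<in> K" for x
    proof -
      have "continuous_on K (\<lambda>k. case (x, k) of (x, k) \<Rightarrow> g x k)"
        by (rule continuous_on_compose2[OF c continuous_on_Pair[OF continuous_on_const continuous_on_id]])
          (use that in blast)
      then show ?thesis by simp
    qed
    have 1: "norm (mean (g x) - avg N (g x)) \<le> r" if "x \<in> K" for x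
      using r refl that by (intro mean_approx[OF cg N e]) (auto intro: b)
    have 2: "norm (mean (\<lambda>x. mean (g x)) - avg N (\<lambda>x. mean (g x))) \<le> r"
    proof (intro mean_approx[OF continuous_on_mean[OF c] N e])
      fix a a' assume a: "a \<in> K" "a' \<in> K" "near (2 * e) a a'"
      have "mean (\<lambda>k. g a k + - g a' k) = mean (g a) - mean (g a')"
        using mean_linear[OF cg[OF a(2)] bounded_linear_minus[OF bounded_linear_ident]]
        by (subst mean_add[OF cg[OF a(1)]]) (auto intro!: continuous_intros cg a)
      moreover have "norm (mean (\<lambda>k. g a k + - g a' k)) \<le> r"
        using a refl by (intro mean_norm_le continuous_intros cg) (auto intro!: b)
      ultimately show "norm (mean (g a) - mean (g a')) \<le> r" by simp
    qed (use r in auto)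
    have 3: "norm (avg N (\<lambda>x. mean (g x)) - avg N (\<lambda>x. avg N (g x))) \<le> r"
      using 1 minimal_netD(2)[OF N] r by (intro avg_norm_diff_le) auto
    show ?thesis using norm_triangle_mono[OF 2 3] by simp
  qed
  have "norm (mean (\<lambda>x. mean (\<lambda>y. f x y)) - mean (\<lambda>y. mean (\<lambda>x. f x y))) \<le> 0"
  proof (rule field_le_epsilon)
    fix r :: real assume "r > 0"
    then have r: "r / 4 > 0" by simp
    have "uniformly_continuous_on (K \<times> K) (\<lambda>(x, y). f x y)"
      using assms compact_Times[OF compact compact] by (rule compact_uniformly_continuous)
    then obtain d where d: "d > 0" "\<And>p q. p \<in> K \<times> K \<Longrightarrow> q \<in> K \<times> K \<Longrightarrow> dist q p < d \<Longrightarrow>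
       dist ((\<lambda>(x, y). f x y) q) ((\<lambda>(x, y). f x y) p) < r/4"
      using r unfolding uniformly_continuous_on_def by metis
    define e where "e = d / 4"
    have e: "e > 0" using d e_def by simp
    have b: "norm (f a a' - f b b') \<le> r/4" if "a \<in> K" "b \<in> K" "a' \<in> K" "b' \<in> K" "near (2 * e) a b" "near (2 * e) a' b'"
      for a b a' b'
    proof -
      have "dist (a, a') (b, b') \<le> dist a b + dist a' b'"
        unfolding dist_prod_def by (simp add: sqrt_sum_squares_le_sum)
      then have "dist (a, a') (b, b') < d" using near_imp_dist[OF that(5)] near_imp_dist[OF that(6)] e_def by simp
      then show ?thesis using d(2)[of "(b, b')" "(a, a')"] that by (simp add: dist_norm)
    qed
    obtain N where N: "minimal_net e N" using minimal_net_ex[OF e] by blast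
    have 1: "norm (mean (\<lambda>x. mean (\<lambda>y. f x y)) - avg N (\<lambda>x. avg N (\<lambda>y. f x y))) \<le> 2 * (r/4)"
      by (rule gen[OF assms N e r b])
    have 2: "norm (mean (\<lambda>y. mean (\<lambda>x. f x y)) - avg N (\<lambda>y. avg N (\<lambda>x. f x y))) \<le> 2 * (r/4)"
      by (rule gen[OF c' N e r b])
    have swapped: "norm (avg N (\<lambda>x. avg N (\<lambda>y. f x y)) - mean (\<lambda>y. mean (\<lambda>x. f x y))) \<le> 2 * (r/4)"
      using 2 by (subst avg_swap, subst norm_minus_commute)
    show "norm (mean (\<lambda>x. mean (\<lambda>y. f x y)) - mean (\<lambda>y. mean (\<lambda>x. f x y))) \<le> 0 + r"
      using norm_triangle_mono[OF 1 swapped] by simp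
  qed
  then show ?thesis by simp
qed

end

section \<open>Commuting operators on a finite-dimensional complex space\<close>

context
  fixes scale :: "complex \<Rightarrow> 'b::ab_group_add \<Rightarrow> 'b"
  assumes vs: "Vector_Spaces.vector_space scale"
begin

interpretation V: Vector_Spaces.vector_space scale by (rule vs)

definition linear_operator_on :: "'b set \<Rightarrow> ('b \<Rightarrow> 'b) \<Rightarrow> bool" where
  "linear_operator_on S f \<longleftrightarrow>
     (\<forall>x\<in>S. f x \<in> S) \<and> (\<forall>x\<in>S. \<forall>y\<in>S. f (x + y) = f x + f y) \<and> (\<forall>c. \<forall>x\<in>S. f (scale c x) = scale c (f x))"

text \<open>By the fundamental theorem of algebra \<open>p\<close> has a linear factor with root
  \<open>c\<close>. Either \<open>f x - scale c x\<close> vanishes and \<open>x\<close> is an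
  eigenvector, or it is a nonzero vector annihilated by the cofactor \<open>q\<close>, of smaller
  degree. No basis or determinant is involved.\<close>

lemma annihilated_imp_eigenvector:
  assumes S: "V.subspace S" and f: "linear_operator_on S f"
    and "x \<in> S" "x \<noteq> 0" "p \<noteq> 0" "(\<Sum>i\<le>degree p. scale (coeff p i) ((f ^^ i) x)) = 0"
  shows "\<exists>c v. v \<in> S \<and> v \<noteq> 0 \<and> f v = scale c v"
  using assms(3-)
proof (induction "degree p" arbitrary: p x rule: less_induct)
  case less
  have fS: "f y \<in> S" if "y \<in> S" for y using f that by (simp add: linear_operator_on_def)
  have diff: "f (y - z) = f y - f z" if "y \<in> S" "z \<in> S" for y z
  proof -
    have "f ((y - z) + z) = f (y - z) + f z"
      using f that V.subspace_diff[OF S] by (simp only: linear_operator_on_def)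
    then show ?thesis by simp
  qed
  have pow: "(f ^^ i) y \<in> S" if "y \<in> S" for i y using that by (induction i) (auto intro: fS)
  show ?case
  proof (cases "degree p = 0")
    case True
    then have "scale (coeff p 0) x = 0" using less.prems(4) by simp
    then show ?thesis using less.prems(2,3) True by (metis V.scale_eq_0_iff leading_coeff_0_iff)
  next
    case False
    then have "\<not> constant (poly p)" by (simp add: constant_degree)
    then obtain c where "poly p c = 0" using fundamental_theorem_of_algebra by blast
    then obtain q where q: "p = [:- c, 1:] * q" by (meson dvdE poly_eq_0_iff_dvd)
    have q0: "q \<noteq> 0" using q less.prems(3) by auto
    have dp: "degree p = Suc (degree q)" unfolding q using q0 by (subst degree_mult_eq) auto
    define y where "y = f x - scale c x"
    have y: "y \<in> S" unfolding y_def using S less.prems(1) fS V.subspace_diff V.subspace_scale by blast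
    have fpow: "(f ^^ i) y = (f ^^ Suc i) x - scale c ((f ^^ i) x)" for i
    proof (induction i)
      case (Suc i)
      have "(f ^^ Suc i) y = f ((f ^^ Suc i) x - scale c ((f ^^ i) x))" using Suc by simp
      also have "\<dots> = f ((f ^^ Suc i) x) - f (scale c ((f ^^ i) x))"
        using pow[OF less.prems(1)] V.subspace_scale[OF S] by (intro diff) blast+
      finally show ?case using f pow[OF less.prems(1), of i] by (simp add: linear_operator_on_def)
    qed (simp add: y_def)
    show ?thesis
    proof (cases "y = 0")
      case True
      then show ?thesis using less.prems(1,2) y_def by auto
    next
      case False
      have cp: "coeff p i = (if i = 0 then 0 else coeff q (i - 1)) - c * coeff q i" for i
        unfolding q by (cases i) (simp_all)
      have cq: "coeff q (Suc (degree q)) = 0" by (simp add: coeff_eq_0)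
      have "(\<Sum>i\<le>degree q. scale (coeff q i) ((f ^^ i) y))
          = (\<Sum>i\<le>degree q. scale (coeff q i) ((f ^^ Suc i) x)) - (\<Sum>i\<le>degree q. scale (c * coeff q i) ((f ^^ i) x))"
        unfolding fpow by (simp add: V.scale_right_diff_distrib sum_subtractf mult.commute)
      also have "(\<Sum>i\<le>degree q. scale (coeff q i) ((f ^^ Suc i) x))
          = (\<Sum>i\<le>Suc (degree q). scale (if i = 0 then 0 else coeff q (i - 1)) ((f ^^ i) x))"
        by (subst sum.atMost_Suc_shift) simp
      also have "(\<Sum>i\<le>degree q. scale (c * coeff q i) ((f ^^ i) x))
          = (\<Sum>i\<le>Suc (degree q). scale (c * coeff q i) ((f ^^ i) x))"
        using cq by simp
      also have "(\<Sum>i\<le>Suc (degree q). scale (if i = 0 then 0 else coeff q (i - 1)) ((f ^^ i) x))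
          - (\<Sum>i\<le>Suc (degree q). scale (c * coeff q i) ((f ^^ i) x))
          = (\<Sum>i\<le>degree p. scale (coeff p i) ((f ^^ i) x))"
        unfolding dp cp by (simp add: V.scale_left_diff_distrib sum_subtractf)
      finally have "(\<Sum>i\<le>degree q. scale (coeff q i) ((f ^^ i) y)) = 0" using less.prems(4) by simp
      then show ?thesis using less.hyps[of q y] dp y False q0 by simp
    qed
  qed
qed

lemma ex_annihilating_poly:
  assumes fin: "finite B" and B: "\<And>i. (f ^^ i) x \<in> V.span B"
  shows "\<exists>p. p \<noteq> 0 \<and> (\<Sum>i\<le>degree p. scale (coeff p i) ((f ^^ i) x)) = 0"
proof -
  let ?g = "\<lambda>i. (f ^^ i) x"
  obtain n a where a: "(\<Sum>i\<le>n. scale (a i) (?g i)) = 0" "\<exists>i\<le>n. a i \<noteq> 0"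
  \<comment> \<open>Dependence is a notion for sets of vectors, so coinciding iterates form a case
    of their own; the relation is then their difference. Otherwise \<open>card B + 1\<close>
    distinct vectors in the span of \<open>B\<close> are dependent.\<close>
  proof (cases "inj_on ?g {..card B}")
    case True
    have "card (?g ` {..card B}) = Suc (card B)" using card_image[OF True] by simp
    then have "V.dependent (?g ` {..card B})"
      using V.independent_span_bound[OF fin, of "?g ` {..card B}"] B by auto
    then obtain u v where u: "v \<in> ?g ` {..card B}" "u v \<noteq> 0" "(\<Sum>v\<in>?g ` {..card B}. scale (u v) v) = 0"
      by (auto simp: V.dependent_finite)
    show thesis
      by (rule that[of "u \<circ> ?g" "card B"]) (use u True in \<open>auto simp: sum.reindex\<close>)
  next
    case False
    then obtain i j where ij: "i \<le> card B" "j \<le> card B" "i \<noteq> j" "?g i = ?g j" by (auto simp: inj_on_def)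
    let ?a = "\<lambda>k. if k = i then 1 else if k = j then -1 else 0 :: complex"
    have "(\<Sum>k\<le>card B. scale (?a k) (?g k)) = (\<Sum>k\<in>{i, j}. scale (?a k) (?g k))"
      using ij by (intro sum.mono_neutral_right) auto
    also have "\<dots> = 0" using ij by simp
    finally show thesis using ij by (intro that[of ?a "card B"] exI[of _ i]) auto
  qed
  define p where "p = (\<Sum>i\<le>n. monom (a i) i)"
  have cf: "coeff p i = (if i \<le> n then a i else 0)" for i
    unfolding p_def coeff_sum by (simp add: sum.delta)
  have "p \<noteq> 0" using a(2) cf by (metis coeff_0)
  have "degree p \<le> n" unfolding p_def by (intro degree_sum_le) (auto intro: order_trans[OF degree_monom_le])
  then have "(\<Sum>i\<le>degree p. scale (coeff p i) (?g i)) = (\<Sum>i\<le>n. scale (coeff p i) (?g i))"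
    by (intro sum.mono_neutral_left) (auto simp: coeff_eq_0)
  also have "\<dots> = 0" using a(1) cf by simp
  finally show ?thesis using \<open>p \<noteq> 0\<close> by blast
qed

text \<open>If a nonzero \<open>x\<close> is not an eigenvector of some \<open>f\<close> in
  \<open>F\<close>, then an eigenspace of \<open>f\<close> in \<open>S\<close> is nonzero, misses
  \<open>x\<close> and is preserved by everything commuting with \<open>f\<close>. Induction on the
  dimension of \<open>S\<close> rather than on \<open>F\<close> copes with infinitely many
  operators.\<close>

lemma ex_common_eigenvector:
  assumes "V.subspace S" "S \<noteq> {0}" "finite B" "S \<subseteq> V.span B"
    and "\<And>f. f \<in> F \<Longrightarrow> linear_operator_on S f"
    and comm: "\<And>f g x. f \<in> F \<Longrightarrow> g \<in> F \<Longrightarrow> x \<in> S \<Longrightarrow> f (g x) = g (f x)"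
  shows "\<exists>v\<in>S. v \<noteq> 0 \<and> (\<forall>f\<in>F. \<exists>c. f v = scale c v)"
  using assms
proof (induction "V.dim S" arbitrary: S rule: less_induct)
  case less
  note S = less.prems(1) and ne = less.prems(2) and fin = less.prems(3,4) and lin = less.prems(5) and cm = less.prems(6)
  obtain x where x: "x \<in> S" "x \<noteq> 0" using ne V.subspace_0[OF S] by auto
  show ?case
  proof (cases "\<forall>f\<in>F. \<exists>c. f x = scale c x")
    case False
    then obtain f where f: "f \<in> F" "\<And>c. f x \<noteq> scale c x" by blast
    have fS: "f y \<in> S" if "y \<in> S" for y using lin[OF f(1)] that by (simp add: linear_operator_on_def)
    have "(f ^^ i) x \<in> S" for i using x(1) by (induction i) (auto intro: fS)
    then have "(f ^^ i) x \<in> V.span B" for i using fin(2) by blast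
    from ex_annihilating_poly[OF fin(1) this]
    obtain p where p: "p \<noteq> 0" "(\<Sum>i\<le>degree p. scale (coeff p i) ((f ^^ i) x)) = 0" by (elim exE conjE)
    obtain c v where v: "v \<in> S" "v \<noteq> 0" "f v = scale c v"
      using annihilated_imp_eigenvector[OF S lin[OF f(1)] x p] by (elim exE conjE)
    define E where "E = {y \<in> S. f y = scale c y}"
    have subE: "V.subspace E"
      using S lin[OF f(1)] V.subspace_0[OF S] lin[OF f(1), unfolded linear_operator_on_def, THEN conjunct2, THEN conjunct2, rule_format, of 0 0]
      by (auto simp: V.subspace_def E_def linear_operator_on_def V.scale_right_distrib V.scale_left_commute)
    have ES: "E \<subseteq> S" by (auto simp: E_def)
    have xE: "x \<notin> E" using f(2) by (auto simp: E_def)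
    obtain C where C: "C \<subseteq> E" "V.independent C" "E \<subseteq> V.span C" "card C = V.dim E" using V.basis_exists by blast
    obtain D where D: "D \<subseteq> S" "V.independent D" "S \<subseteq> V.span D" "card D = V.dim S" using V.basis_exists by blast
    have finD: "finite D" using V.independent_span_bound[OF fin(1) D(2)] D(1) fin(2) by blast
    have xC: "x \<notin> V.span C" using V.span_minimal[OF C(1) subE] xE by blast
    have "V.independent (insert x C)" using C(2) xC by (rule V.independent_insertI[rotated])
    moreover have "insert x C \<subseteq> V.span D" using x(1) C(1) ES D(3) by blast
    ultimately have 1: "finite (insert x C) \<and> card (insert x C) \<le> card D" by (rule V.independent_span_bound[OF finD])
    have "x \<notin> C" using xC V.span_superset by blast
    then have lt: "V.dim E < V.dim S" using 1 C(4) D(4) by auto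
    have "\<exists>v\<in>E. v \<noteq> 0 \<and> (\<forall>f\<in>F. \<exists>c. f v = scale c v)"
    proof (rule less.hyps[OF lt subE _ fin(1)])
      show "E \<noteq> {0}" using v by (auto simp: E_def)
      show "E \<subseteq> V.span B" using ES fin(2) by blast
      show "f' (g y) = g (f' y)" if "f' \<in> F" "g \<in> F" "y \<in> E" for f' g y using cm that ES by blast
      show "linear_operator_on E g" if g: "g \<in> F" for g
      proof -
        have "f (g y) = scale c (g y)" if "y \<in> E" for y
          using cm[OF f(1) g] that lin[OF g] by (auto simp: E_def linear_operator_on_def)
        then show ?thesis using lin[OF g] ES by (auto simp: E_def linear_operator_on_def)
      qed
    qed
    then show ?thesis using ES by blast
  qed (use x in blast)
qed

end

section \<open>Hilbert space preliminaries\<close>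

instance complex_hilbert_space \<subseteq> banach ..

lemma norm_scaleC [simp]: "norm (scaleC c x) = cmod c * norm (x :: 'v::complex_hilbert_space)"
proof -
  have "cinner (scaleC c x) (scaleC c x) = c * cnj (c * cinner x x)"
    using cinner_commute[of x "scaleC c x"] by (simp add: cinner_scaleC_left)
  also have "\<dots> = of_real ((cmod c)^2) * cinner x x"
    using cinner_commute[of x x] by (metis complex_cnj_mult complex_norm_square mult.assoc)
  finally have "inner (scaleC c x) (scaleC c x) = (cmod c)^2 * inner x x"
    by (simp del: of_real_power flip: Re_cinner)
  then show ?thesis by (simp add: norm_eq_sqrt_inner real_sqrt_mult)
qed

lemma bounded_bilinear_scaleC: "bounded_bilinear (scaleC :: complex \<Rightarrow> 'v::complex_hilbert_space \<Rightarrow> 'v)"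
proof
  show "scaleC (r *\<^sub>R a) b = r *\<^sub>R scaleC a b" for r a and b :: 'v
    by (simp add: scaleR_conv_of_real flip: scaleC_of_real scaleC_scaleC)
  show "scaleC a (r *\<^sub>R b) = r *\<^sub>R scaleC a b" for r a and b :: 'v
    by (simp add: scaleC_scaleC mult.commute flip: scaleC_of_real)
  show "\<exists>K. \<forall>a (b :: 'v). norm (scaleC a b) \<le> norm a * norm b * K" by (intro exI[of _ 1]) simp
qed (simp_all add: scaleC_add_left scaleC_add_right)

lemmas continuous_on_scaleC [continuous_intros] = bounded_bilinear.continuous_on[OF bounded_bilinear_scaleC]
lemmas bounded_linear_scaleC_left = bounded_bilinear.bounded_linear_left[OF bounded_bilinear_scaleC]
lemmas bounded_linear_scaleC_right = bounded_bilinear.bounded_linear_right[OF bounded_bilinear_scaleC]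

lemma scaleC_simps [simp]:
  "scaleC 1 x = x" "scaleC 0 x = 0" "scaleC c 0 = (0 :: 'v::complex_hilbert_space)"
  using scaleC_of_real[of 1 x] scaleC_of_real[of 0 x]
  by (simp_all add: bounded_bilinear.zero_right[OF bounded_bilinear_scaleC])

lemma scaleC_sum_right: "scaleC c (sum f A) = (\<Sum>i\<in>A. scaleC c (f i :: 'v::complex_hilbert_space))"
  using bounded_linear_scaleC_right linear_sum bounded_linear.linear by blast

lemma scaleC_sum_left: "scaleC (sum f A) x = (\<Sum>i\<in>A. scaleC (f i) (x :: 'v::complex_hilbert_space))"
  using linear_sum[OF bounded_linear.linear[OF bounded_linear_scaleC_left], of f A x] by simp

lemma cinner_eq: "cinner x y = Complex (inner x y) (- inner (scaleC \<i> x) (y :: 'v::complex_hilbert_space))"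
  using Re_cinner[of x y] Re_cinner[of "scaleC \<i> x" y] by (simp add: cinner_scaleC_left complex_eq_iff)

lemma continuous_on_cinner [continuous_intros]:
  assumes "continuous_on S f"
  shows "continuous_on S (\<lambda>x. cinner (f x) (y :: 'v::complex_hilbert_space))"
  unfolding cinner_eq Complex_eq by (intro continuous_intros assms)

text \<open>Replaces the existential by an equation between continuous functions of
  \<open>w\<close>. This shows that lines are closed, and the explicit coefficient is used later
  where continuity of an eigenvalue matters.\<close>

lemma mem_line_iff:
  assumes "v \<noteq> (0 :: 'v::complex_hilbert_space)"
  shows "(\<exists>c. w = scaleC c v) \<longleftrightarrow> w = scaleC (cinner w v / cinner v v) v"
proof -
  have "cinner v v \<noteq> 0" using assms Re_cinner[of v v] by (metis inner_eq_zero_iff zero_complex.sel(1))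
  then show ?thesis by (auto simp: cinner_scaleC_left)
qed

lemma closed_line:
  assumes "v \<noteq> (0 :: 'v::complex_hilbert_space)"
  shows "closed {w. \<exists>c. w = scaleC c v}"
  unfolding mem_line_iff[OF assms] divide_inverse
  by (intro closed_Collect_eq continuous_intros)

section \<open>Multiplicity one from an anti-automorphism\<close>

context compact_matrix_group
begin

lemma inv_mem [simp]:
  assumes "k \<in> K"
  shows "matrix_inv k \<in> K" "k ** matrix_inv k = mone" "matrix_inv k ** k = mone"
proof -
  obtain b where b: "b \<in> K" "k ** b = mone" "b ** k = mone" using ex_inv[OF assms] by blast
  show *: "k ** matrix_inv k = mone" "matrix_inv k ** k = mone"
    unfolding matrix_inv_def by (rule someI2[of _ b]; use b in blast)+
  have "matrix_inv k = matrix_inv k ** (k ** b)" using b by simp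
  also have "\<dots> = b" by (simp only: matrix_mul_assoc * matrix_mul_lid)
  finally show "matrix_inv k \<in> K" using b by simp
qed

lemma inv_unique: assumes "k \<in> K" "k ** b = mone" shows "matrix_inv k = b"
  by (metis assms inv_mem(3) matrix_mul_assoc matrix_mul_lid matrix_mul_rid)

lemma inv_cancel [simp]:
  assumes "k \<in> K"
  shows "k ** (matrix_inv k ** b) = b" "matrix_inv k ** (k ** b) = b"
    "b ** k ** matrix_inv k = b" "b ** matrix_inv k ** k = b"
  by (simp_all add: assms matrix_mul_assoc, simp_all add: assms flip: matrix_mul_assoc)

lemma inv_mul: assumes "k \<in> K" "l \<in> K" shows "matrix_inv (k ** l) = matrix_inv l ** matrix_inv k"
proof (rule inv_unique)
  have "k ** l ** (matrix_inv l ** matrix_inv k) = k ** (l ** (matrix_inv l ** matrix_inv k))"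
    by (simp only: matrix_mul_assoc)
  then show "k ** l ** (matrix_inv l ** matrix_inv k) = mone" using assms by simp
qed (use assms mul_mem in blast)

text \<open>Translating a near pair \<open>a\<close>, \<open>b\<close> by
  \<open>matrix_inv a\<close> on the left and \<open>matrix_inv b\<close> on the right turns it into
  the pair of inverses in exchanged order.\<close>

lemma continuous_on_matrix_inv: "continuous_on K matrix_inv"
proof (unfold continuous_on_iff, intro ballI allI impI)
  fix a and e :: real assume a: "a \<in> K" and e: "e > 0"
  obtain d where d: "d > 0" "\<And>a b. a \<in> K \<Longrightarrow> b \<in> K \<Longrightarrow> dist a b < d \<Longrightarrow> near e a b"
    using dist_imp_near[OF e] by blast
  show "\<exists>d>0. \<forall>b\<in>K. dist b a < d \<longrightarrow> dist (matrix_inv b) (matrix_inv a) < e"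
  proof (intro exI[of _ d] conjI ballI impI d(1))
    fix b assume b: "b \<in> K" "dist b a < d"
    then have "near e a b" using d(2)[of a b] a by (simp add: dist_commute)
    then have "dist (matrix_inv a ** a ** matrix_inv b) (matrix_inv a ** b ** matrix_inv b) < e"
      unfolding near_def using inv_mem(1)[OF a] inv_mem(1)[OF b(1)] by blast
    then show "dist (matrix_inv b) (matrix_inv a) < e" using a b by simp
  qed
qed

lemma continuous_on_matrix_inv_comp:
  assumes "continuous_on S f" "f ` S \<subseteq> K"
  shows "continuous_on S (\<lambda>x. matrix_inv (f x))"
  using continuous_on_compose2[OF continuous_on_matrix_inv assms] .

end

section \<open>Operators averaged over K-conjugates\<close>

locale matrix_group_rep = compact_matrix_group K
  for K :: "('a::real_normed_field ^ 'n::finite ^ 'n) set" +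
  fixes G :: "('a ^ 'n ^ 'n) set" and \<pi> :: "'a ^ 'n ^ 'n \<Rightarrow> 'v::complex_hilbert_space \<Rightarrow> 'v"
  assumes sub: "K \<subseteq> G"
    and mulG: "g \<in> G \<Longrightarrow> h \<in> G \<Longrightarrow> g ** h \<in> G"
    and rep: "hilbert_representation G \<pi>"
begin

lemma rep_mul: "g \<in> G \<Longrightarrow> h \<in> G \<Longrightarrow> \<pi> (g ** h) x = \<pi> g (\<pi> h x)"
  using rep by (simp add: hilbert_representation_def)

lemma rep_one [simp]: "\<pi> mone x = x"
  using rep by (simp add: hilbert_representation_def)

lemma rep_linear: "g \<in> G \<Longrightarrow> bounded_linear (\<pi> g)"
  using rep by (simp add: hilbert_representation_def)

lemma rep_scaleC: "g \<in> G \<Longrightarrow> \<pi> g (scaleC c x) = scaleC c (\<pi> g x)"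
  using rep by (simp add: hilbert_representation_def)

lemma rep_add: "g \<in> G \<Longrightarrow> \<pi> g (x + y) = \<pi> g x + \<pi> g y"
  using rep_linear by (simp add: linear_simps)

lemma continuous_on_rep:
  assumes "continuous_on S f" "f ` S \<subseteq> G" "continuous_on S h"
  shows "continuous_on S (\<lambda>x. \<pi> (f x) (h x))"
proof -
  have "continuous_on (G \<times> UNIV) (\<lambda>(g, x). \<pi> g x)" using rep by (simp add: hilbert_representation_def)
  from continuous_on_compose2[OF this continuous_on_Pair[OF assms(1,3)]] assms(2)
  show ?thesis by (simp add: image_subset_iff)
qed

definition avg_conj :: "'a ^ 'n ^ 'n \<Rightarrow> 'v \<Rightarrow> 'v" where
  "avg_conj g v = mean (\<lambda>k. \<pi> (k ** g ** matrix_inv k) v)"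

lemma KG: "k \<in> K \<Longrightarrow> k \<in> G" using sub by blast

lemma conj_mem [simp]: "k \<in> K \<Longrightarrow> g \<in> G \<Longrightarrow> k ** g ** matrix_inv k \<in> G"
  by (simp add: mulG KG)

lemma continuous_on_conj:
  assumes "continuous_on S f" "f ` S \<subseteq> G" "continuous_on S k" "k ` S \<subseteq> K" "continuous_on S h"
  shows "continuous_on S (\<lambda>x. \<pi> (k x ** f x ** matrix_inv (k x)) (h x))"
  by (intro continuous_on_rep continuous_on_matrix_mul continuous_on_matrix_inv_comp assms)
    (use assms(2,4) in \<open>auto simp: image_subset_iff\<close>)

lemma continuous_on_conj_const: "g \<in> G \<Longrightarrow> continuous_on K (\<lambda>k. \<pi> (k ** g ** matrix_inv k) v)"
  by (intro continuous_on_conj continuous_on_const continuous_on_id) auto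

lemma continuous_on_avg_conj:
  assumes "continuous_on X f" "f ` X \<subseteq> G" "continuous_on X h"
  shows "continuous_on X (\<lambda>x. avg_conj (f x) (h x))"
  unfolding avg_conj_def
proof (rule continuous_on_mean)
  have "continuous_on (X \<times> K) (\<lambda>p. \<pi> (snd p ** f (fst p) ** matrix_inv (snd p)) (h (fst p)))"
    by (intro continuous_on_conj continuous_on_compose2[OF assms(1)] continuous_on_compose2[OF assms(3)] continuous_intros)
      (use assms(2) in auto)
  then show "continuous_on (X \<times> K) (\<lambda>(x, k). \<pi> (k ** f x ** matrix_inv k) (h x))"
    by (simp add: case_prod_unfold)
qed

lemma avg_conj_add: "g \<in> G \<Longrightarrow> avg_conj g (v + w) = avg_conj g v + avg_conj g w"
  unfolding avg_conj_def
  by (subst mean_add[symmetric]) (auto intro!: continuous_on_conj_const mean_cong rep_add)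

lemma avg_conj_scaleC: "g \<in> G \<Longrightarrow> avg_conj g (scaleC c v) = scaleC c (avg_conj g v)"
  unfolding avg_conj_def
  by (subst mean_linear[OF _ bounded_linear_scaleC_right, symmetric])
    (auto intro!: continuous_on_conj_const mean_cong rep_scaleC)

lemma avg_conj_conj: assumes "g \<in> G" "l \<in> K" shows "avg_conj (l ** g ** matrix_inv l) v = avg_conj g v"
proof -
  have "avg_conj (l ** g ** matrix_inv l) v = mean (\<lambda>k. \<pi> ((k ** l) ** g ** matrix_inv (k ** l)) v)"
    unfolding avg_conj_def by (rule mean_cong) (simp add: inv_mul assms matrix_mul_assoc)
  also have "\<dots> = avg_conj g v" unfolding avg_conj_def
    using mean_mul_right[OF continuous_on_conj_const[OF assms(1), of v] assms(2)] .
  finally show ?thesis .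
qed

lemma avg_conj_commute: assumes "g \<in> G" "l \<in> K" shows "avg_conj g (\<pi> l v) = \<pi> l (avg_conj g v)"
proof -
  have "avg_conj g (\<pi> l v) = mean (\<lambda>k. \<pi> ((l ** k) ** g ** matrix_inv (l ** k)) (\<pi> l v))"
    unfolding avg_conj_def
    using mean_mul_left[OF continuous_on_conj_const[OF assms(1), of "\<pi> l v"] assms(2)] by simp
  also have "\<dots> = mean (\<lambda>k. \<pi> l (\<pi> (k ** g ** matrix_inv k) v))"
  proof (rule mean_cong)
    fix k assume k: "k \<in> K"
    have "\<pi> ((l ** k) ** g ** matrix_inv (l ** k)) (\<pi> l v) = \<pi> ((l ** k) ** g ** matrix_inv (l ** k) ** l) v"
      using assms k KG mul_mem by (intro rep_mul[symmetric]) auto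
    also have "(l ** k) ** g ** matrix_inv (l ** k) ** l = l ** (k ** g ** matrix_inv k)"
      using assms k by (simp add: inv_mul matrix_mul_assoc)
    finally show "\<pi> ((l ** k) ** g ** matrix_inv (l ** k)) (\<pi> l v) = \<pi> l (\<pi> (k ** g ** matrix_inv k) v)"
      using assms k KG rep_mul by simp
  qed
  also have "\<dots> = \<pi> l (avg_conj g v)" unfolding avg_conj_def
    by (intro mean_linear continuous_on_conj_const rep_linear assms KG)
  finally show ?thesis .
qed

text \<open>Since \<open>avg_conj h\<close> depends only on the K-conjugacy class of
  \<open>h\<close>, the inner element may be conjugated by the integration variable \<open>k\<close>
  of the outer mean. Then the two arguments merge into a single conjugate by \<open>k\<close>, and
  exchanging the means finishes.\<close>

lemma avg_conj_mul:
  assumes "g \<in> G" "h \<in> G"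
  shows "avg_conj g (avg_conj h v) = mean (\<lambda>l. avg_conj (g ** (l ** h ** matrix_inv l)) v)"
proof -
  have fst: "\<pi> (k ** g ** matrix_inv k) (avg_conj h v) =
      mean (\<lambda>l. \<pi> (k ** (g ** (l ** h ** matrix_inv l)) ** matrix_inv k) v)" if k: "k \<in> K" for k
  proof -
    have "\<pi> (k ** g ** matrix_inv k) (avg_conj h v) = \<pi> (k ** g ** matrix_inv k) (avg_conj (k ** h ** matrix_inv k) v)"
      using avg_conj_conj assms k by simp
    also have "\<dots> = \<pi> (k ** g ** matrix_inv k) (mean (\<lambda>l. \<pi> (k ** (l ** h ** matrix_inv l) ** matrix_inv k) v))"
    proof -
      have "avg_conj (k ** h ** matrix_inv k) v = avg_conj h v" using avg_conj_conj assms k by simp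
      also have "\<dots> = mean (\<lambda>l. \<pi> ((k ** l) ** h ** matrix_inv (k ** l)) v)"
        unfolding avg_conj_def using mean_mul_left[OF continuous_on_conj_const[OF assms(2), of v] k] by simp
      also have "\<dots> = mean (\<lambda>l. \<pi> (k ** (l ** h ** matrix_inv l) ** matrix_inv k) v)"
        by (rule mean_cong) (simp add: inv_mul k matrix_mul_assoc)
      finally show ?thesis by simp
    qed
    also have "\<dots> = mean (\<lambda>l. \<pi> (k ** g ** matrix_inv k) (\<pi> (k ** (l ** h ** matrix_inv l) ** matrix_inv k) v))"
    proof (intro mean_linear[symmetric] rep_linear conj_mem k assms)
      show "continuous_on K (\<lambda>l. \<pi> (k ** (l ** h ** matrix_inv l) ** matrix_inv k) v)"
        by (intro continuous_on_rep continuous_on_matrix_mul continuous_on_matrix_inv continuous_on_const continuous_on_id)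
          (use k assms in auto)
    qed
    also have "\<dots> = mean (\<lambda>l. \<pi> (k ** (g ** (l ** h ** matrix_inv l)) ** matrix_inv k) v)"
    proof (rule mean_cong)
      fix l assume l: "l \<in> K"
      have eq: "(k ** g ** matrix_inv k) ** (k ** (l ** h ** matrix_inv l) ** matrix_inv k) = k ** (g ** (l ** h ** matrix_inv l)) ** matrix_inv k"
        using k by (simp add: matrix_mul_assoc)
      show "\<pi> (k ** g ** matrix_inv k) (\<pi> (k ** (l ** h ** matrix_inv l) ** matrix_inv k) v) =
         \<pi> (k ** (g ** (l ** h ** matrix_inv l)) ** matrix_inv k) v"
        unfolding eq[symmetric] by (intro rep_mul[symmetric] conj_mem k l assms)
    qed
    finally show ?thesis .
  qed
  have "avg_conj g (avg_conj h v) = mean (\<lambda>k. mean (\<lambda>l. \<pi> (k ** (g ** (l ** h ** matrix_inv l)) ** matrix_inv k) v))"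
    unfolding avg_conj_def[of g] by (rule mean_cong) (rule fst)
  also have "\<dots> = mean (\<lambda>l. mean (\<lambda>k. \<pi> (k ** (g ** (l ** h ** matrix_inv l)) ** matrix_inv k) v))"
  proof (rule mean_swap)
    have "continuous_on (K \<times> K) (\<lambda>p. \<pi> (fst p ** (g ** (snd p ** h ** matrix_inv (snd p))) ** matrix_inv (fst p)) v)"
      by (intro continuous_on_conj continuous_on_matrix_mul continuous_on_matrix_inv_comp continuous_on_const continuous_on_id continuous_on_fst continuous_on_snd)
        (use assms mulG in auto)
    then show "continuous_on (K \<times> K) (\<lambda>(k, l). \<pi> (k ** (g ** (l ** h ** matrix_inv l)) ** matrix_inv k) v)"
      by (simp add: case_prod_unfold)
  qed
  finally show ?thesis unfolding avg_conj_def .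
qed

end

text \<open>The last axiom says that \<open>\<theta> g\<close> is a K-conjugate of \<open>g\<close>.
  It gives \<open>avg_conj (\<theta> g) = avg_conj g\<close> and also forces \<open>\<theta>\<close>
  to preserve \<open>K\<close>.\<close>

locale strong_gelfand = matrix_group_rep K G \<pi>
  for K G :: "('a::real_normed_field ^ 'n::finite ^ 'n) set"
    and \<pi> :: "'a ^ 'n ^ 'n \<Rightarrow> 'v::complex_hilbert_space \<Rightarrow> 'v" +
  fixes \<theta> :: "'a ^ 'n ^ 'n \<Rightarrow> 'a ^ 'n ^ 'n"
  assumes theta_mul: "g \<in> G \<Longrightarrow> h \<in> G \<Longrightarrow> \<theta> (g ** h) = \<theta> h ** \<theta> g"
    and theta_mem: "g \<in> G \<Longrightarrow> \<theta> g \<in> G"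
    and theta_invol: "g \<in> G \<Longrightarrow> \<theta> (\<theta> g) = g"
    and theta_cont: "continuous_on K \<theta>"
    and theta_conj: "g \<in> G \<Longrightarrow> \<exists>k\<in>K. k ** g = \<theta> g ** k"
begin

lemma theta_eq: assumes "g \<in> G" obtains k where "k \<in> K" "\<theta> g = k ** g ** matrix_inv k"
  using theta_conj[OF assms] inv_cancel(3) by metis

lemma theta_K: assumes "k \<in> K" shows "\<theta> k \<in> K"
  by (metis theta_eq[OF KG[OF assms]] mul_mem assms inv_mem(1))

lemma theta_inv: assumes "k \<in> K" shows "\<theta> (matrix_inv k) = matrix_inv (\<theta> k)"
proof -
  have one: "\<theta> mone = mone"
    by (rule theta_eq[OF KG[OF one_mem]]) simp
  have "\<theta> k ** \<theta> (matrix_inv k) = \<theta> (matrix_inv k ** k)"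
    using assms KG by (intro theta_mul[symmetric]) auto
  then show ?thesis using inv_unique[OF theta_K[OF assms]] assms one by simp
qed

text \<open>Uniqueness of the invariant mean, made explicit: the double mean of
  \<open>f (\<theta> k ** l)\<close> equals the left side when \<open>k\<close> is integrated first,
  because \<open>\<theta>\<close> reverses products, and \<open>mean f\<close> when \<open>l\<close>
  is integrated first.\<close>

lemma mean_theta:
  fixes f :: "'a^'n^'n \<Rightarrow> 'b::banach"
  assumes "continuous_on K f"
  shows "mean (\<lambda>k. f (\<theta> k)) = mean f"
proof -
  have ct: "continuous_on K (\<lambda>k. f (\<theta> k))"
    by (rule continuous_on_compose2[OF assms theta_cont]) (use theta_K in auto)
  have "mean (\<lambda>k. f (\<theta> k)) = mean (\<lambda>l. mean (\<lambda>k. f (\<theta> k)))" by simp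
  also have "\<dots> = mean (\<lambda>l. mean (\<lambda>k. f (\<theta> k ** l)))"
  proof (rule mean_cong)
    fix l assume l: "l \<in> K"
    have "mean (\<lambda>k. f (\<theta> k)) = mean (\<lambda>k. f (\<theta> (\<theta> l ** k)))"
      using mean_mul_left[OF ct theta_K[OF l]] by simp
    also have "\<dots> = mean (\<lambda>k. f (\<theta> k ** l))"
      by (rule mean_cong) (simp add: theta_mul theta_K KG l theta_invol)
    finally show "mean (\<lambda>k. f (\<theta> k)) = mean (\<lambda>k. f (\<theta> k ** l))" .
  qed
  also have "\<dots> = mean (\<lambda>k. mean (\<lambda>l. f (\<theta> k ** l)))"
  proof (rule mean_swap)
    have "continuous_on (K \<times> K) (\<lambda>p. f (\<theta> (snd p) ** fst p))"
      by (rule continuous_on_compose2[OF assms])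
        (use theta_K mul_mem in \<open>auto intro!: continuous_on_matrix_mul continuous_on_compose2[OF theta_cont] continuous_intros\<close>)
    then show "continuous_on (K \<times> K) (\<lambda>(l, k). f (\<theta> k ** l))" by (simp add: case_prod_unfold)
  qed
  also have "\<dots> = mean (\<lambda>k. mean f)"
    by (rule mean_cong) (rule mean_mul_left[OF assms theta_K])
  finally show ?thesis by simp
qed

lemma avg_conj_theta: assumes "g \<in> G" shows "avg_conj (\<theta> g) v = avg_conj g v"
  by (rule theta_eq[OF assms]) (simp add: avg_conj_conj assms)

text \<open>Write l' for the inverse of l. Applying \<open>\<theta>\<close> under the mean in
  \<open>avg_conj_mul\<close> turns g l h l' into a product with the factors reversed; by
  \<open>mean_theta\<close> the variable \<open>\<theta> l\<close> may be renamed, and a conjugation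
  by l brings the product into the form of \<open>avg_conj_mul\<close> for \<open>\<theta> h\<close>
  and \<open>\<theta> g\<close>.\<close>

lemma avg_conj_abelian:
  assumes g: "g \<in> G" and h: "h \<in> G"
  shows "avg_conj g (avg_conj h v) = avg_conj h (avg_conj g v)"
proof -
  define F where "F m = avg_conj (matrix_inv m ** \<theta> h ** m ** \<theta> g) v" for m
  have cF: "continuous_on K F" unfolding F_def
    by (intro continuous_on_avg_conj continuous_on_matrix_mul continuous_on_matrix_inv continuous_on_const continuous_on_id)
      (use g h theta_mem mulG KG in \<open>auto intro!: mulG\<close>)
  have "avg_conj g (avg_conj h v) = mean (\<lambda>l. avg_conj (\<theta> (g ** (l ** h ** matrix_inv l))) v)"
    unfolding avg_conj_mul[OF assms] by (rule mean_cong) (simp add: avg_conj_theta mulG g h)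
  also have "\<dots> = mean (\<lambda>l. F (\<theta> l))"
    by (rule mean_cong)
      (simp add: F_def theta_mul mulG g h KG theta_inv matrix_mul_assoc)
  also have "\<dots> = mean F" by (rule mean_theta[OF cF])
  also have "\<dots> = mean (\<lambda>l. avg_conj (\<theta> h ** (l ** \<theta> g ** matrix_inv l)) v)"
  proof (rule mean_cong)
    fix l assume l: "l \<in> K"
    have "F l = avg_conj (l ** (matrix_inv l ** \<theta> h ** l ** \<theta> g) ** matrix_inv l) v"
      unfolding F_def using l g h theta_mem KG by (intro avg_conj_conj[symmetric] mulG) auto
    also have "l ** (matrix_inv l ** \<theta> h ** l ** \<theta> g) ** matrix_inv l = \<theta> h ** (l ** \<theta> g ** matrix_inv l)"
      using l by (simp add: matrix_mul_assoc)
    finally show "F l = avg_conj (\<theta> h ** (l ** \<theta> g ** matrix_inv l)) v" .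
  qed
  also have "\<dots> = avg_conj (\<theta> h) (avg_conj (\<theta> g) v)"
    by (rule avg_conj_mul[symmetric]) (intro theta_mem assms)+
  also have "\<dots> = avg_conj h (avg_conj g v)" by (simp add: avg_conj_theta assms)
  finally show ?thesis .
qed

end

section \<open>Schur orthogonality for matrix coefficients\<close>

lemma mat_vec_index:
  assumes "A \<in> carrier_mat n n" "x \<in> carrier_vec n" "i < n"
  shows "vec_index (A *\<^sub>v x) i = (\<Sum>j<n. A $$ (i, j) * vec_index x j)"
  using assms by (auto simp: scalar_prod_def atLeast0LessThan intro!: sum.cong)

lemma mat_mul_index:
  assumes "A \<in> carrier_mat n n" "B \<in> carrier_mat n n" "i < n" "j < n"
  shows "(A * B) $$ (i, j) = (\<Sum>p<n. A $$ (i, p) * B $$ (p, j))"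
  using assms by (auto simp: scalar_prod_def atLeast0LessThan intro!: sum.cong)

locale compact_group_irrep = compact_matrix_group K
  for K :: "('a::real_normed_field ^ 'n::finite ^ 'n) set" +
  fixes n :: nat and \<tau> :: "'a ^ 'n ^ 'n \<Rightarrow> complex Matrix.mat"
  assumes irr: "irreducible_matrix_representation K n \<tau>"
begin

definition coef :: "'a ^ 'n ^ 'n \<Rightarrow> nat \<Rightarrow> nat \<Rightarrow> complex" where
  "coef k i j = \<tau> k $$ (i, j)"

lemma carrier [simp]: "k \<in> K \<Longrightarrow> \<tau> k \<in> carrier_mat n n"
  and tau_one: "\<tau> mone = 1\<^sub>m n"
  and tau_mul: "k \<in> K \<Longrightarrow> l \<in> K \<Longrightarrow> \<tau> (k ** l) = \<tau> k * \<tau> l"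
  and coef_cont: "i < n \<Longrightarrow> j < n \<Longrightarrow> continuous_on K (\<lambda>k. coef k i j)"
  and n_pos: "0 < n"
  using irr by (auto simp: irreducible_matrix_representation_def matrix_representation_def coef_def)

lemma invariant_subspace_trivial:
  assumes "W \<subseteq> carrier_vec n" "0\<^sub>v n \<in> W" "\<And>x y. x \<in> W \<Longrightarrow> y \<in> W \<Longrightarrow> x + y \<in> W"
    "\<And>c x. x \<in> W \<Longrightarrow> c \<cdot>\<^sub>v x \<in> W" "\<And>k x. k \<in> K \<Longrightarrow> x \<in> W \<Longrightarrow> \<tau> k *\<^sub>v x \<in> W"
    "v \<in> W" "v \<noteq> 0\<^sub>v n"
  shows "W = carrier_vec n"
proof -
  note triv = irr[unfolded irreducible_matrix_representation_def, THEN conjunct2, THEN conjunct2, rule_format, of W]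
  have "W = {0\<^sub>v n} \<or> W = carrier_vec n" by (rule triv, rule assms(1)) (intro conjI allI ballI assms)
  then show ?thesis using assms(6,7) by blast
qed

lemma coef_mul: "k \<in> K \<Longrightarrow> l \<in> K \<Longrightarrow> i < n \<Longrightarrow> j < n \<Longrightarrow> coef (k ** l) i j = (\<Sum>p<n. coef k i p * coef l p j)"
  unfolding coef_def by (simp add: tau_mul mat_mul_index del: index_mult_mat)

lemma coef_one: "i < n \<Longrightarrow> j < n \<Longrightarrow> coef mone i j = (if i = j then 1 else 0)"
  by (simp add: coef_def tau_one)

lemma coef_cont_comp:
  assumes "i < n" "j < n" "continuous_on S f" "f ` S \<subseteq> K"
  shows "continuous_on S (\<lambda>x. coef (f x) i j)"
  using continuous_on_compose2[OF coef_cont assms(3,4)] assms(1,2) .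

lemma schur:
  assumes S: "S \<in> carrier_mat n n" and comm: "\<And>g. g \<in> K \<Longrightarrow> \<tau> g * S = S * \<tau> g"
  obtains c where "\<And>i j. i < n \<Longrightarrow> j < n \<Longrightarrow> S $$ (i, j) = (if i = j then c else 0)"
proof -
  obtain c where "eigenvalue S c" using spectrum_non_empty[OF S n_pos] by (auto simp: spectrum_def)
  then obtain v where v: "v \<in> carrier_vec n" "v \<noteq> 0\<^sub>v n" "S *\<^sub>v v = c \<cdot>\<^sub>v v"
    using S by (auto simp: eigenvalue_def eigenvector_def)
  let ?W = "{x \<in> carrier_vec n. S *\<^sub>v x = c \<cdot>\<^sub>v x}"
  have W: "?W = carrier_vec n"
  proof (rule invariant_subspace_trivial)
    show "0\<^sub>v n \<in> ?W" using S by auto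
    show "x + y \<in> ?W" if "x \<in> ?W" "y \<in> ?W" for x y
      using that S by (auto simp: mult_add_distrib_mat_vec smult_add_distrib_vec)
    show "a \<cdot>\<^sub>v x \<in> ?W" if "x \<in> ?W" for a x
      using that S by (auto simp: mult_mat_vec smult_smult_assoc mult.commute)
    show "\<tau> k *\<^sub>v x \<in> ?W" if "k \<in> K" "x \<in> ?W" for k x
    proof -
      have "S *\<^sub>v (\<tau> k *\<^sub>v x) = (S * \<tau> k) *\<^sub>v x" using that S by (simp add: assoc_mult_mat_vec[of _ n n _ n])
      also have "\<dots> = \<tau> k *\<^sub>v (S *\<^sub>v x)" using that S by (simp add: assoc_mult_mat_vec[of _ n n _ n] flip: comm)
      finally show ?thesis using that mult_mat_vec_carrier[OF carrier[OF that(1)]] by (auto simp: mult_mat_vec[of _ n n])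
    qed
  qed (use v in auto)
  show thesis
  proof (rule that[of c])
    fix i j assume ij: "i < n" "j < n"
    have "unit_vec n j \<in> ?W" unfolding W by simp
    then have "vec_index (S *\<^sub>v unit_vec n j) i = vec_index (c \<cdot>\<^sub>v unit_vec n j) i" by simp
    then show "S $$ (i, j) = (if i = j then c else 0)" using ij S by (auto split: if_splits)
  qed
qed

text \<open>For fixed \<open>a\<close> and \<open>b\<close> the means form a matrix \<open>S\<close>
  that commutes with \<open>\<tau>\<close> by left invariance, so it is scalar by Schur's lemma and
  its trace gives the scalar. The coefficient of the inverse stands in for a complex conjugate,
  since \<open>\<tau>\<close> is an arbitrary matrix representation and may be non-unitary.\<close>

lemma coef_orthogonality:
  assumes "l < n" "a < n" "b < n" "m < n"
  shows "mean (\<lambda>k. coef k l a * coef (matrix_inv k) b m) = (if a = b \<and> l = m then 1 / of_nat n else 0)"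
proof -
  define s where "s l m = mean (\<lambda>k. coef k l a * coef (matrix_inv k) b m)" for l m
  have cont: "continuous_on K (\<lambda>k. coef k l a * coef (matrix_inv k) b m)" if "l < n" "m < n" for l m
    by (intro continuous_intros coef_cont coef_cont_comp continuous_on_matrix_inv) (use assms that in auto)
  define S where "S = Matrix.mat n n (\<lambda>(l, m). s l m)"
  have S: "S \<in> carrier_mat n n" by (simp add: S_def)
  have comm: "\<tau> g * S = S * \<tau> g" if g: "g \<in> K" for g
  proof (rule eq_matI)
    fix i j assume "i < dim_row (S * \<tau> g)" "j < dim_col (S * \<tau> g)"
    then have ij: "i < n" "j < n" using S carrier[OF g] by auto
    have "(\<tau> g * S) $$ (i, j) = (\<Sum>p<n. coef g i p * s p j)"
      using mat_mul_index[OF carrier[OF g] S ij] ij by (simp add: coef_def S_def)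
    also have "\<dots> = (\<Sum>p<n. mean (\<lambda>k. coef g i p * (coef k p a * coef (matrix_inv k) b j)))"
      unfolding s_def by (intro sum.cong refl mean_linear[symmetric] cont ij bounded_linear_mult_right) auto
    also have "\<dots> = mean (\<lambda>k. \<Sum>p<n. coef g i p * (coef k p a * coef (matrix_inv k) b j))"
      by (intro mean_sum[symmetric] continuous_on_mult continuous_on_const cont ij) auto
    also have "\<dots> = mean (\<lambda>k. coef (g ** k) i a * coef (matrix_inv (g ** k) ** g) b j)"
      by (rule mean_cong)
        (use g ij assms in \<open>simp add: coef_mul inv_mul sum_distrib_right mult.assoc flip: matrix_mul_assoc\<close>)
    also have "\<dots> = mean (\<lambda>k. coef k i a * coef (matrix_inv k ** g) b j)"
      by (rule mean_mul_left[OF _ g, of "\<lambda>k. coef k i a * coef (matrix_inv k ** g) b j"],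
          intro continuous_intros coef_cont coef_cont_comp continuous_on_matrix_inv)
        (use assms ij g mul_mem in auto)
    also have "\<dots> = mean (\<lambda>k. \<Sum>p<n. coef k i a * coef (matrix_inv k) b p * coef g p j)"
      by (rule mean_cong) (use g ij assms in \<open>simp add: coef_mul sum_distrib_left mult.assoc\<close>)
    also have "\<dots> = (\<Sum>p<n. mean (\<lambda>k. coef k i a * coef (matrix_inv k) b p * coef g p j))"
      by (intro mean_sum continuous_on_mult continuous_on_const cont ij coef_cont coef_cont_comp continuous_on_matrix_inv)
        (use assms ij in auto)
    also have "\<dots> = (\<Sum>p<n. s i p * coef g p j)"
      unfolding s_def by (intro sum.cong refl mean_linear cont ij bounded_linear_mult_left) auto
    also have "\<dots> = (S * \<tau> g) $$ (i, j)"
      using mat_mul_index[OF S carrier[OF g] ij] ij by (simp add: coef_def S_def)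
    finally show "(\<tau> g * S) $$ (i, j) = (S * \<tau> g) $$ (i, j)" .
  qed (use S carrier[OF g] in auto)
  obtain c where c: "\<And>i j. i < n \<Longrightarrow> j < n \<Longrightarrow> S $$ (i, j) = (if i = j then c else 0)"
    using schur[OF S comm] by blast
  then have sc: "s i j = (if i = j then c else 0)" if "i < n" "j < n" for i j
    using that by (simp add: S_def)
  \<comment> \<open>Under the mean, the trace collapses to the entry at \<open>b\<close>,
    \<open>a\<close> of \<open>\<tau>\<close> at \<open>matrix_inv k ** k\<close>, the
    identity.\<close>
  have "of_nat n * c = (\<Sum>i<n. s i i)" by (simp add: sc)
  also have "\<dots> = mean (\<lambda>k. \<Sum>i<n. coef k i a * coef (matrix_inv k) b i)"
    unfolding s_def by (intro mean_sum[symmetric] cont) auto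
  also have "\<dots> = mean (\<lambda>k. if a = b then 1 else 0)"
  proof (rule mean_cong)
    fix k assume k: "k \<in> K"
    have "(\<Sum>i<n. coef k i a * coef (matrix_inv k) b i) = coef (matrix_inv k ** k) b a"
      using k assms by (subst coef_mul) (auto simp: mult.commute)
    then show "(\<Sum>i<n. coef k i a * coef (matrix_inv k) b i) = (if a = b then 1 else 0)"
      using k assms coef_one by auto
  qed
  finally have "of_nat n * c = (if a = b then 1 else 0)" by simp
  then have "c = (if a = b then 1 / of_nat n else 0)" using n_pos by (auto simp: field_simps)
  then show ?thesis using sc[OF assms(1,4)] by (auto simp: s_def)
qed

end

section \<open>Compression to the first basis vector of a K-type\<close>

locale gelfand_irrep = strong_gelfand K G \<pi> \<theta> + compact_group_irrep K n \<tau>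
  for K G :: "('a::real_normed_field ^ 'n::finite ^ 'n) set"
    and \<pi> :: "'a ^ 'n ^ 'n \<Rightarrow> 'v::complex_hilbert_space \<Rightarrow> 'v" and \<theta> n \<tau>
begin

abbreviation "\<I> \<equiv> intertwiners K n \<tau> \<pi>"

lemma intertwinerD:
  assumes "T \<in> \<I>"
  shows "x \<in> carrier_vec n \<Longrightarrow> y \<in> carrier_vec n \<Longrightarrow> T (x + y) = T x + T y"
    "x \<in> carrier_vec n \<Longrightarrow> T (c \<cdot>\<^sub>v x) = scaleC c (T x)"
    "k \<in> K \<Longrightarrow> x \<in> carrier_vec n \<Longrightarrow> T (\<tau> k *\<^sub>v x) = \<pi> k (T x)"
    "x \<notin> carrier_vec n \<Longrightarrow> T x = 0"
  using assms by (auto simp: intertwiners_def)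

lemma intertwiner_expand:
  assumes T: "T \<in> \<I>" and x: "x \<in> carrier_vec n"
  shows "T x = (\<Sum>j<n. scaleC (vec_index x j) (T (unit_vec n j)))"
proof -
  define y where "y m = vec n (\<lambda>i. if i < m then vec_index x i else 0)" for m
  have yc: "y m \<in> carrier_vec n" for m by (simp add: y_def)
  have "T (y m) = (\<Sum>j<m. scaleC (vec_index x j) (T (unit_vec n j)))" if "m \<le> n" for m
    using that
  proof (induction m)
    case 0
    have "y 0 = 0 \<cdot>\<^sub>v y 0" by (auto simp: y_def)
    then have "T (y 0) = scaleC 0 (T (y 0))" using intertwinerD(2)[OF T yc] by metis
    then show ?case by simp
  next
    case (Suc m)
    have "y (Suc m) = y m + vec_index x m \<cdot>\<^sub>v unit_vec n m"
      by (rule eq_vecI) (auto simp: y_def unit_vec_def less_Suc_eq)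
    then show ?case using Suc intertwinerD(1,2)[OF T] yc by simp
  qed
  moreover have "y n = x" using x by (intro eq_vecI) (auto simp: y_def)
  ultimately show ?thesis by auto
qed

text \<open>The projection attached to the first diagonal coefficient of \<open>\<tau>\<close>: on
  the image of an intertwiner it keeps only the component along the first basis vector, as
  \<open>proj_intertwiner\<close> shows. The factor \<open>n\<close> cancels the one in the
  orthogonality relations.\<close>

definition proj :: "'v \<Rightarrow> 'v" where
  "proj v = scaleC (of_nat n) (mean (\<lambda>k. scaleC (coef (matrix_inv k) 0 0) (\<pi> k v)))"

lemma cont_integrand:
  assumes "i < n" "j < n"
  shows "continuous_on K (\<lambda>k. scaleC (coef (matrix_inv k) i j) (\<pi> k v))"
  by (intro continuous_on_scaleC coef_cont_comp continuous_on_matrix_inv continuous_on_rep continuous_on_const continuous_on_id)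
    (use assms sub in auto)

text \<open>Moving \<open>\<pi> k\<close> through \<open>T\<close> turns the integrand into products
  of two matrix coefficients of \<open>\<tau>\<close>, and orthogonality leaves the single term
  \<open>p = j\<close>, \<open>m = i\<close>.\<close>

lemma mean_coef_intertwiner:
  assumes T: "T \<in> \<I>" and x: "x \<in> carrier_vec n" and ij: "i < n" "j < n"
  shows "mean (\<lambda>k. scaleC (coef (matrix_inv k) i j) (\<pi> k (T x))) = scaleC (vec_index x i / of_nat n) (T (unit_vec n j))"
proof -
  have "mean (\<lambda>k. scaleC (coef (matrix_inv k) i j) (\<pi> k (T x))) =
      mean (\<lambda>k. \<Sum>p<n. \<Sum>m<n. scaleC (coef k p m * coef (matrix_inv k) i j) (scaleC (vec_index x m) (T (unit_vec n p))))"
  proof (rule mean_cong)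
    fix k assume k: "k \<in> K"
    have "\<pi> k (T x) = T (\<tau> k *\<^sub>v x)" using intertwinerD(3)[OF T k x] by simp
    also have "\<dots> = (\<Sum>p<n. scaleC (\<Sum>m<n. coef k p m * vec_index x m) (T (unit_vec n p)))"
      by (subst intertwiner_expand[OF T])
        (use k x in \<open>auto intro!: sum.cong mult_mat_vec_carrier[of _ n n] arg_cong[of _ _ "\<lambda>c. scaleC c _"] simp: mat_vec_index coef_def simp del: index_mult_mat_vec\<close>)
    finally show "scaleC (coef (matrix_inv k) i j) (\<pi> k (T x)) =
      (\<Sum>p<n. \<Sum>m<n. scaleC (coef k p m * coef (matrix_inv k) i j) (scaleC (vec_index x m) (T (unit_vec n p))))"
      by (simp add: scaleC_sum_right scaleC_sum_left scaleC_scaleC mult_ac)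
  qed
  also have "\<dots> = (\<Sum>p<n. \<Sum>m<n. mean (\<lambda>k. scaleC (coef k p m * coef (matrix_inv k) i j) (scaleC (vec_index x m) (T (unit_vec n p)))))"
    by (subst mean_sum, simp, intro continuous_intros coef_cont coef_cont_comp continuous_on_matrix_inv, use ij in auto,
        intro sum.cong refl mean_sum continuous_intros coef_cont coef_cont_comp continuous_on_matrix_inv, use ij in auto)
  also have "\<dots> = (\<Sum>p<n. \<Sum>m<n. scaleC (mean (\<lambda>k. coef k p m * coef (matrix_inv k) i j)) (scaleC (vec_index x m) (T (unit_vec n p))))"
    by (intro sum.cong refl mean_linear[OF _ bounded_linear_scaleC_left] continuous_intros coef_cont coef_cont_comp continuous_on_matrix_inv)
      (use ij in auto)
  also have "\<dots> = (\<Sum>p<n. \<Sum>m<n. if p = j \<and> m = i then scaleC (vec_index x i / of_nat n) (T (unit_vec n j)) else 0)"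
    by (intro sum.cong refl) (use ij in \<open>auto simp: coef_orthogonality scaleC_scaleC\<close>)
  also have "\<dots> = (\<Sum>p<n. if p = j then scaleC (vec_index x i / of_nat n) (T (unit_vec n j)) else 0)"
    by (intro sum.cong refl) (use ij in auto)
  also have "\<dots> = scaleC (vec_index x i / of_nat n) (T (unit_vec n j))" using ij by simp
  finally show ?thesis .
qed

lemma proj_intertwiner: "T \<in> \<I> \<Longrightarrow> x \<in> carrier_vec n \<Longrightarrow> proj (T x) = scaleC (vec_index x 0) (T (unit_vec n 0))"
  unfolding proj_def using n_pos by (simp add: mean_coef_intertwiner scaleC_scaleC)

text \<open>
  Compressing \<open>\<pi> g\<close> to the line of the first basis vector expresses it through the averaged
  operators, by the orthogonality relations.
\<close>

lemma proj_rep: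
  assumes T: "T \<in> \<I>" and g: "g \<in> G"
  defines "v \<equiv> T (unit_vec n 0)"
  shows "mean (\<lambda>l. scaleC (coef (matrix_inv l) 0 0) (avg_conj (g ** l) v)) = scaleC (1 / (of_nat n)^2) (proj (\<pi> g v))"
proof -
  note cc = continuous_on_scaleC coef_cont_comp continuous_on_rep continuous_on_matrix_mul continuous_on_matrix_inv_comp
    continuous_on_matrix_inv continuous_on_const continuous_on_id continuous_on_fst continuous_on_snd
  have "mean (\<lambda>l. scaleC (coef (matrix_inv l) 0 0) (avg_conj (g ** l) v)) =
      mean (\<lambda>l. mean (\<lambda>k. scaleC (coef (matrix_inv l) 0 0) (\<pi> (k ** (g ** l) ** matrix_inv k) v)))"
    unfolding avg_conj_def
    by (intro mean_cong mean_linear[symmetric] bounded_linear_scaleC_right continuous_on_conj_const mulG g KG)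
  also have "\<dots> = mean (\<lambda>k. mean (\<lambda>l. scaleC (coef (matrix_inv l) 0 0) (\<pi> (k ** (g ** l) ** matrix_inv k) v)))"
  proof (rule mean_swap)
    have "continuous_on (K \<times> K) (\<lambda>p. scaleC (coef (matrix_inv (fst p)) 0 0) (\<pi> (snd p ** (g ** fst p) ** matrix_inv (snd p)) v))"
      by (intro cc) (use n_pos mulG g KG in auto)
    then show "continuous_on (K \<times> K) (\<lambda>(l, k). scaleC (coef (matrix_inv l) 0 0) (\<pi> (k ** (g ** l) ** matrix_inv k) v))"
      by (simp add: case_prod_unfold)
  qed
  also have "\<dots> = mean (\<lambda>k. scaleC (1 / of_nat n) (scaleC (coef (matrix_inv k) 0 0) (\<pi> k (\<pi> g v))))"
  proof (rule mean_cong)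
    fix k assume k: "k \<in> K"
    have kg: "k ** g \<in> G" using k g KG mulG by blast
    \<comment> \<open>Replacing \<open>l\<close> by \<open>l ** k\<close> cancels the trailing
      \<open>matrix_inv k\<close>; the coefficient of \<open>matrix_inv (l ** k)\<close> splits into
      a sum over an intermediate index \<open>j\<close>.\<close>
    have "mean (\<lambda>l. scaleC (coef (matrix_inv l) 0 0) (\<pi> (k ** (g ** l) ** matrix_inv k) v)) =
      mean (\<lambda>l. scaleC (coef (matrix_inv (l ** k)) 0 0) (\<pi> (k ** (g ** (l ** k)) ** matrix_inv k) v))"
      by (rule mean_mul_right[OF _ k, symmetric], intro cc) (use n_pos mulG g k KG in auto)
    also have "\<dots> = mean (\<lambda>l. \<Sum>j<n. scaleC (coef (matrix_inv k) 0 j) (\<pi> (k ** g) (scaleC (coef (matrix_inv l) j 0) (\<pi> l v))))"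
    proof (rule mean_cong)
      fix l assume l: "l \<in> K"
      have "\<pi> (k ** (g ** (l ** k)) ** matrix_inv k) v = \<pi> (k ** g ** l) v"
        using k by (simp add: matrix_mul_assoc)
      also have "\<dots> = \<pi> (k ** g) (\<pi> l v)" using rep_mul[OF kg KG[OF l]] .
      finally show "scaleC (coef (matrix_inv (l ** k)) 0 0) (\<pi> (k ** (g ** (l ** k)) ** matrix_inv k) v) =
          (\<Sum>j<n. scaleC (coef (matrix_inv k) 0 j) (\<pi> (k ** g) (scaleC (coef (matrix_inv l) j 0) (\<pi> l v))))"
        using k l n_pos kg by (simp add: inv_mul coef_mul scaleC_sum_left rep_scaleC scaleC_scaleC)
    qed
    also have "\<dots> = (\<Sum>j<n. mean (\<lambda>l. scaleC (coef (matrix_inv k) 0 j) (\<pi> (k ** g) (scaleC (coef (matrix_inv l) j 0) (\<pi> l v)))))"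
      by (intro mean_sum cc) (use n_pos kg k KG in auto)
    also have "\<dots> = (\<Sum>j<n. scaleC (coef (matrix_inv k) 0 j) (\<pi> (k ** g) (mean (\<lambda>l. scaleC (coef (matrix_inv l) j 0) (\<pi> l v)))))"
      by (intro sum.cong refl mean_linear bounded_linear_compose[OF bounded_linear_scaleC_right rep_linear[OF kg]] cont_integrand n_pos) auto
    \<comment> \<open>Only \<open>j = 0\<close> survives because \<open>v\<close> is the image of
      the first basis vector.\<close>
    also have "\<dots> = (\<Sum>j<n. if j = 0 then scaleC (coef (matrix_inv k) 0 0) (\<pi> (k ** g) (scaleC (1 / of_nat n) v)) else 0)"
      unfolding v_def using n_pos kg bounded_linear.linear[OF rep_linear[OF kg]]
      by (intro sum.cong refl) (auto simp: mean_coef_intertwiner[OF T] linear_0)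
    also have "\<dots> = scaleC (1 / of_nat n) (scaleC (coef (matrix_inv k) 0 0) (\<pi> k (\<pi> g v)))"
      using n_pos kg k g KG by (simp add: rep_scaleC rep_mul scaleC_scaleC mult.commute)
    finally show "mean (\<lambda>l. scaleC (coef (matrix_inv l) 0 0) (\<pi> (k ** (g ** l) ** matrix_inv k) v)) =
      scaleC (1 / of_nat n) (scaleC (coef (matrix_inv k) 0 0) (\<pi> k (\<pi> g v)))" .
  qed
  also have "\<dots> = scaleC (1 / of_nat n) (mean (\<lambda>k. scaleC (coef (matrix_inv k) 0 0) (\<pi> k (\<pi> g v))))"
    by (intro mean_linear bounded_linear_scaleC_right cont_integrand n_pos)
  finally show ?thesis using n_pos by (simp add: proj_def scaleC_scaleC power2_eq_square)
qed

lemma proj_linear: "proj (x + y) = proj x + proj y" "proj (scaleC c x) = scaleC c (proj x)"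
proof -
  have "mean (\<lambda>k. scaleC (coef (matrix_inv k) 0 0) (\<pi> k (x + y))) =
      mean (\<lambda>k. scaleC (coef (matrix_inv k) 0 0) (\<pi> k x) + scaleC (coef (matrix_inv k) 0 0) (\<pi> k y))"
    by (rule mean_cong) (simp add: rep_add KG scaleC_add_right)
  then show "proj (x + y) = proj x + proj y"
    unfolding proj_def using n_pos by (simp add: mean_add cont_integrand scaleC_add_right)
  have "mean (\<lambda>k. scaleC (coef (matrix_inv k) 0 0) (\<pi> k (scaleC c x))) =
      mean (\<lambda>k. scaleC c (scaleC (coef (matrix_inv k) 0 0) (\<pi> k x)))"
    by (rule mean_cong) (simp add: rep_scaleC KG scaleC_scaleC mult.commute)
  also have "\<dots> = scaleC c (mean (\<lambda>k. scaleC (coef (matrix_inv k) 0 0) (\<pi> k x)))"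
    by (intro mean_linear bounded_linear_scaleC_right cont_integrand n_pos)
  finally show "proj (scaleC c x) = scaleC c (proj x)"
    unfolding proj_def by (simp add: scaleC_scaleC mult.commute)
qed

lemma proj_cont: "continuous_on UNIV proj"
proof -
  have "continuous_on (UNIV \<times> K) (\<lambda>p. scaleC (coef (matrix_inv (snd p)) 0 0) (\<pi> (snd p) (fst p)))"
    by (intro continuous_on_scaleC coef_cont_comp continuous_on_matrix_inv_comp continuous_on_rep continuous_on_fst continuous_on_snd continuous_on_id)
      (use n_pos sub in auto)
  then have "continuous_on UNIV (\<lambda>v. mean (\<lambda>k. scaleC (coef (matrix_inv k) 0 0) (\<pi> k v)))"
    by (intro continuous_on_mean) (simp add: case_prod_unfold)
  then show ?thesis unfolding proj_def by (intro continuous_intros)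
qed

lemma common_eigen_intertwiner:
  assumes fin: "finite B" "\<I> \<subseteq> scale_map.span B" and ne: "\<I> \<noteq> {0}"
  obtains T \<kappa> where "T \<in> \<I>" "T \<noteq> 0" "\<And>g x. g \<in> G \<Longrightarrow> avg_conj g (T x) = scaleC (\<kappa> g) (T x)"
proof -
  have sub: "scale_map.subspace \<I>"
    unfolding scale_map.subspace_def
    by (auto simp: intertwiners_def scale_map_def scaleC_add_right rep_add KG rep_scaleC scaleC_scaleC mult.commute
        linear_0[OF bounded_linear.linear[OF rep_linear]] add_ac)
  let ?F = "(\<lambda>g (T :: complex Matrix.vec \<Rightarrow> 'v) x. avg_conj g (T x)) ` G"
  have ac0: "avg_conj g 0 = 0" if "g \<in> G" for g
    using avg_conj_scaleC[OF that, of 0 0] by simp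
  have "\<exists>T\<in>\<I>. T \<noteq> 0 \<and> (\<forall>f\<in>?F. \<exists>c. f T = scale_map c T)"
  proof (rule ex_common_eigenvector[OF scale_map.vector_space_axioms sub ne fin])
    fix f assume "f \<in> ?F"
    then obtain g where g: "g \<in> G" "f = (\<lambda>T x. avg_conj g (T x))" by blast
    show "linear_operator_on scale_map \<I> f"
      unfolding linear_operator_on_def[OF scale_map.vector_space_axioms] g(2)
      by (auto simp: intertwiners_def scale_map_def fun_eq_iff avg_conj_add[OF g(1)] avg_conj_scaleC[OF g(1)]
          avg_conj_commute[OF g(1)] ac0[OF g(1)])
  next
    fix f h T assume "f \<in> ?F" "h \<in> ?F" "T \<in> \<I>"
    then show "f (h T) = h (f T)" by (auto simp: avg_conj_abelian)
  qed
  then obtain T where T: "T \<in> \<I>" "T \<noteq> 0" "\<forall>f\<in>?F. \<exists>c. f T = scale_map c T"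
    by (elim bexE conjE)
  have "\<exists>c. (\<lambda>x. avg_conj g (T x)) = scale_map c T" if "g \<in> G" for g
    using bspec[OF T(3) imageI[OF that]] .
  then obtain \<kappa> where "\<And>g. g \<in> G \<Longrightarrow> (\<lambda>x. avg_conj g (T x)) = scale_map (\<kappa> g) T" by metis
  then show thesis using that[OF T(1,2), of \<kappa>] by (metis scale_map_def)
qed

text \<open>The kernel of \<open>T\<close> is a K-invariant subspace containing a nonzero vector,
  hence everything by irreducibility. Intertwiners are thus determined by their value at one basis
  vector.\<close>

lemma intertwiner_eq_0:
  assumes T: "T \<in> \<I>" and z: "T (unit_vec n 0) = 0"
  shows "T = 0"
proof -
  let ?W = "{x \<in> carrier_vec n. T x = 0}"
  have W: "?W = carrier_vec n"
  proof (rule invariant_subspace_trivial)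
    have "(0 :: complex) \<cdot>\<^sub>v 0\<^sub>v n = 0\<^sub>v n" by (rule eq_vecI) auto
    then show "0\<^sub>v n \<in> ?W" using intertwinerD(2)[OF T, of "0\<^sub>v n" 0] by simp
    show "x + y \<in> ?W" if "x \<in> ?W" "y \<in> ?W" for x y using that intertwinerD(1)[OF T] by auto
    show "c \<cdot>\<^sub>v x \<in> ?W" if "x \<in> ?W" for c x using that intertwinerD(2)[OF T] by auto
    show "\<tau> k *\<^sub>v x \<in> ?W" if "k \<in> K" "x \<in> ?W" for k x
      using that intertwinerD(3)[OF T] linear_0[OF bounded_linear.linear[OF rep_linear[OF KG]]]
      by (auto intro: mult_mat_vec_carrier[of _ n n])
    show "unit_vec n 0 \<in> ?W" using z by simp
    show "unit_vec n 0 \<noteq> (0\<^sub>v n :: complex Matrix.vec)"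
    proof
      assume "unit_vec n 0 = (0\<^sub>v n :: complex Matrix.vec)"
      then have "vec_index (unit_vec n 0) 0 = (vec_index (0\<^sub>v n) 0 :: complex)" by (rule arg_cong)
      then show False using n_pos by simp
    qed
  qed auto
  show ?thesis
  proof (rule ext)
    fix x
    have "T x = 0" if "x \<in> carrier_vec n" using subsetD[OF equalityD2[OF W] that] by simp
    then show "T x = 0 x" using intertwinerD(4)[OF T, of x] by (cases "x \<in> carrier_vec n") simp_all
  qed
qed

lemma multiplicity_le_one:
  assumes irr\<pi>: "\<And>W. closed_invariant_subspace G \<pi> W \<Longrightarrow> W = {0} \<or> W = UNIV"
    and fin: "multiplicity_in K n \<tau> \<pi> \<noteq> \<infinity>"
  shows "multiplicity_in K n \<tau> \<pi> \<in> {0, 1}"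
proof -
  obtain B where B: "finite B" "\<I> \<subseteq> scale_map.span B"
    using fin unfolding multiplicity_in_def by (auto split: if_splits)
  have "\<exists>T. \<I> \<subseteq> scale_map.span {T}"
  proof (cases "\<I> = {0}")
    case False
    obtain T \<kappa> where T: "T \<in> \<I>" "T \<noteq> 0" "\<And>g x. g \<in> G \<Longrightarrow> avg_conj g (T x) = scaleC (\<kappa> g) (T x)"
      using common_eigen_intertwiner[OF B False] by blast
    define v where "v = T (unit_vec n 0)"
    have v0: "v \<noteq> 0" unfolding v_def using intertwiner_eq_0[OF T(1)] T(2) by blast
    let ?L = "{w. \<exists>c. w = scaleC c v}"
    \<comment> \<open>Instead of the closed span of the orbit of \<open>v\<close>, this takes all
      vectors whose whole orbit projects into the line of \<open>v\<close>. It is visibly closed and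
      invariant, so only \<open>v \<in> W\<close> needs the averaged operators.\<close>
    define W where "W = {w. \<forall>g\<in>G. proj (\<pi> g w) \<in> ?L}"
    have in_line: "proj (\<pi> g v) \<in> ?L" if g: "g \<in> G" for g
    proof -
      \<comment> \<open>The eigenvalue is given by the coefficient formula because
        \<open>\<kappa>\<close> is obtained by choice and carries no continuity, while the mean
        below requires it.\<close>
      define \<phi> where "\<phi> l = cinner (avg_conj (g ** l) v) v / cinner v v" for l
      have gl: "g ** l \<in> G" if "l \<in> K" for l using g KG mulG that by blast
      have \<phi>: "avg_conj (g ** l) v = scaleC (\<phi> l) v" if "l \<in> K" for l
        using T(3)[OF gl[OF that]] mem_line_iff[OF v0] unfolding v_def \<phi>_def by metis
      have cont: "continuous_on K (\<lambda>l. coef (matrix_inv l) 0 0 * \<phi> l)"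
        unfolding \<phi>_def divide_inverse
        by (intro continuous_intros coef_cont_comp continuous_on_matrix_inv continuous_on_avg_conj continuous_on_matrix_mul)
          (use n_pos gl in auto)
      have "scaleC (1 / (of_nat n)^2) (proj (\<pi> g v)) = mean (\<lambda>l. scaleC (coef (matrix_inv l) 0 0) (avg_conj (g ** l) v))"
        using proj_rep[OF T(1) g] by (simp add: v_def)
      also have "\<dots> = mean (\<lambda>l. scaleC (coef (matrix_inv l) 0 0 * \<phi> l) v)"
        by (rule mean_cong) (simp add: \<phi> scaleC_scaleC)
      also have "\<dots> = scaleC (mean (\<lambda>l. coef (matrix_inv l) 0 0 * \<phi> l)) v"
        by (rule mean_linear[OF cont bounded_linear_scaleC_left])
      finally have "scaleC ((of_nat n)^2) (scaleC (1 / (of_nat n)^2) (proj (\<pi> g v))) =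
         scaleC ((of_nat n)^2) (scaleC (mean (\<lambda>l. coef (matrix_inv l) 0 0 * \<phi> l)) v)" by simp
      then show ?thesis using n_pos by (auto simp: scaleC_scaleC)
    qed
    have clL: "closed ?L" by (rule closed_line[OF v0])
    have "closed_invariant_subspace G \<pi> W"
      unfolding closed_invariant_subspace_def
    proof (intro conjI ballI allI)
      have "W = (\<Inter>g\<in>G. (\<lambda>w. proj (\<pi> g w)) -` ?L)" by (auto simp: W_def)
      moreover have "closed ((\<lambda>w. proj (\<pi> g w)) -` ?L)" if "g \<in> G" for g
      proof (rule closed_vimage[OF clL])
        show "continuous_on UNIV (\<lambda>w. proj (\<pi> g w))"
          using continuous_on_compose2[OF proj_cont linear_continuous_on[OF rep_linear[OF that]]] by auto
      qed
      ultimately show "closed W" by auto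
      have p0: "proj 0 = 0" using proj_linear(2)[of 0 0] by simp
      show "0 \<in> W" using linear_0[OF bounded_linear.linear[OF rep_linear]] p0
        by (auto simp: W_def intro!: exI[of _ 0])
      show "x + y \<in> W" if xy: "x \<in> W" "y \<in> W" for x y
        unfolding W_def
      proof (intro CollectI ballI)
        fix g assume g: "g \<in> G"
        obtain c d where "proj (\<pi> g x) = scaleC c v" "proj (\<pi> g y) = scaleC d v" using xy g unfolding W_def by blast
        then show "\<exists>c. proj (\<pi> g (x + y)) = scaleC c v"
          using g by (intro exI[of _ "c + d"]) (simp add: rep_add proj_linear scaleC_add_left)
      qed
      show "scaleC c x \<in> W" if x: "x \<in> W" for c x
        unfolding W_def
      proof (intro CollectI ballI)
        fix g assume g: "g \<in> G"
        obtain d where "proj (\<pi> g x) = scaleC d v" using x g by (auto simp: W_def)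
        then show "\<exists>d. proj (\<pi> g (scaleC c x)) = scaleC d v"
          using g by (intro exI[of _ "c * d"]) (simp add: rep_scaleC proj_linear scaleC_scaleC)
      qed
      show "\<pi> h x \<in> W" if "h \<in> G" "x \<in> W" for h x
        unfolding W_def
      proof (intro CollectI ballI)
        fix g assume g: "g \<in> G"
        have "proj (\<pi> g (\<pi> h x)) = proj (\<pi> (g ** h) x)" using rep_mul[OF g that(1)] by simp
        then show "\<exists>c. proj (\<pi> g (\<pi> h x)) = scaleC c v" using that g mulG by (auto simp: W_def)
      qed
    qed
    moreover have "v \<in> W" using in_line by (auto simp: W_def)
    ultimately have W: "W = UNIV" using irr\<pi> v0 by blast
    have "T' \<in> scale_map.span {T}" if T': "T' \<in> \<I>" for T'
    proof -
      have "proj (\<pi> mone (T' (unit_vec n 0))) \<in> ?L" 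
      proof -
        have "T' (unit_vec n 0) \<in> W" using W by simp
        then show ?thesis using KG[OF one_mem] unfolding W_def by blast
      qed
      then obtain c where c: "T' (unit_vec n 0) = scaleC c v"
        using proj_intertwiner[OF T', of "unit_vec n 0"] n_pos by auto
      define D where "D = (\<lambda>x. T' x - scaleC c (T x))"
      have neg: "D = T' + scale_map (- c) T"
        by (auto simp: D_def scale_map_def fun_eq_iff bounded_bilinear.minus_left[OF bounded_bilinear_scaleC])
      have "scale_map.subspace \<I>"
        unfolding scale_map.subspace_def
        by (auto simp: intertwiners_def scale_map_def scaleC_add_right rep_add KG rep_scaleC scaleC_scaleC mult.commute
            linear_0[OF bounded_linear.linear[OF rep_linear]] add_ac)
      then have "D \<in> \<I>" unfolding neg using T' T(1) scale_map.subspace_add scale_map.subspace_scale by blast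
      moreover have "D (unit_vec n 0) = 0" using c by (simp add: D_def v_def)
      ultimately have "D = 0" by (rule intertwiner_eq_0)
      then have "T' = scale_map c T" by (auto simp: D_def scale_map_def fun_eq_iff)
      then show ?thesis using scale_map.span_base scale_map.span_scale by blast
    qed
    then show ?thesis by blast
  qed (auto simp: scale_map.span_zero)
  then obtain T where "\<I> \<subseteq> scale_map.span {T}" by blast
  then have "scale_map.dim \<I> \<le> 1" using scale_map.dim_le_card[of \<I> "{T}"] by simp
  moreover have "multiplicity_in K n \<tau> \<pi> = enat (scale_map.dim \<I>)"
    unfolding multiplicity_in_def using B by auto
  ultimately show ?thesis by (auto simp: le_Suc_eq zero_enat_def one_enat_def)
qed

end

theorem (in strong_gelfand) multiplicity_freeI:
  assumes "irreducible_hilbert_representation G \<pi>" "admissible K \<pi>"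
  shows "multiplicity_free K \<pi>"
  unfolding multiplicity_free_def
proof (intro allI impI)
  fix n \<tau> assume "irreducible_matrix_representation K n \<tau>"
  then interpret gelfand_irrep K G \<pi> \<theta> n \<tau> by unfold_locales
  show "multiplicity_in K n \<tau> \<pi> \<in> {0, 1}"
  proof (rule multiplicity_le_one)
    show "W = {0} \<or> W = UNIV" if "closed_invariant_subspace G \<pi> W" for W
      using assms(1) that unfolding irreducible_hilbert_representation_def by (elim conjE allE[of _ W] impE)
    show "multiplicity_in K n \<tau> \<pi> \<noteq> \<infinity>"
      using assms(2) irr unfolding admissible_def by (elim allE impE)
  qed
qed

section \<open>Isometries of a signature form\<close>

lemmas cart_eq_iff = Finite_Cartesian_Product.vec_eq_iff

text \<open>Covers the reals with trivial conjugation and the complex numbers with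
  \<open>cnj\<close>, so that both kinds of isometry groups are treated at once. The last axiom
  makes multiplication by \<open>star y\<close> the adjoint of multiplication by \<open>y\<close>
  for the real inner product.\<close>

class star_field = real_normed_field + euclidean_space +
  fixes star :: "'a \<Rightarrow> 'a"
  assumes star_add [simp]: "star (x + y) = star x + star y"
    and star_mult [simp]: "star (x * y) = star x * star y"
    and star_star [simp]: "star (star x) = x"
    and star_mult_self_scaleR: "star x * x = (norm x)\<^sup>2 *\<^sub>R 1"
    and inner_mult_right: "inner x (y * z) = inner (star y * x) z"

instantiation real :: star_field
begin
definition star_real :: "real \<Rightarrow> real" where [simp]: "star_real x = x"
instance by standard (auto simp: power2_eq_square)
end

instantiation complex :: star_field
begin
definition star_complex :: "complex \<Rightarrow> complex" where [simp]: "star_complex x = cnj x"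
instance
proof
  fix x y z :: complex
  show "star x * x = (norm x)\<^sup>2 *\<^sub>R 1"
    using complex_norm_square[of x] by (simp add: mult.commute scaleR_conv_of_real)
  show "inner x (y * z) = inner (star y * x) z" by (simp add: inner_complex_def algebra_simps)
qed auto
end

lemma star_mult_self: "star x * x = (of_real ((norm x)\<^sup>2) :: 'a::star_field)"
  by (simp only: star_mult_self_scaleR of_real_def)

lemma star_of_real [simp]: "star (of_real r :: 'a::star_field) = of_real r"
proof -
  have "inner (star (of_real r) :: 'a) z = inner (of_real r) z" for z :: 'a
    using inner_mult_right[of 1 "of_real r" z] by (simp add: of_real_def inner_commute)
  then show ?thesis using vector_eq_rdot by blast
qed

lemma star_01 [simp]: "star 0 = (0::'a::star_field)" "star 1 = (1::'a::star_field)"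
  using star_of_real[of 0] star_of_real[of 1] by simp_all

lemma star_minus [simp]: "star (- x) = - star (x::'a::star_field)"
  using star_add[of x "- x"] by (simp del: star_add add: eq_neg_iff_add_eq_0 add.commute)

lemma star_diff [simp]: "star (x - y) = star x - star (y::'a::star_field)"
  using star_add[of x "- y"] by simp

lemma norm_star [simp]: "norm (star x) = norm (x::'a::star_field)"
proof -
  have "of_real ((norm (star x))\<^sup>2) = (of_real ((norm x)\<^sup>2) :: 'a)"
    by (simp only: star_mult_self[symmetric] star_star mult.commute)
  then show ?thesis by (simp add: of_real_eq_iff power2_eq_iff_nonneg del: of_real_power)
qed

lemma star_sum [simp]: "star (sum f A) = (\<Sum>i\<in>A. star (f i :: 'a::star_field))"
  by (induction A rule: infinite_finite_induct) auto

lemma star_divide [simp]: "star (x / y) = star x / star (y::'a::star_field)"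
proof (cases "y = 0")
  case False
  then have "star y \<noteq> 0" by (metis star_star star_01(1))
  moreover have "star (x / y) * star y = star x" using False by (simp flip: star_mult)
  ultimately show ?thesis by (simp add: field_simps)
qed simp

lemma bounded_linear_star: "bounded_linear (star :: 'a::star_field \<Rightarrow> 'a)"
  by (rule bounded_linear_intro[where K = 1]) (auto simp: scaleR_conv_of_real)

lemmas continuous_on_star [continuous_intros] = bounded_linear.continuous_on[OF bounded_linear_star]

definition adj :: "'a::star_field ^ 'n ^ 'm \<Rightarrow> 'a ^ 'm ^ 'n" where
  "adj A = (\<chi> i j. star (A $ j $ i))"

lemma adj_nth [simp]: "adj A $ i $ j = star (A $ j $ i)"
  by (simp add: adj_def)

lemma adj_mul: "adj (A ** B) = adj B ** adj A"
  by (simp add: cart_eq_iff matrix_matrix_mult_def mult.commute)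

lemma adj_adj [simp]: "adj (adj A) = A"
  by (simp add: cart_eq_iff)

lemma adj_one [simp]: "adj mone = mone"
  by (simp add: cart_eq_iff Finite_Cartesian_Product.mat_def)

lemma continuous_on_adj [continuous_intros]:
  "continuous_on S f \<Longrightarrow> continuous_on S (\<lambda>x. adj (f x :: 'a::star_field ^ 'n::finite ^ 'm::finite))"
  unfolding adj_def by (intro continuous_intros)

definition diag_form :: "('n \<Rightarrow> real) \<Rightarrow> 'a::star_field ^ 'n ^ 'n" where
  "diag_form sg = (\<chi> i j. if i = j then of_real (sg i) else 0)"

text \<open>For signs 1 and -1 this is O(p,q) over the reals and U(p,q) over the complex
  numbers.\<close>

definition isoms :: "('n \<Rightarrow> real) \<Rightarrow> ('a::star_field ^ 'n::finite ^ 'n) set" where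
  "isoms sg = {A. adj A ** diag_form sg ** A = diag_form sg}"

definition form :: "('n::finite \<Rightarrow> real) \<Rightarrow> 'a::star_field ^ 'n \<Rightarrow> 'a ^ 'n \<Rightarrow> 'a" where
  "form sg x y = (\<Sum>r\<in>UNIV. of_real (sg r) * (star (x $ r) * y $ r))"

lemma matrix_inv_eqI:
  assumes "A ** B = mone" "B ** A = mone"
  shows "matrix_inv A = B"
proof -
  have "A ** matrix_inv A = mone \<and> matrix_inv A ** A = mone"
    unfolding matrix_inv_def by (rule someI[of _ B]) (use assms in blast)
  then show ?thesis by (metis assms(2) matrix_mul_assoc matrix_mul_lid matrix_mul_rid)
qed

lemma diag_form_mul_right: "(A ** diag_form sg) $ i $ j = A $ i $ j * of_real (sg j)"
proof -
  have "(A ** diag_form sg) $ i $ j = (\<Sum>k\<in>UNIV. if k = j then A $ i $ j * of_real (sg j) else 0)"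
    unfolding matrix_matrix_mult_def diag_form_def by (simp only: vec_lambda_beta, intro sum.cong) auto
  then show ?thesis by simp
qed

lemma diag_form_mul_left: "(diag_form sg ** A) $ i $ j = of_real (sg i) * A $ i $ j"
proof -
  have "(diag_form sg ** A) $ i $ j = (\<Sum>k\<in>UNIV. if k = i then of_real (sg i) * A $ i $ j else 0)"
    unfolding matrix_matrix_mult_def diag_form_def by (simp only: vec_lambda_beta, intro sum.cong) auto
  then show ?thesis by simp
qed

lemma adj_diag_form [simp]: "adj (diag_form sg) = diag_form sg"
  by (simp add: cart_eq_iff diag_form_def)

lemma form_mul: "(adj A ** diag_form sg ** B) $ p $ q = form sg (column p A) (column q B)"
proof -
  have "(adj A ** diag_form sg ** B) $ p $ q = (\<Sum>r\<in>UNIV. (adj A ** diag_form sg) $ p $ r * B $ r $ q)"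
    by (simp add: matrix_matrix_mult_def)
  then show ?thesis by (simp add: diag_form_mul_right form_def column_def mult_ac)
qed

lemma isoms_iff: "A \<in> isoms sg \<longleftrightarrow> (\<forall>p q. form sg (column p A) (column q A) = (if p = q then of_real (sg p) else 0))"
  by (simp add: isoms_def cart_eq_iff form_mul) (simp add: diag_form_def)

lemma form_linear:
  "form sg (x + y) z = form sg x z + form sg y z" "form sg x (y + z) = form sg x y + form sg x z"
  "form sg (x - y) z = form sg x z - form sg y z" "form sg x (y - z) = form sg x y - form sg x z"
  "form sg (c *s x) y = star c * form sg x y" "form sg x (c *s y) = c * form sg x y"
  by (simp_all add: form_def algebra_simps sum.distrib sum_distrib_left sum_subtractf)

lemma form_star: "star (form sg x y) = form sg y x"
  by (simp add: form_def mult_ac)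

lemma form_isom: assumes "A \<in> isoms sg" shows "form sg (A *v x) (A *v y) = form sg x y"
proof -
  have "form sg (A *v x) (A *v y) = (\<Sum>r\<in>UNIV. \<Sum>p\<in>UNIV. \<Sum>q\<in>UNIV. of_real (sg r) * (star (A $ r $ p) * star (x $ p) * (A $ r $ q * y $ q)))"
    unfolding form_def matrix_vector_mult_def by (simp add: sum_product) (simp add: sum_distrib_left)
  also have "\<dots> = (\<Sum>p\<in>UNIV. \<Sum>q\<in>UNIV. \<Sum>r\<in>UNIV. of_real (sg r) * (star (A $ r $ p) * star (x $ p) * (A $ r $ q * y $ q)))"
    by (subst sum.swap) (intro sum.cong refl sum.swap)
  also have "\<dots> = (\<Sum>p\<in>UNIV. \<Sum>q\<in>UNIV. (star (x $ p) * y $ q) * form sg (column p A) (column q A))"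
    unfolding form_def column_def by (simp add: sum_distrib_left mult_ac)
  also have "\<dots> = (\<Sum>p\<in>UNIV. \<Sum>q\<in>UNIV. if p = q then (star (x $ p) * y $ q) * of_real (sg p) else 0)"
    using assms by (intro sum.cong refl) (simp add: isoms_iff)
  finally show ?thesis by (simp add: form_def mult_ac)
qed

lemma column_mul: "column q (A ** B) = A *v column q B"
  by (simp add: cart_eq_iff column_def matrix_matrix_mult_def matrix_vector_mult_def)

lemma isoms_mul: "A \<in> isoms sg \<Longrightarrow> B \<in> isoms sg \<Longrightarrow> A ** B \<in> isoms sg"
  by (simp add: isoms_iff column_mul form_isom)

lemma isoms_one [simp]: "mone \<in> isoms sg"
  by (simp add: isoms_def)

lemma closed_isoms: "closed (isoms sg :: ('a::star_field ^ 'n::finite ^ 'n) set)"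
  unfolding isoms_def by (intro closed_Collect_eq continuous_intros)

locale signature =
  fixes sg :: "'n::finite \<Rightarrow> real"
  assumes sg_cases: "sg i = 1 \<or> sg i = -1"
begin

lemma sg_sq [simp]: "sg i * sg i = 1" "of_real (sg i) * of_real (sg i) = (1 :: 'a::star_field)"
  using sg_cases[of i] by auto

lemma diag_form_sq [simp]: "diag_form sg ** diag_form sg = (mone :: 'a::star_field ^ 'n ^ 'n)"
  by (simp add: cart_eq_iff diag_form_mul_left Finite_Cartesian_Product.mat_def) (simp add: diag_form_def)

lemma diag_form_cancel [simp]:
  "diag_form sg ** (diag_form sg ** A) = (A :: 'a::star_field ^ 'n ^ 'n)"
  "A ** diag_form sg ** diag_form sg = (A :: 'a::star_field ^ 'n ^ 'n)"
  by (simp add: matrix_mul_assoc) (simp flip: matrix_mul_assoc)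

lemma isoms_inv:
  assumes "A \<in> isoms sg"
  shows "matrix_inv A = diag_form sg ** adj A ** diag_form sg"
    "A ** matrix_inv A = mone" "matrix_inv A ** A = mone" "matrix_inv A \<in> isoms sg" "adj A \<in> isoms sg"
proof -
  let ?J = "diag_form sg :: 'a ^ 'n ^ 'n" and ?B = "diag_form sg ** adj A ** diag_form sg"
  have e: "adj A ** ?J ** A = ?J" using assms by (simp add: isoms_def)
  have 1: "?B ** A = mone" using e by (simp flip: matrix_mul_assoc)
  then have 2: "A ** ?B = mone" by (simp add: matrix_left_right_inverse)
  show 3: "matrix_inv A = ?B" using 1 2 by (rule matrix_inv_eqI[rotated])
  show 4: "A ** matrix_inv A = mone" "matrix_inv A ** A = mone" using 1 2 3 by simp_all
  have "A ** ?J ** adj A = A ** ?B ** ?J" by (simp add: matrix_mul_assoc)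
  then show 5: "adj A \<in> isoms sg" unfolding 2 by (simp add: isoms_def)
  have J: "?J \<in> isoms sg" by (simp add: isoms_def)
  show "matrix_inv A \<in> isoms sg" unfolding 3 by (intro isoms_mul J 5)
qed

lemma isoms_inv_cancel:
  assumes "A \<in> isoms sg"
  shows "A ** (matrix_inv A ** B) = B" "matrix_inv A ** (A ** B) = B"
    "B ** A ** matrix_inv A = B" "B ** matrix_inv A ** A = B"
  by (simp_all add: isoms_inv(2,3)[OF assms] matrix_mul_assoc, simp_all add: isoms_inv(2,3)[OF assms] flip: matrix_mul_assoc)

end

subsection \<open>Compact groups of isometries\<close>

lemma norm_matrix_sq: "(norm (A :: 'a::star_field ^ 'n::finite ^ 'm::finite))\<^sup>2 = (\<Sum>q\<in>UNIV. (norm (column q A))\<^sup>2)"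
proof -
  have v: "(norm x)\<^sup>2 = (\<Sum>i\<in>UNIV. (norm (x $ i))\<^sup>2)" for x :: "'b::real_normed_vector ^ 'k::finite"
    by (simp add: norm_vec_def L2_set_def sum_nonneg)
  show ?thesis unfolding v column_def by simp (rule sum.swap)
qed

lemma norm_add_scaled_sq:
  "(norm (of_real c *s x + of_real s *s (y :: 'a::star_field ^ 'n::finite)))\<^sup>2 =
     c\<^sup>2 * (norm x)\<^sup>2 + s\<^sup>2 * (norm y)\<^sup>2 + 2 * c * s * inner x y"
proof -
  have "of_real c *s x = c *\<^sub>R x" "of_real s *s y = s *\<^sub>R y"
    by (simp_all add: cart_eq_iff flip: scaleR_conv_of_real)
  then show ?thesis
    by (simp only: power2_norm_eq_inner inner_add_left inner_add_right inner_scaleR_left inner_scaleR_right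
        inner_commute[of y x]) (simp only: power2_eq_square algebra_simps mult_2)
qed

lemma inner_scaled: "inner (x :: 'a::star_field ^ 'n::finite) (c *s y) = inner (star c *s x) y"
  by (simp add: inner_vec_def inner_mult_right)

lemma continuous_on_matrix_vec [continuous_intros]:
  fixes f :: "'x::topological_space \<Rightarrow> 'a::real_normed_field ^ 'n::finite ^ 'm::finite"
  assumes "continuous_on S f" "continuous_on S g"
  shows "continuous_on S (\<lambda>x. f x *v g x)"
  unfolding matrix_vector_mult_def by (intro continuous_intros assms)

locale compact_isometry_group = compact_matrix_group K + signature sg
  for K :: "('a::star_field ^ 'n::finite ^ 'n) set" and sg +
  assumes K_isoms: "K \<subseteq> isoms sg"
begin

definition nrm :: "'a ^ 'n \<Rightarrow> real" where
  "nrm x = mean (\<lambda>k. (norm (k *v x))\<^sup>2)"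

text \<open>This function plays the part of the convex function in Cartan's fixed point theorem: its
  minimizers correspond to points of the symmetric space fixed by \<open>K\<close>.\<close>

definition energy :: "'a ^ 'n ^ 'n \<Rightarrow> real" where
  "energy h = mean (\<lambda>k. (norm (k ** h))\<^sup>2)"

lemma energy_eq: "energy h = (\<Sum>q\<in>UNIV. nrm (column q h))"
  unfolding energy_def nrm_def norm_matrix_sq column_mul
  by (intro mean_sum continuous_intros) auto

lemma nrm_add: "nrm (of_real c *s x + of_real s *s y) =
    c\<^sup>2 * nrm x + s\<^sup>2 * nrm y + 2 * c * s * mean (\<lambda>k. inner (k *v x) (k *v y))"
proof -
  have eq: "k *v (of_real c *s x + of_real s *s y) = of_real c *s (k *v x) + of_real s *s (k *v y)" for k
    by (simp add: matrix_vector_right_distrib vector_scalar_commute)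
  have m: "mean (\<lambda>k. a * f k) = a * mean f" if "continuous_on K f" for a and f :: "_ \<Rightarrow> real"
    using mean_linear[OF that bounded_linear_mult_right] .
  show ?thesis unfolding nrm_def eq norm_add_scaled_sq
    by (subst mean_add, (intro continuous_intros)+, subst mean_add, (intro continuous_intros)+,
        subst m, (intro continuous_intros)+, subst m, (intro continuous_intros)+, subst m, (intro continuous_intros)+) simp
qed

text \<open>A minimum over the compact product of \<open>K\<close> with the unit sphere, positive
  because elements of \<open>K\<close> are invertible. It makes \<open>energy\<close> proper and
  \<open>nrm\<close> definite.\<close>

lemma norm_mul_lower: obtains m where "m > 0" "\<And>k h :: 'a^'n^'n. k \<in> K \<Longrightarrow> m * norm h \<le> norm (k ** h)"
proof -
  let ?f = "\<lambda>(k, u). norm (k ** u :: 'a^'n^'n)"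
  have comp: "compact (K \<times> sphere 0 1 :: (('a^'n^'n) \<times> ('a^'n^'n)) set)"
    by (intro compact_Times compact compact_sphere)
  have "sphere 0 1 \<noteq> ({} :: ('a^'n^'n) set)" by simp
  then have ne: "K \<times> sphere 0 1 \<noteq> ({} :: (('a^'n^'n) \<times> ('a^'n^'n)) set)" using one_mem by blast
  have "continuous_on (K \<times> sphere 0 1) ?f" unfolding case_prod_unfold by (intro continuous_intros)
  from continuous_attains_inf[OF comp ne this]
  obtain p where p: "p \<in> K \<times> sphere 0 1" "\<forall>q\<in>K \<times> sphere 0 1. ?f p \<le> ?f q" by (elim bexE)
  define k0 where "k0 = fst p"
  define u0 where "u0 = snd p"
  have ku: "k0 \<in> K" "norm u0 = 1" using p(1) by (auto simp: k0_def u0_def)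
  have ku3: "norm (k0 ** u0) \<le> norm (k ** u)" if "k \<in> K" "norm u = 1" for k u :: "'a^'n^'n"
    using p(2)[THEN bspec, of "(k, u)"] that by (simp add: k0_def u0_def case_prod_unfold)
  have pos: "norm (k0 ** u0) > 0"
  proof -
    have "k0 ** u0 \<noteq> 0"
    proof
      assume "k0 ** u0 = 0"
      then have "matrix_inv k0 ** (k0 ** u0) = 0" by simp
      then show False using ku(1,2) by simp
    qed
    then show ?thesis by simp
  qed
  show thesis
  proof (rule that[OF pos])
    fix k h :: "'a^'n^'n" assume k: "k \<in> K"
    show "norm (k0 ** u0) * norm h \<le> norm (k ** h)"
    proof (cases "h = 0")
      case False
      have "k ** ((1 / norm h) *\<^sub>R h) = (1 / norm h) *\<^sub>R (k ** h)"
        by (simp add: cart_eq_iff matrix_matrix_mult_def scaleR_sum_right)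
      then have "norm (k0 ** u0) \<le> norm (k ** h) / norm h"
        using ku3[OF k, of "(1 / norm h) *\<^sub>R h"] False by simp
      then show ?thesis using False by (simp add: field_simps)
    qed simp
  qed
qed

lemma ex_energy_minimizer: obtains h where "h \<in> isoms sg" "\<And>g. g \<in> isoms sg \<Longrightarrow> energy h \<le> energy g"
proof -
  obtain m where m: "m > 0" "\<And>k h :: 'a^'n^'n. k \<in> K \<Longrightarrow> m * norm h \<le> norm (k ** h)" using norm_mul_lower by blast
  have low: "(m * norm h)\<^sup>2 \<le> energy h" for h
  proof -
    have "mean (\<lambda>k. (m * norm h)\<^sup>2) \<le> energy h" unfolding energy_def
      using m by (intro mean_mono continuous_intros power_mono) auto
    then show ?thesis by simp
  qed
  \<comment> \<open>Beyond the radius \<open>sqrt (energy mone) / m\<close> the energy is at least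
    \<open>energy mone\<close>; the summand \<open>norm mone\<close> only ensures that
    \<open>mone\<close> lies in the ball.\<close>
  define S :: "('a^'n^'n) set" where "S = isoms sg \<inter> cball 0 (norm (mone :: 'a^'n^'n) + sqrt (energy mone) / m)"
  have en: "energy (mone :: 'a^'n^'n) \<ge> 0" using low[of mone] by (meson order_trans zero_le_power2)
  have comp: "compact S" unfolding S_def by (intro closed_Int_compact closed_isoms compact_cball)
  have oneS: "mone \<in> S" 
    using divide_nonneg_pos[OF real_sqrt_ge_zero[OF en] m(1)] by (simp add: S_def)
  then have "S \<noteq> {}" by blast
  moreover have "compact S" by (rule comp)
  moreover have "continuous_on S energy" unfolding energy_def
    by (rule continuous_on_mean) (unfold case_prod_unfold, intro continuous_intros)
  ultimately have "\<exists>h\<in>S. \<forall>g\<in>S. energy h \<le> energy g" by (intro continuous_attains_inf)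
  then obtain h where h: "h \<in> S" "\<And>g. g \<in> S \<Longrightarrow> energy h \<le> energy g" by blast
  show thesis
  proof (rule that)
    show "h \<in> isoms sg" using h(1) by (simp add: S_def)
    fix g :: "'a^'n^'n" assume g: "g \<in> isoms sg"
    show "energy h \<le> energy g"
    proof (cases "g \<in> S")
      case False
      then have "norm (mone :: 'a^'n^'n) + sqrt (energy mone) / m < norm g" using g by (simp add: S_def)
      then have "sqrt (energy mone) / m < norm g" using norm_ge_zero[of "mone :: 'a^'n^'n"] by linarith
      then have "sqrt (energy mone) < m * norm g" using m(1) by (simp add: field_simps)
      then have "(sqrt (energy mone))\<^sup>2 \<le> (m * norm g)\<^sup>2" using en by (intro power_mono) auto
      then show ?thesis using low[of g] en h(2)[OF oneS] by simp
    qed (use h in blast)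
  qed
qed

text \<open>The first variation of the energy along the hyperbolic rotations in a plane of signature (1,1).\<close>

lemma energy_minimizer_orthogonal:
  assumes h: "h \<in> isoms sg" and min: "\<And>g. g \<in> isoms sg \<Longrightarrow> energy h \<le> energy g"
    and ij: "sg i = 1" "sg j = -1" and \<sigma>: "norm \<sigma> = 1"
  shows "mean (\<lambda>k. inner (k *v column i h) (k *v (\<sigma> *s column j h))) = 0"
proof -
  define x where "x = column i h"
  define y where "y = column j h"
  define N where "N = mean (\<lambda>k. inner (k *v x) (k *v (\<sigma> *s y)))"
  define A where "A = nrm x + nrm y"
  have ne: "i \<noteq> j" using ij by auto
  have \<sigma>2: "star \<sigma> * \<sigma> = 1" "\<sigma> * star \<sigma> = 1" using star_mult_self[of \<sigma>] \<sigma> by (simp_all add: mult.commute)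
  have fh: "form sg (column p h) (column q h) = (if p = q then of_real (sg p) else 0)" for p q
    using h by (simp add: isoms_iff)
  have scaled: "nrm (c *s z) = nrm z" if "norm c = 1" for c z
  proof -
    have "norm (k *v (c *s z)) = norm (k *v z)" for k :: "'a^'n^'n"
      using that by (simp add: vector_scalar_commute norm_vec_def norm_mult L2_set_def)
    then show ?thesis by (simp add: nrm_def)
  qed
  have N2: "mean (\<lambda>k. inner (k *v y) (k *v (star \<sigma> *s x))) = N"
  proof -
    have "inner (k *v y) (k *v (star \<sigma> *s x)) = inner (k *v x) (k *v (\<sigma> *s y))" for k :: "'a^'n^'n"
      unfolding vector_scalar_commute inner_scaled[of "k *v y"] by (simp only: star_star inner_commute)
    then show ?thesis by (simp only: N_def)
  qed
  \<comment> \<open>The columns \<open>x\<close> and \<open>y\<close> are mixed by a hyperbolic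
    rotation with phase \<open>\<sigma>\<close>, the others kept. The result is again an isometry,
    and the inequality is the change of the energy, with the relation between \<open>c\<close> and
    \<open>s\<close> substituted.\<close>
  have key: "0 \<le> 2 * s\<^sup>2 * A + 4 * c * s * N" if cs: "c\<^sup>2 - s\<^sup>2 = 1" for c s :: real
  proof -
    define x' where "x' = of_real c *s x + of_real s *s (\<sigma> *s y)"
    define y' where "y' = of_real c *s y + of_real s *s (star \<sigma> *s x)"
    define g where "g = (\<chi> r q. if q = i then x' $ r else if q = j then y' $ r else h $ r $ q)"
    have col: "column q g = (if q = i then x' else if q = j then y' else column q h)" for q
      by (simp add: g_def column_def cart_eq_iff)
    have cs': "of_real c * of_real c = 1 + (of_real s * of_real s :: 'a)"
    proof -
      have "of_real (c\<^sup>2) = (of_real (1 + s\<^sup>2) :: 'a)" using cs by (intro arg_cong[of _ _ of_real]) simp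
      then show ?thesis by (simp add: power2_eq_square)
    qed
    have s1: "star \<sigma> * (\<sigma> * a) = a" "\<sigma> * (star \<sigma> * a) = a" for a using \<sigma>2 by (simp_all flip: mult.assoc)
    have "g \<in> isoms sg" unfolding isoms_iff
    proof (intro allI)
      fix p q
      have f1: "form sg x x = 1" "form sg y y = -1" "form sg x y = 0" "form sg y x = 0"
        using fh[of i i] fh[of j j] fh[of i j] fh[of j i] ij ne by (simp_all add: x_def y_def)
      have f2: "form sg x' x' = 1" "form sg y' y' = -1" "form sg x' y' = 0" "form sg y' x' = 0"
        unfolding x'_def y'_def form_linear by (simp_all add: f1 cs' s1 \<sigma>2 algebra_simps)
      have f3: "form sg (column r h) x' = 0" "form sg x' (column r h) = 0"
          "form sg (column r h) y' = 0" "form sg y' (column r h) = 0" if "r \<noteq> i" "r \<noteq> j" for r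
        unfolding x'_def y'_def form_linear using fh[of r i] fh[of r j] fh[of i r] fh[of j r] that
        by (simp_all add: x_def y_def)
      show "form sg (column p g) (column q g) = (if p = q then of_real (sg p) else 0)"
        using ne ij by (auto simp: col f2 f3 fh)
    qed
    then have "energy h \<le> energy g" by (rule min)
    moreover have split: "(\<Sum>q\<in>UNIV. F q) = F i + F j + (\<Sum>q\<in>UNIV - {i} - {j}. F q)" for F :: "'n \<Rightarrow> real"
      using ne by (subst sum.remove[of _ i], simp, simp, subst sum.remove[of _ j]) auto
    have "energy g = nrm x' + nrm y' + (\<Sum>q\<in>UNIV - {i} - {j}. nrm (column q h))"
      unfolding energy_eq split[of "\<lambda>q. nrm (column q g)"] using ne by (auto simp: col intro!: sum.cong)
    moreover have "energy h = nrm x + nrm y + (\<Sum>q\<in>UNIV - {i} - {j}. nrm (column q h))"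
      unfolding energy_eq split[of "\<lambda>q. nrm (column q h)"] by (simp add: x_def y_def)
    moreover have "nrm x' = c\<^sup>2 * nrm x + s\<^sup>2 * nrm y + 2 * c * s * N"
      unfolding x'_def nrm_add by (simp add: scaled \<sigma> N_def)
    moreover have "nrm y' = c\<^sup>2 * nrm y + s\<^sup>2 * nrm x + 2 * c * s * N"
      unfolding y'_def nrm_add by (simp add: scaled \<sigma> N2)
    moreover have "c\<^sup>2 = 1 + s\<^sup>2" using cs by simp
    ultimately show ?thesis unfolding A_def by (simp add: algebra_simps)
  qed
  \<comment> \<open>For parameters \<open>s\<close> and \<open>- s\<close> with positive
    \<open>s\<close>, dividing \<open>key\<close> by \<open>2 * s\<close> leaves expressions tending
    to \<open>2 * N\<close> and \<open>- (2 * N)\<close>, so both limits are nonnegative.\<close>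
  have lim: "((\<lambda>s. s * A + 2 * sqrt (1 + s\<^sup>2) * z) \<longlongrightarrow> 0 * A + 2 * sqrt (1 + 0\<^sup>2) * z) (at_right 0)" for z :: real
    by (intro tendsto_intros)
  have "0 \<le> 2 * N"
  proof (rule tendsto_lowerbound[OF lim[of N, simplified]])
    show "\<forall>\<^sub>F s in at_right 0. 0 \<le> s * A + 2 * sqrt (1 + s\<^sup>2) * N"
      unfolding eventually_at_right_field
    proof (intro exI[of _ 1] conjI allI impI)
      fix s :: real assume s: "0 < s" "s < 1"
      have "0 \<le> 2 * s\<^sup>2 * A + 4 * sqrt (1 + s\<^sup>2) * s * N" by (rule key) (simp add: real_sqrt_pow2_iff)
      also have "\<dots> = (2 * s) * (s * A + 2 * sqrt (1 + s\<^sup>2) * N)" by (simp add: power2_eq_square algebra_simps)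
      finally show "0 \<le> s * A + 2 * sqrt (1 + s\<^sup>2) * N" using s by (simp add: zero_le_mult_iff)
    qed simp
  qed simp
  moreover have "0 \<le> - (2 * N)"
  proof (rule tendsto_lowerbound[OF lim[of "- N", simplified]])
    show "\<forall>\<^sub>F s in at_right 0. 0 \<le> s * A - 2 * sqrt (1 + s\<^sup>2) * N"
      unfolding eventually_at_right_field
    proof (intro exI[of _ 1] conjI allI impI)
      fix s :: real assume s: "0 < s" "s < 1"
      have "0 \<le> 2 * (- s)\<^sup>2 * A + 4 * sqrt (1 + s\<^sup>2) * (- s) * N" by (rule key) (simp add: real_sqrt_pow2_iff)
      also have "\<dots> = (2 * s) * (s * A - 2 * sqrt (1 + s\<^sup>2) * N)" by (simp add: power2_eq_square algebra_simps)
      finally show "0 \<le> s * A - 2 * sqrt (1 + s\<^sup>2) * N" using s by (simp add: zero_le_mult_iff)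
    qed simp
  qed simp
  ultimately show ?thesis by (simp add: N_def x_def y_def)
qed

definition gram :: "'a ^ 'n ^ 'n \<Rightarrow> 'a ^ 'n ^ 'n" where
  "gram h = mean (\<lambda>k. adj (k ** h) ** (k ** h))"

lemma adj_mul_nth: "(adj A ** B) $ i $ j = (\<Sum>r\<in>UNIV. star (A $ r $ i) * B $ r $ j)"
  by (simp add: matrix_matrix_mult_def)

lemma bounded_linear_nth2: "bounded_linear (\<lambda>A :: 'a ^ 'n ^ 'n. A $ i $ j)"
  using bounded_linear_compose[OF bounded_linear_vec_nth bounded_linear_vec_nth] .

lemma gram_nth: "gram h $ i $ j = mean (\<lambda>k. (adj (k ** h) ** (k ** h)) $ i $ j)"
  unfolding gram_def
  by (rule mean_linear[OF _ bounded_linear_nth2, symmetric]) (intro continuous_intros)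

lemma gram_quadratic:
  "(\<Sum>i\<in>UNIV. \<Sum>j\<in>UNIV. star (x $ i) * gram h $ i $ j * x $ j) = of_real (nrm (h *v x))"
proof -
  have "(\<Sum>i\<in>UNIV. \<Sum>j\<in>UNIV. star (x $ i) * gram h $ i $ j * x $ j) =
      (\<Sum>i\<in>UNIV. \<Sum>j\<in>UNIV. mean (\<lambda>k. star (x $ i) * (adj (k ** h) ** (k ** h)) $ i $ j * x $ j))"
    unfolding gram_nth
    by (intro sum.cong refl mean_linear[symmetric] bounded_linear_mult_left
        bounded_linear_compose[OF bounded_linear_mult_left bounded_linear_mult_right] continuous_intros)
  also have "\<dots> = mean (\<lambda>k. \<Sum>i\<in>UNIV. \<Sum>j\<in>UNIV. star (x $ i) * (adj (k ** h) ** (k ** h)) $ i $ j * x $ j)"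
    by (subst mean_sum, simp, intro continuous_intros, intro sum.cong refl mean_sum[symmetric], simp, intro continuous_intros)
  also have "\<dots> = mean (\<lambda>k. of_real ((norm (k *v (h *v x)))\<^sup>2))"
  proof (rule mean_cong)
    fix k
    define A where "A = k ** h"
    have "(\<Sum>i\<in>UNIV. \<Sum>j\<in>UNIV. star (x $ i) * (adj A ** A) $ i $ j * x $ j)
        = (\<Sum>i\<in>UNIV. \<Sum>j\<in>UNIV. \<Sum>r\<in>UNIV. star (x $ i) * (star (A $ r $ i) * A $ r $ j) * x $ j)"
      by (simp add: adj_mul_nth sum_distrib_left sum_distrib_right)
    also have "\<dots> = (\<Sum>r\<in>UNIV. \<Sum>i\<in>UNIV. \<Sum>j\<in>UNIV. star (x $ i) * (star (A $ r $ i) * A $ r $ j) * x $ j)"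
      by (rule trans[OF sum.cong[OF refl sum.swap] sum.swap])
    also have "\<dots> = (\<Sum>r\<in>UNIV. star ((A *v x) $ r) * (A *v x) $ r)"
      unfolding matrix_vector_mult_def by (simp add: sum_product) (simp add: mult_ac)
    also have "\<dots> = (\<Sum>r\<in>UNIV. of_real ((norm ((A *v x) $ r))\<^sup>2))"
      by (simp only: star_mult_self)
    also have "\<dots> = of_real ((norm (A *v x))\<^sup>2)"
      by (simp add: norm_vec_def L2_set_def sum_nonneg)
    finally show "(\<Sum>i\<in>UNIV. \<Sum>j\<in>UNIV. star (x $ i) * (adj (k ** h) ** (k ** h)) $ i $ j * x $ j) =
       of_real ((norm (k *v (h *v x)))\<^sup>2)"
      by (simp add: A_def matrix_vector_mul_assoc)
  qed
  also have "\<dots> = of_real (nrm (h *v x))" unfolding nrm_def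
    by (intro mean_linear bounded_linear_of_real continuous_intros)
  finally show ?thesis .
qed

text \<open>As \<open>h ** S = k ** h\<close>, the change of basis by \<open>S\<close> is absorbed
  by right invariance of the mean.\<close>

lemma gram_invariant:
  assumes h: "h \<in> isoms sg" and k: "k \<in> K"
  defines "S \<equiv> matrix_inv h ** k ** h"
  shows "adj S ** gram h ** S = gram h"
proof -
  have hS: "h ** S = k ** h" by (simp add: S_def isoms_inv_cancel[OF h] flip: matrix_mul_assoc)
  have bl: "bounded_linear (\<lambda>A :: 'a^'n^'n. adj S ** A ** S)"
    by (rule linear_conv_bounded_linear[THEN iffD1], rule linearI)
       (simp_all add: cart_eq_iff matrix_matrix_mult_def sum.distrib distrib_left distrib_right flip: scaleR_sum_right)
  have "adj S ** gram h ** S = mean (\<lambda>l. adj S ** (adj (l ** h) ** (l ** h)) ** S)"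
    unfolding gram_def by (rule mean_linear[OF _ bl, symmetric]) (intro continuous_intros)
  also have "\<dots> = mean (\<lambda>l. adj ((l ** k) ** h) ** ((l ** k) ** h))"
  proof (rule mean_cong)
    fix l
    have "l ** h ** S = (l ** k) ** h" using hS by (simp flip: matrix_mul_assoc)
    then have "adj (l ** h ** S) ** (l ** h ** S) = adj ((l ** k) ** h) ** ((l ** k) ** h)" by simp
    then show "adj S ** (adj (l ** h) ** (l ** h)) ** S = adj ((l ** k) ** h) ** ((l ** k) ** h)"
      by (simp only: adj_mul matrix_mul_assoc)
  qed
  also have "\<dots> = gram h" unfolding gram_def
    by (rule mean_mul_right[OF _ k, of "\<lambda>l. adj (l ** h) ** (l ** h)"]) (intro continuous_intros)
  finally show ?thesis .
qed

lemma nrm_eq_0: assumes "nrm x = 0" shows "x = 0"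
proof -
  obtain m where m: "m > 0" "\<And>k h :: 'a^'n^'n. k \<in> K \<Longrightarrow> m * norm h \<le> norm (k ** h)" using norm_mul_lower by blast
  \<comment> \<open>All columns of \<open>X\<close> equal \<open>x\<close>, so the lower bound for
    matrices applies to a vector.\<close>
  define X :: "'a^'n^'n" where "X = (\<chi> i j. x $ i)"
  have "energy X = of_nat CARD('n) * nrm x"
    unfolding energy_eq by (simp add: X_def column_def)
  then have "energy X = 0" using assms by simp
  moreover have "mean (\<lambda>k. (m * norm X)\<^sup>2) \<le> energy X" unfolding energy_def
    using m by (intro mean_mono continuous_intros power_mono) auto
  ultimately have "(m * norm X)\<^sup>2 \<le> 0" by simp
  then have "X = 0" using m(1) by simp
  then show ?thesis by (simp add: X_def cart_eq_iff)
qed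

lemma nrm_nonneg: "nrm x \<ge> 0"
proof -
  have "mean (\<lambda>k. 0) \<le> nrm x" unfolding nrm_def by (intro mean_mono continuous_intros) auto
  then show ?thesis by simp
qed

text \<open>
  At a minimizer of the energy the averaged Gram matrix \<open>P\<close> commutes with the form. An isometry \<open>S\<close>
  preserving both forms commutes with \<open>J P\<close>, so its off-diagonal part \<open>T\<close> satisfies \<open>P T = - T P\<close>;
  pairing with \<open>T\<close> writes zero as a sum of nonnegative terms.
\<close>

theorem conjugate_into_commutant:
  obtains h where "h \<in> isoms sg"
    "\<And>k. k \<in> K \<Longrightarrow> (matrix_inv h ** k ** h) ** diag_form sg = diag_form sg ** (matrix_inv h ** k ** h)"
proof -
  obtain h where h: "h \<in> isoms sg" "\<And>g. g \<in> isoms sg \<Longrightarrow> energy h \<le> energy g"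
    using ex_energy_minimizer by blast
  define P where "P = gram h"
  have P0: "P $ i $ j = 0" if ij: "sg i = 1" "sg j = -1" for i j
  proof (rule ccontr)
    assume nz: "P $ i $ j \<noteq> 0"
    \<comment> \<open>The phase is chosen so that \<open>star \<sigma>\<close> points in the
      direction of \<open>P $ i $ j\<close>; the orthogonality at the minimizer then says that the
      norm of this entry is zero.\<close>
    define \<sigma> where "\<sigma> = of_real (1 / norm (P $ i $ j)) * star (P $ i $ j)"
    have "norm \<sigma> = 1" using nz by (simp add: \<sigma>_def norm_mult norm_divide)
    note orth = energy_minimizer_orthogonal[OF h ij this]
    have "inner (k *v column i h) (k *v (\<sigma> *s column j h)) = inner (star \<sigma>) ((adj (k ** h) ** (k ** h)) $ i $ j)" for k :: "'a^'n^'n"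
    proof -
      have "inner (k *v column i h) (k *v (\<sigma> *s column j h)) =
        (\<Sum>r\<in>UNIV. inner ((k ** h) $ r $ i) (\<sigma> * (k ** h) $ r $ j))"
        unfolding vector_scalar_commute column_mul[symmetric] by (simp add: inner_vec_def column_def)
      also have "\<dots> = (\<Sum>r\<in>UNIV. inner (star \<sigma>) (star ((k ** h) $ r $ i) * (k ** h) $ r $ j))"
      proof (intro sum.cong refl)
        fix r
        show "inner ((k ** h) $ r $ i) (\<sigma> * (k ** h) $ r $ j) = inner (star \<sigma>) (star ((k ** h) $ r $ i) * (k ** h) $ r $ j)"
          using inner_mult_right[of "(k ** h) $ r $ i" \<sigma> "(k ** h) $ r $ j"]
            inner_mult_right[of "star \<sigma>" "star ((k ** h) $ r $ i)" "(k ** h) $ r $ j"]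
          by (simp only: star_star mult.commute)
      qed
      finally show ?thesis by (simp add: adj_mul_nth inner_sum_right)
    qed
    then have "mean (\<lambda>k. inner (star \<sigma>) ((adj (k ** h) ** (k ** h)) $ i $ j)) = 0" using orth by simp
    moreover have "mean (\<lambda>k. inner (star \<sigma>) ((adj (k ** h) ** (k ** h)) $ i $ j)) = inner (star \<sigma>) (P $ i $ j)"
      unfolding P_def gram_nth by (rule mean_linear[OF _ bounded_linear_inner_right]) (intro continuous_intros)
    ultimately have "inner (star \<sigma>) (P $ i $ j) = 0" by simp
    moreover have "star \<sigma> = (1 / norm (P $ i $ j)) *\<^sub>R (P $ i $ j)"
      by (simp add: \<sigma>_def scaleR_conv_of_real)
    ultimately show False using nz by simp
  qed
  have Pstar: "star (P $ i $ j) = P $ j $ i" for i j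
  proof -
    have "star (P $ i $ j) = mean (\<lambda>k. star ((adj (k ** h) ** (k ** h)) $ i $ j))"
      unfolding P_def gram_nth by (rule mean_linear[OF _ bounded_linear_star, symmetric]) (intro continuous_intros)
    also have "\<dots> = P $ j $ i"
      unfolding P_def gram_nth by (simp add: adj_mul_nth mult.commute)
    finally show ?thesis .
  qed
  have P0': "P $ i $ j = 0" if "sg i \<noteq> sg j" for i j
    using that sg_cases[of i] sg_cases[of j] P0[of i j] P0[of j i] Pstar[of j i] by auto
  let ?J = "diag_form sg :: 'a^'n^'n"
  have JP: "?J ** P = P ** ?J"
    using P0' by (auto simp: cart_eq_iff diag_form_mul_left diag_form_mul_right)
  have off: "S $ i $ j = 0" if S: "S \<in> isoms sg" "adj S ** P ** S = P" and ij0: "sg i = 1" "sg j = -1" for S i j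
  proof -
    let ?I = "matrix_inv S"
    have 1: "adj S ** ?J = ?J ** ?I"
      using S(1) by (simp add: isoms_inv(1) matrix_mul_assoc)
    have 2: "adj S ** P = P ** ?I"
      using S(2) isoms_inv_cancel(3)[OF S(1), of "adj S ** P"] by simp
    have "?J ** ?I ** ?J ** P = adj S ** (?J ** ?J) ** P" unfolding 1[symmetric] by (simp add: matrix_mul_assoc)
    also have "\<dots> = P ** ?I" using 2 by simp
    finally have "?J ** (?J ** ?I ** ?J ** P) = ?J ** (P ** ?I)" by simp
    then have 3: "?I ** ?J ** P = ?J ** P ** ?I" by (simp flip: matrix_mul_assoc)
    have "S ** (?I ** ?J ** P) ** S = S ** (?J ** P ** ?I) ** S" using 3 by simp
    then have 4: "?J ** P ** S = S ** ?J ** P"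
      using isoms_inv(2,3)[OF S(1)] isoms_inv_cancel[OF S(1)] by (simp add: matrix_mul_assoc)
    define T where "T i j = (if sg i = 1 \<and> sg j = -1 then S $ i $ j else 0)" for i j
    \<comment> \<open>\<open>P\<close> is block diagonal by \<open>P0'\<close>, so the block of
      \<open>4\<close> with positive row and negative column involves only \<open>T\<close>. The
      sign arises because the form is 1 on the row index and -1 on the column index.\<close>
    have 5: "(\<Sum>k\<in>UNIV. P $ i $ k * T k j) + (\<Sum>k\<in>UNIV. T i k * P $ k $ j) = 0" for i j
    proof (cases "sg i = 1 \<and> sg j = -1")
      case True
      have "(?J ** P ** S) $ i $ j = (\<Sum>k\<in>UNIV. P $ i $ k * T k j)"
        unfolding matrix_matrix_mult_def[of "?J ** P"]
        by (simp add: diag_form_mul_left True) (intro sum.cong refl, use True P0' sg_cases in \<open>fastforce simp: T_def\<close>)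
      moreover have "(S ** ?J ** P) $ i $ j = - (\<Sum>k\<in>UNIV. T i k * P $ k $ j)"
        unfolding matrix_matrix_mult_def[of "S ** ?J"] sum_negf[symmetric]
        by (simp add: diag_form_mul_right True) (intro sum.cong refl, use True P0' sg_cases in \<open>fastforce simp: T_def\<close>)
      ultimately have "(\<Sum>k\<in>UNIV. P $ i $ k * T k j) = - (\<Sum>k\<in>UNIV. T i k * P $ k $ j)" using 4 by simp
      then show ?thesis by (simp only: eq_neg_iff_add_eq_0)
    next
      case False
      have "P $ i $ k * T k j = 0" "T i k * P $ k $ j = 0" for k
        using False P0'[of i k] P0'[of k j] by (auto simp: T_def)
      then show ?thesis by simp
    qed
    \<comment> \<open>Columns and conjugated rows of \<open>T\<close>. By
      \<open>gram_quadratic\<close> their \<open>nrm\<close> values add up to the traces of adj(T) P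
      T and T P adj(T), whose sum vanishes by \<open>5\<close>.\<close>
    define c where "c j = (\<chi> i. T i j)" for j
    define d where "d i = (\<chi> j. star (T i j))" for i
    have "of_real ((\<Sum>j\<in>UNIV. nrm (h *v c j)) + (\<Sum>i\<in>UNIV. nrm (h *v d i))) =
       (\<Sum>j\<in>UNIV. \<Sum>i\<in>UNIV. \<Sum>k\<in>UNIV. star (T i j) * P $ i $ k * T k j) +
       (\<Sum>i\<in>UNIV. \<Sum>k\<in>UNIV. \<Sum>j\<in>UNIV. T i k * P $ k $ j * star (T i j))"
      by (simp add: gram_quadratic[symmetric] c_def d_def P_def)
    also have "(\<Sum>j\<in>UNIV. \<Sum>i\<in>UNIV. \<Sum>k\<in>UNIV. star (T i j) * P $ i $ k * T k j) =
       (\<Sum>i\<in>UNIV. \<Sum>j\<in>UNIV. star (T i j) * (\<Sum>k\<in>UNIV. P $ i $ k * T k j))"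
      by (subst sum.swap) (simp add: sum_distrib_left mult.assoc)
    also have "(\<Sum>i\<in>UNIV. \<Sum>k\<in>UNIV. \<Sum>j\<in>UNIV. T i k * P $ k $ j * star (T i j)) =
       (\<Sum>i\<in>UNIV. \<Sum>j\<in>UNIV. star (T i j) * (\<Sum>k\<in>UNIV. T i k * P $ k $ j))"
      by (rule sum.cong[OF refl], subst sum.swap) (simp add: sum_distrib_left mult_ac)
    also have "(\<Sum>i\<in>UNIV. \<Sum>j\<in>UNIV. star (T i j) * (\<Sum>k\<in>UNIV. P $ i $ k * T k j)) +
       (\<Sum>i\<in>UNIV. \<Sum>j\<in>UNIV. star (T i j) * (\<Sum>k\<in>UNIV. T i k * P $ k $ j)) =
       (\<Sum>i\<in>UNIV. \<Sum>j\<in>UNIV. star (T i j) * ((\<Sum>k\<in>UNIV. P $ i $ k * T k j) + (\<Sum>k\<in>UNIV. T i k * P $ k $ j)))"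
      by (simp only: sum.distrib distrib_left)
    also have "\<dots> = 0" by (simp only: 5 mult_zero_right sum.neutral_const)
    finally have "(\<Sum>j\<in>UNIV. nrm (h *v c j)) + (\<Sum>i\<in>UNIV. nrm (h *v d i)) = 0" by (simp only: of_real_eq_0_iff)
    moreover have "(\<Sum>j\<in>UNIV. nrm (h *v c j)) \<ge> 0" "(\<Sum>i\<in>UNIV. nrm (h *v d i)) \<ge> 0"
      by (simp_all add: sum_nonneg nrm_nonneg)
    ultimately have "(\<Sum>j\<in>UNIV. nrm (h *v c j)) = 0" by linarith
    then have "nrm (h *v c j) = 0" for j by (subst (asm) sum_nonneg_eq_0_iff) (auto simp: nrm_nonneg)
    then have hc: "h *v c j = 0" for j using nrm_eq_0 by blast
    have c0: "c j = 0" for j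
    proof -
      have "matrix_inv h *v (h *v c j) = 0" by (simp add: hc)
      then show ?thesis by (simp add: matrix_vector_mul_assoc isoms_inv(3)[OF h(1)])
    qed
    show ?thesis using c0[of j] ij0 by (auto simp: c_def T_def cart_eq_iff dest: spec[of _ i])
  qed
  have main: "S ** ?J = ?J ** S" if S: "S \<in> isoms sg" "adj S ** P ** S = P" for S
  proof -
    let ?I = "matrix_inv S"
    have "adj ?I ** P ** ?I = adj ?I ** (adj S ** P ** S) ** ?I" using S(2) by simp
    also have "\<dots> = adj (S ** ?I) ** P ** (S ** ?I)" by (simp only: adj_mul matrix_mul_assoc)
    finally have inv: "adj ?I ** P ** ?I = P" by (simp add: isoms_inv(2)[OF S(1)])
    have "S $ i $ j = 0" if "sg i \<noteq> sg j" for i j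
    proof (cases "sg i = 1")
      case True
      then show ?thesis using off[OF S, of i j] that sg_cases[of j] by simp
    next
      case False
      \<comment> \<open>Up to sign and conjugation, the remaining off-diagonal block of
        \<open>S\<close> is the block already treated of its inverse, which preserves both forms as
        well.\<close>
      then have "?I $ j $ i = 0" using off[OF isoms_inv(4)[OF S(1)] inv, of j i] that sg_cases[of i] sg_cases[of j] by simp
      then have "star (S $ i $ j) = 0" using False sg_cases[of i] sg_cases[of j]
        by (auto simp: isoms_inv(1)[OF S(1)] diag_form_mul_right diag_form_mul_left)
      then show ?thesis by (metis star_star star_01(1))
    qed
    then have "S $ i $ j * of_real (sg j) = of_real (sg i) * S $ i $ j" for i j
      by (cases "sg i = sg j") simp_all
    then show ?thesis by (simp add: cart_eq_iff diag_form_mul_left diag_form_mul_right)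
  qed
  show thesis
  proof (rule that[OF h(1)])
    fix k assume k: "k \<in> K"
    have "matrix_inv h ** k ** h \<in> isoms sg"
      using h(1) k K_isoms isoms_inv(4)[OF h(1)] by (intro isoms_mul) auto
    then show "matrix_inv h ** k ** h ** ?J = ?J ** (matrix_inv h ** k ** h)"
      using main gram_invariant[OF h(1) k] by (simp add: P_def)
  qed
qed

end

subsection \<open>Quasi-reflections\<close>

definition vbar :: "'a::star_field ^ 'n \<Rightarrow> 'a ^ 'n" where
  "vbar x = (\<chi> i. star (x $ i))"

definition mbar :: "'a::star_field ^ 'n ^ 'm \<Rightarrow> 'a ^ 'n ^ 'm" where
  "mbar A = (\<chi> i j. star (A $ i $ j))"

lemma bar_nth [simp]: "vbar x $ i = star (x $ i)" "mbar A $ i $ j = star (A $ i $ j)"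
  by (simp_all add: vbar_def mbar_def)

lemma bar_bar [simp]: "vbar (vbar x) = x" "mbar (mbar A) = A"
  by (simp_all add: cart_eq_iff)

lemma vbar_simps: "vbar (x + y) = vbar x + vbar y" "vbar (x - y) = vbar x - vbar y" "vbar (c *s x) = star c *s vbar x"
  by (simp_all add: cart_eq_iff)

lemma vbar_0 [simp]: "vbar 0 = 0"
  by (simp add: cart_eq_iff)

lemma mbar_mul: "mbar (A ** B) = mbar A ** mbar B"
  by (simp add: cart_eq_iff matrix_matrix_mult_def)

lemma mbar_vec: "mbar A *v vbar x = vbar (A *v x)"
  by (simp add: cart_eq_iff matrix_vector_mult_def)

lemma mbar_one [simp]: "mbar mone = mone"
  by (simp add: cart_eq_iff Finite_Cartesian_Product.mat_def)

lemma mbar_diag_form [simp]: "mbar (diag_form sg) = diag_form sg"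
  by (simp add: cart_eq_iff diag_form_def)

lemma form_vbar: "form sg (vbar x) (vbar y) = star (form sg x y)"
  by (simp add: form_def)

lemma mbar_isoms: "A \<in> isoms sg \<Longrightarrow> mbar A \<in> isoms sg"
proof -
  assume A: "A \<in> isoms sg"
  have "adj (mbar A) ** diag_form sg ** mbar A = mbar (adj A ** diag_form sg ** A)"
    by (simp add: mbar_mul) (simp add: cart_eq_iff matrix_matrix_mult_def)
  then show ?thesis using A by (simp add: isoms_def)
qed

lemma form_axis: "form sg (axis p 1) x = of_real (sg p) * x $ p"
proof -
  have "form sg (axis p 1) x = (\<Sum>r\<in>UNIV. if r = p then of_real (sg p) * x $ p else 0)"
    unfolding form_def axis_def by (intro sum.cong) auto
  then show ?thesis by simp
qed

lemma matrix_vec_axis: "A *v axis k 1 = column k (A :: 'a::star_field ^ 'n ^ 'm)"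
proof -
  have "(A *v axis k 1) $ i = (\<Sum>j\<in>UNIV. if j = k then A $ i $ k else 0)" for i
    unfolding matrix_vector_mult_def axis_def by (simp only: vec_lambda_beta, intro sum.cong) auto
  then show ?thesis by (simp add: cart_eq_iff column_def)
qed

lemma isomsI: "(\<And>x y. form sg (A *v x) (A *v y) = form sg x y) \<Longrightarrow> A \<in> isoms sg"
proof (unfold isoms_iff, intro allI)
  assume a: "\<And>x y. form sg (A *v x) (A *v y) = form sg x y"
  fix p q
  show "form sg (column p A) (column q A) = (if p = q then of_real (sg p) else 0)"
    using a[of "axis p 1" "axis q 1"] by (simp add: matrix_vec_axis form_axis) (simp add: axis_def)
qed

text \<open>The map that subtracts \<open>form sg w x / z\<close> times \<open>w\<close> from
  \<open>x\<close>. For \<open>z\<close> equal to half of \<open>form sg w w\<close> it is the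
  orthogonal reflection; over the complex numbers only the sum of \<open>z\<close> and its conjugate
  is prescribed, which leaves room for a phase.\<close>

definition quasi_refl :: "('n::finite \<Rightarrow> real) \<Rightarrow> 'a::star_field ^ 'n \<Rightarrow> 'a \<Rightarrow> 'a ^ 'n ^ 'n" where
  "quasi_refl sg w z = (\<chi> i j. (if i = j then 1 else 0) - w $ i * (star (w $ j) * of_real (sg j) / z))"

lemma quasi_refl_vec: "quasi_refl sg w z *v x = x - (form sg w x / z) *s w"
proof -
  have "(quasi_refl sg w z *v x) $ i = x $ i - (form sg w x / z) * w $ i" for i
  proof -
    have "(quasi_refl sg w z *v x) $ i = (\<Sum>j\<in>UNIV. (if i = j then x $ j else 0) - w $ i * (of_real (sg j) * (star (w $ j) * x $ j)) / z)"
      unfolding quasi_refl_def matrix_vector_mult_def by (simp, intro sum.cong) (auto simp: algebra_simps)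
    then show ?thesis by (simp add: sum_subtractf form_def sum_distrib_left sum_divide_distrib sum_distrib_right mult_ac)
  qed
  then show ?thesis by (simp add: cart_eq_iff)
qed

lemma quasi_refl_isom:
  assumes "z \<noteq> 0" "form sg w w = z + star z"
  shows "quasi_refl sg w z \<in> isoms sg"
proof (rule isomsI)
  fix x y
  define a where "a = form sg w x"
  define b where "b = form sg w y"
  have sz: "star z \<noteq> 0" using assms(1) by (metis star_star star_01(1))
  have "form sg (quasi_refl sg w z *v x) (quasi_refl sg w z *v y) =
      form sg x y - b / z * star a - star a / star z * b + star a / star z * (b / z) * (z + star z)"
    unfolding quasi_refl_vec form_linear form_star[of sg w x, symmetric] assms(2)[symmetric]
    by (simp add: a_def b_def algebra_simps)
  also have "\<dots> = form sg x y" using assms(1) sz by (simp add: field_simps)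
  finally show "form sg (quasi_refl sg w z *v x) (quasi_refl sg w z *v y) = form sg x y" .
qed

text \<open>The matrix determinant lemma. With \<open>u\<close> as column \<open>k\<close> of
  \<open>P\<close>, conjugation by \<open>P\<close> turns the rank-one update into a matrix
  \<open>Q\<close> that differs from the identity only in row \<open>k\<close>, so its determinant
  is the diagonal entry \<open>x $ k\<close>.\<close>

lemma det_rank_one_update:
  fixes u v :: "'a::field ^ 'n::finite"
  shows "Determinants.det (\<chi> i j. (if i = j then 1 else 0) - u $ i * v $ j) = 1 - (\<Sum>i\<in>UNIV. u $ i * v $ i)"
proof (cases "u = 0")
  case True
  then show ?thesis by (simp add: flip: Finite_Cartesian_Product.mat_def)
next
  case False
  then obtain k where k: "u $ k \<noteq> 0" by (auto simp: cart_eq_iff)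
  let ?U = "\<chi> i j. (if i = j then 1 else 0) - u $ i * v $ j"
  define P :: "'a ^ 'n ^ 'n" where "P = (\<chi> i j. if j = k then u $ i else if i = j then 1 else 0)"
  define x :: "'a ^ 'n" where "x = (\<chi> j. (if k = j then 1 else 0) - (\<Sum>i\<in>UNIV. v $ i * P $ i $ j))"
  define Q :: "'a ^ 'n ^ 'n" where "Q = (\<chi> i. if i = k then x else axis i 1)"
  have row1: "Finite_Cartesian_Product.row i (mone :: 'a ^ 'n ^ 'n) = axis i 1" for i
    by (simp add: Finite_Cartesian_Product.row_def axis_def cart_eq_iff Finite_Cartesian_Product.mat_def)
  have repl: "Determinants.det (\<chi> i. if i = k then y else axis i 1) = y $ k" for y :: "'a ^ 'n"
    using cramer_lemma_transpose[of k y "mone :: 'a ^ 'n ^ 'n"] unfolding row1 basis_expansion by simp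
  have detQ: "Determinants.det Q = x $ k" unfolding Q_def by (rule repl)
  have "Finite_Cartesian_Product.transpose P = (\<chi> i. if i = k then u else axis i 1)"
    by (auto simp: P_def cart_eq_iff Finite_Cartesian_Product.transpose_def axis_def)
  then have detP: "Determinants.det P = u $ k" using repl[of u] Determinants.det_transpose[of P] by simp
  have "?U ** P = P ** Q"
  proof -
    have "(?U ** P) $ i $ j = (P ** Q) $ i $ j" for i j
    proof -
      define s where "s = (\<Sum>l\<in>UNIV. v $ l * P $ l $ j)"
      have "(?U ** P) $ i $ j = (\<Sum>l\<in>UNIV. (if i = l then P $ l $ j else 0) - u $ i * (v $ l * P $ l $ j))"
        unfolding matrix_matrix_mult_def by (simp, intro sum.cong) (auto simp: algebra_simps)
      then have L: "(?U ** P) $ i $ j = P $ i $ j - u $ i * s" by (simp add: sum_subtractf s_def sum_distrib_left)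
      have "(P ** Q) $ i $ j = (\<Sum>l\<in>UNIV. (if l = k then u $ i * x $ j else 0) + (if l = i then (if l = j \<and> l \<noteq> k then 1 else 0) else 0))"
        unfolding matrix_matrix_mult_def P_def Q_def by (simp only: vec_lambda_beta, intro sum.cong) (auto simp: axis_def)
      then have R: "(P ** Q) $ i $ j = u $ i * x $ j + (if i = j \<and> i \<noteq> k then 1 else 0)"
        by (simp add: sum.distrib)
      show ?thesis unfolding L R by (auto simp: x_def s_def P_def algebra_simps)
    qed
    then show ?thesis by (simp add: cart_eq_iff)
  qed
  from arg_cong[OF this, of Determinants.det]
  have "Determinants.det ?U * u $ k = u $ k * x $ k" by (simp only: Determinants.det_mul detP detQ)
  then have "Determinants.det ?U = x $ k" using k by simp
  then show ?thesis by (simp add: x_def P_def mult.commute)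
qed

lemma det_quasi_refl: "Determinants.det (quasi_refl sg w z) = 1 - form sg w w / z"
proof -
  have "Determinants.det (quasi_refl sg w z) = 1 - (\<Sum>i\<in>UNIV. w $ i * (star (w $ i) * of_real (sg i) / z))"
    unfolding quasi_refl_def using det_rank_one_update[of w "\<chi> j. star (w $ j) * of_real (sg j) / z"] by simp
  then show ?thesis by (simp add: form_def sum_divide_distrib mult_ac)
qed

subsection \<open>Reversing an isometry\<close>

text \<open>
  \<open>M\<close> reverses \<open>g\<close> if the antilinear map \<open>x \<mapsto> M *v vbar x\<close> conjugates \<open>g\<close> to its inverse.
\<close>

definition reverses :: "'a::star_field ^ 'n::finite ^ 'n \<Rightarrow> 'a ^ 'n ^ 'n \<Rightarrow> bool" where
  "reverses M g \<longleftrightarrow> g ** M ** mbar g = M"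

context signature
begin

text \<open>The quasi-reflection along \<open>w\<close> maps \<open>g *v v\<close> to
  \<open>v\<close>, so \<open>h\<close> fixes \<open>v\<close>. A reversal \<open>M\<close> of
  \<open>h\<close> becomes one of \<open>g\<close> provided that its antilinear map preserves the
  line of \<open>w\<close>; for this it suffices to control \<open>v\<close> and the part
  \<open>w - c *s v\<close> of \<open>w\<close> orthogonal to \<open>v\<close>.\<close>

lemma reversal_step:
  fixes g :: "'a::star_field ^ 'n ^ 'n"
  assumes g: "g \<in> isoms sg" and vv: "form sg v v \<noteq> 0"
  defines "w \<equiv> v - g *v v" and "z \<equiv> form sg v v - form sg v (g *v v)"
  assumes z: "z \<noteq> 0"
  defines "h \<equiv> quasi_refl sg w z ** g" and "c \<equiv> z / form sg v v"
  shows "h \<in> isoms sg" "h *v v = v"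
    "\<And>u. g *v u = u \<Longrightarrow> form sg w u = 0 \<Longrightarrow> h *v u = u"
    "form sg w w = z + star z" "form sg v (w - c *s v) = 0"
    "\<And>M. M \<in> isoms sg \<Longrightarrow> reverses M h \<Longrightarrow> M *v vbar v = v \<Longrightarrow>
       M *v vbar (star c *s (w - c *s v)) = star c *s (w - c *s v) \<Longrightarrow> reverses (M ** mbar h) g"
    "\<And>M u. M *v vbar u = u \<Longrightarrow> h *v u = u \<Longrightarrow> (M ** mbar h) *v vbar u = u"
proof -
  have gg: "form sg (g *v x) (g *v y) = form sg x y" for x y by (rule form_isom[OF g])
  have sv: "star (form sg v v) = form sg v v" by (rule form_star)
  show ww: "form sg w w = z + star z"
    unfolding w_def z_def form_linear gg by (simp add: form_star sv)
  note R = quasi_refl_isom[OF z ww]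
  show hI: "h \<in> isoms sg" unfolding h_def by (intro isoms_mul R g)
  have wg: "form sg w (g *v v) = - z" by (simp add: w_def z_def form_linear gg)
  show "h *v v = v"
    using z by (simp add: h_def quasi_refl_vec wg flip: matrix_vector_mul_assoc) (simp add: w_def)
  show "h *v u = u" if "g *v u = u" "form sg w u = 0" for u
    using that by (simp add: h_def quasi_refl_vec flip: matrix_vector_mul_assoc)
  have vw: "form sg v w = z" by (simp add: w_def z_def form_linear)
  show "form sg v (w - c *s v) = 0" using vv by (simp add: form_linear vw c_def)
  show "(M ** mbar h) *v vbar u = u" if "M *v vbar u = u" "h *v u = u" for M :: "'a^'n^'n" and u
    using that by (simp add: mbar_vec flip: matrix_vector_mul_assoc)
  fix M :: "'a^'n^'n"
  assume M: "M \<in> isoms sg" "reverses M h" "M *v vbar v = v"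
    "M *v vbar (star c *s (w - c *s v)) = star c *s (w - c *s v)"
  have "star z \<noteq> 0" using z by (metis star_star star_01(1))
  then have c0: "c \<noteq> 0" "star c \<noteq> 0" using z vv by (simp_all add: c_def sv)
  \<comment> \<open>The factor \<open>star c\<close> in the hypothesis on \<open>M\<close> makes the
    antilinear map multiply both parts \<open>w - c *s v\<close> and \<open>c *s v\<close> of
    \<open>w\<close> by the same phase \<open>e\<close>.\<close>
  define e where "e = star c / c"
  have ee: "star e * e = 1" using c0 by (simp add: e_def)
  have Mw: "M *v vbar w = e *s w"
  proof -
    have "c *s (M *v vbar (w - c *s v)) = star c *s (w - c *s v)"
      using M(4) by (simp only: vbar_simps(3) star_star vector_scalar_commute)
    then have "M *v vbar (w - c *s v) = e *s (w - c *s v)"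
      using c0(1) by (simp add: e_def cart_eq_iff field_simps)
    moreover have "M *v vbar (c *s v) = e *s (c *s v)"
      using M(3) c0(1) by (simp add: vbar_simps vector_scalar_commute e_def)
    ultimately show ?thesis
      by (simp add: vbar_simps matrix_vector_mult_diff_distrib vector_ssub_ldistrib)
  qed
  let ?R = "quasi_refl sg w z"
  \<comment> \<open>The antilinear isometry of \<open>M\<close> rotates \<open>w\<close> by a phase,
    hence conjugates the quasi-reflection with parameter \<open>z\<close> to the one with
    \<open>star z\<close>, which is its inverse.\<close>
  have key: "?R ** M ** mbar ?R = M"
  proof (unfold matrix_eq, intro allI)
    fix y
    obtain x :: "'a^'n" where x: "y = vbar x" using bar_bar(1)[of y] by metis
    define f where "f = form sg w x"
    have "star e * form sg w (M *v vbar x) = form sg (M *v vbar w) (M *v vbar x)"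
      by (simp add: Mw form_linear)
    also have "\<dots> = star f" by (simp add: form_isom[OF M(1)] form_vbar f_def)
    finally have "(star e * e) * form sg w (M *v vbar x) = e * star f" by (simp only: mult_ac)
    then have fm: "form sg w (M *v vbar x) = e * star f" using ee by simp
    have sz: "star z \<noteq> 0" using z by (metis star_star star_01(1))
    have "(?R ** M ** mbar ?R) *v y = ?R *v (M *v vbar (?R *v x))"
      by (simp add: x mbar_vec flip: matrix_vector_mul_assoc)
    also have "M *v vbar (?R *v x) = M *v vbar x - (star f / star z * e) *s w"
      by (simp add: quasi_refl_vec vbar_simps f_def matrix_vector_mult_diff_distrib vector_scalar_commute Mw)
    also have "?R *v \<dots> = M *v vbar x - (star f / star z * e) *s w
        - ((e * star f - star f / star z * e * (z + star z)) / z) *s w"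
      unfolding quasi_refl_vec form_linear fm ww ..
    also have "\<dots> = M *v vbar x - ((star f / star z * e) + (e * star f - star f / star z * e * (z + star z)) / z) *s w"
      by (simp only: vector_sadd_rdistrib diff_diff_add)
    also have "(star f / star z * e) + (e * star f - star f / star z * e * (z + star z)) / z = 0"
      using z sz by (simp add: field_simps)
    finally show "(?R ** M ** mbar ?R) *v y = M *v y" by (simp add: x)
  qed
  have h: "h ** M ** mbar h = M" using M(2) by (simp add: reverses_def)
  have "?R ** (g ** (M ** mbar h)) = ?R ** (M ** mbar ?R)"
    using h key by (simp add: h_def matrix_mul_assoc)
  then have "g ** (M ** mbar h) = M ** mbar ?R"
    by (metis isoms_inv_cancel(2)[OF R])
  then show "reverses (M ** mbar h) g"
    by (simp add: reverses_def h_def mbar_mul matrix_mul_assoc)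
qed

lemma quasi_refl_maps:
  fixes a b :: "'a::star_field ^ 'n"
  assumes eq: "form sg a a = form sg b b" and ww: "form sg (b - a) (b - a) \<noteq> 0"
  defines "z \<equiv> form sg b b - form sg b a"
  shows "quasi_refl sg (b - a) z \<in> isoms sg" "quasi_refl sg (b - a) z *v a = b"
    "\<And>u. form sg (b - a) u = 0 \<Longrightarrow> quasi_refl sg (b - a) z *v u = u"
proof -
  have sb: "star (form sg b b) = form sg b b" "star (form sg b a) = form sg a b" by (rule form_star)+
  have w: "form sg (b - a) (b - a) = z + star z" unfolding z_def form_linear by (simp add: sb eq)
  then have z: "z \<noteq> 0" using ww by auto
  show "quasi_refl sg (b - a) z \<in> isoms sg" by (rule quasi_refl_isom[OF z w])
  have "form sg (b - a) a = - z" by (simp add: form_linear z_def eq)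
  then show "quasi_refl sg (b - a) z *v a = b" using z by (simp add: quasi_refl_vec)
  show "quasi_refl sg (b - a) z *v u = u" if "form sg (b - a) u = 0" for u
    using that by (simp add: quasi_refl_vec)
qed

definition perp :: "('a::star_field ^ 'n) set \<Rightarrow> ('a ^ 'n) set" where
  "perp S = {x. \<forall>u\<in>S. form sg u x = 0}"

lemma perp_subspace: "vec.subspace (perp S)"
  by (auto simp: vec.subspace_def perp_def form_linear) (simp add: form_def)

lemma perp_insert: "perp (insert b S) = {x \<in> perp S. form sg b x = 0}"
  by (auto simp: perp_def)

lemma form_commute_0: "form sg x y = 0 \<longleftrightarrow> form sg y x = 0"
  by (metis form_star star_01(1))

lemma isom_diff_perp:
  assumes "g \<in> isoms sg" "\<And>u. u \<in> S \<Longrightarrow> g *v u = u"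
  shows "x - g *v x \<in> perp S"
proof -
  have "form sg u (g *v x) = form sg u x" if "u \<in> S" for u
    using form_isom[OF assms(1), of u x] assms(2)[OF that] by simp
  then show ?thesis by (simp add: perp_def form_linear)
qed

lemma perp_0_imp_one:
  assumes "g \<in> isoms sg" "\<And>u. u \<in> S \<Longrightarrow> g *v u = u" "perp S = {0}"
  shows "g = mone"
proof (unfold matrix_eq, intro allI)
  fix x show "g *v x = mone *v x" using isom_diff_perp[OF assms(1,2), of S x] assms(3) by simp
qed

lemma dim_perp_insert_less:
  assumes "b \<in> perp S" "form sg b b \<noteq> 0"
  shows "vec.dim (perp (insert b S)) < vec.dim (perp S)"
proof (rule vec.dim_psubset)
  have "perp (insert b S) \<subset> perp S" using assms by (auto simp: perp_insert)
  then show "vec.span (perp (insert b S)) \<subset> vec.span (perp S)"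
    using perp_subspace vec.span_eq_iff by metis
qed

text \<open>The prescribed fixed vector \<open>v\<close> strengthens the induction:
  \<open>reversal_step\<close> asks the reversal of \<open>h\<close> to fix one more vector
  orthogonal to \<open>insert b S\<close>. The isometry \<open>M\<^sub>0\<close> supplies the answer
  once \<open>perp S\<close> is zero and \<open>g\<close> is the identity. Anisotropy of
  \<open>perp S\<close> ensures that every parameter \<open>z\<close> met on the way is
  nonzero.\<close>

lemma reversal_ex:
  fixes S :: "('a::star_field ^ 'n) set"
  assumes "\<And>x. x \<in> perp S \<Longrightarrow> x \<noteq> 0 \<Longrightarrow> form sg x x \<noteq> 0"
    and "M\<^sub>0 \<in> isoms sg" "\<And>u. u \<in> S \<Longrightarrow> M\<^sub>0 *v vbar u = u"
    and "g \<in> isoms sg" "\<And>u. u \<in> S \<Longrightarrow> g *v u = u" "v \<in> perp S"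
  shows "\<exists>M\<in>isoms sg. reverses M g \<and> (\<forall>u\<in>S. M *v vbar u = u) \<and> M *v vbar v = v"
  using assms
proof (induction "vec.dim (perp S)" arbitrary: S M\<^sub>0 g v rule: less_induct)
  case less
  note aniso = less.prems(1) and M0 = less.prems(2,3) and g = less.prems(4,5) and v = less.prems(6)
  have z0: "0 \<in> perp S" by (simp add: perp_def form_def)
  show ?case
  proof (cases "perp S = {0}")
    case True
    have "g = mone" by (rule perp_0_imp_one[OF g True])
    moreover have "v = 0" using v True by simp
    ultimately show ?thesis using M0
      by (intro bexI[of _ M\<^sub>0]) (auto simp: reverses_def)
  next
    case False
    then obtain a where a: "a \<in> perp S" "a \<noteq> 0" using z0 by blast
    \<comment> \<open>The vector adjoined to \<open>S\<close> is \<open>v\<close> itself if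
      possible, so that fixing \<open>insert b S\<close> also fixes \<open>v\<close>.\<close>
    define b where "b = (if v = 0 then a else v)"
    have b: "b \<in> perp S" "b \<noteq> 0" using a v by (auto simp: b_def)
    then have fb: "form sg b b \<noteq> 0" using aniso by blast
    have suff: ?thesis if "M \<in> isoms sg" "reverses M g" "\<And>u. u \<in> insert b S \<Longrightarrow> M *v vbar u = u" for M
    proof -
      have "M *v vbar v = v"
      proof (cases "v = 0")
        case True
        then show ?thesis by simp
      qed (use that(3) in \<open>simp add: b_def\<close>)
      then show ?thesis using that by blast
    qed
    have perp_fixed: "form sg w u = 0" if "w \<in> perp S" "u \<in> S" for w u
      using that form_commute_0 by (auto simp: perp_def)
    \<comment> \<open>\<open>M\<^sub>0\<close> corrected by the quasi-reflection that sends its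
      image of \<open>b\<close> back to \<open>b\<close>; this keeps \<open>S\<close> fixed.\<close>
    obtain M1 where M1: "M1 \<in> isoms sg" "\<And>u. u \<in> insert b S \<Longrightarrow> M1 *v vbar u = u"
    proof (cases "M\<^sub>0 *v vbar b = b")
      case True
      then show thesis using that[of M\<^sub>0] M0 by auto
    next
      case ne: False
      define a' where "a' = M\<^sub>0 *v vbar b"
      have eq: "form sg a' a' = form sg b b"
        unfolding a'_def by (simp add: form_isom[OF M0(1)] form_vbar form_star)
      have "form sg u a' = 0" if "u \<in> S" for u
      proof -
        have "form sg u a' = form sg (M\<^sub>0 *v vbar u) (M\<^sub>0 *v vbar b)" using M0(2)[OF that] by (simp add: a'_def)
        then show ?thesis using b(1) that by (simp add: form_isom[OF M0(1)] form_vbar perp_def)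
      qed
      then have "b - a' \<in> perp S" using b(1) by (simp add: perp_def form_linear)
      moreover have "b - a' \<noteq> 0" using ne by (simp add: a'_def)
      ultimately have w: "form sg (b - a') (b - a') \<noteq> 0" "\<And>u. u \<in> S \<Longrightarrow> form sg (b - a') u = 0"
        using aniso perp_fixed by blast+
      note R = quasi_refl_maps[OF eq w(1)]
      show thesis
      proof (rule that)
        show "quasi_refl sg (b - a') (form sg b b - form sg b a') ** M\<^sub>0 \<in> isoms sg"
          by (intro isoms_mul R M0)
        show "(quasi_refl sg (b - a') (form sg b b - form sg b a') ** M\<^sub>0) *v vbar u = u" if "u \<in> insert b S" for u
          using that R(2,3) w(2) M0(2) by (auto simp: a'_def simp flip: matrix_vector_mul_assoc)
      qed
    qed
    have lt: "vec.dim (perp (insert b S)) < vec.dim (perp S)" by (rule dim_perp_insert_less[OF b(1) fb])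
    have aniso': "form sg x x \<noteq> 0" if "x \<in> perp (insert b S)" "x \<noteq> 0" for x
      using aniso that by (simp add: perp_insert)
    show ?thesis
    proof (cases "g *v b = b")
      case True
      then have gf: "g *v u = u" if "u \<in> insert b S" for u using that g(2) by auto
      have "0 \<in> perp (insert b S)" by (simp add: perp_def form_def)
      from less.hyps[OF lt aniso' M1 g(1) gf this]
      show ?thesis using suff by blast
    next
      case False
      define w where "w = b - g *v b"
      define z where "z = form sg b b - form sg b (g *v b)"
      have wp: "w \<in> perp S" unfolding w_def by (rule isom_diff_perp[OF g])
      have "w \<noteq> 0" using False by (simp add: w_def)
      then have ww: "form sg w w \<noteq> 0" using aniso wp by blast
      have eq: "form sg (g *v b) (g *v b) = form sg b b" by (rule form_isom[OF g(1)])
      have "form sg w w = z + star z"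
        unfolding w_def z_def form_linear eq by (simp add: form_star)
      then have z: "z \<noteq> 0" using ww by auto
      note st = reversal_step[OF g(1) fb z[unfolded z_def], folded z_def, folded w_def]
      let ?h = "quasi_refl sg w z ** g" and ?c = "z / form sg b b"
      have hf: "?h *v u = u" if "u \<in> insert b S" for u
        using that st(2,3) g(2) perp_fixed[OF wp] by auto
      have "star ?c *s (w - ?c *s b) \<in> perp (insert b S)"
        using st(5) wp b(1) by (simp add: perp_insert perp_def form_linear)
      from less.hyps[OF lt aniso' M1 st(1) hf this]
      obtain M where M: "M \<in> isoms sg" "reverses M ?h" "\<forall>u\<in>insert b S. M *v vbar u = u"
        "M *v vbar (star ?c *s (w - ?c *s b)) = star ?c *s (w - ?c *s b)" by blast
      show ?thesis
      proof (rule suff)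
        show "M ** mbar ?h \<in> isoms sg" by (intro isoms_mul M mbar_isoms st(1))
        show "reverses (M ** mbar ?h) g" using st(6) M by blast
        show "(M ** mbar ?h) *v vbar u = u" if "u \<in> insert b S" for u
          using st(7)[of M u] M(3) hf[OF that] that by blast
      qed
    qed
  qed
qed

end

section \<open>Reduction to a standard maximal compact subgroup\<close>

lemma matrix_monoid_sel [simp]:
  "carrier (matrix_monoid G) = G" "monoid.mult (matrix_monoid G) = (**)" "one (matrix_monoid G) = mone"
  by (simp_all add: matrix_monoid_def)

lemma matrix_monoid_inv:
  assumes "g \<in> G" "matrix_inv g \<in> G" "g ** matrix_inv g = mone" "matrix_inv g ** g = mone"
  shows "m_inv (matrix_monoid G) g = matrix_inv g"
  unfolding m_inv_def by (rule the_equality) (use assms matrix_inv_eqI in auto)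

context signature
begin

lemma inv_inv: assumes "h \<in> isoms sg" shows "matrix_inv (matrix_inv h) = h"
  by (intro matrix_inv_eqI isoms_inv assms)

lemma commuting_isom_unitary:
  assumes "g \<in> isoms sg" "g ** diag_form sg = diag_form sg ** g"
  shows "adj g ** g = mone"
proof -
  have "adj g ** g ** diag_form sg = adj g ** diag_form sg ** g" using assms(2) by (simp flip: matrix_mul_assoc)
  also have "\<dots> = diag_form sg" using assms(1) by (simp add: isoms_def)
  finally have "adj g ** g ** diag_form sg ** diag_form sg = diag_form sg ** diag_form sg" by simp
  then show ?thesis by simp
qed

lemma bounded_commuting_isoms: "bounded {g \<in> isoms sg. g ** diag_form sg = diag_form sg ** (g :: 'a::star_field ^ 'n ^ 'n)}"
  unfolding bounded_iff
proof (intro exI ballI)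
  fix g :: "'a ^ 'n ^ 'n" assume "g \<in> {g \<in> isoms sg. g ** diag_form sg = diag_form sg ** g}"
  then have u: "adj g ** g = mone" using commuting_isom_unitary by blast
  have "(norm (column q g))\<^sup>2 = 1" for q
  proof -
    have "of_real ((norm (column q g))\<^sup>2) = (\<Sum>r\<in>UNIV. of_real ((norm (g $ r $ q))\<^sup>2) :: 'a)"
      by (simp add: norm_vec_def L2_set_def sum_nonneg column_def)
    also have "\<dots> = (adj g ** g) $ q $ q" by (simp only: star_mult_self[symmetric] adj_nth matrix_matrix_mult_def vec_lambda_beta)
    also have "\<dots> = of_real 1" unfolding u by (simp add: Finite_Cartesian_Product.mat_def)
    finally show ?thesis by (simp only: of_real_eq_iff)
  qed
  then have "(norm g)\<^sup>2 = real CARD('n)" by (simp add: norm_matrix_sq)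
  then show "norm g \<le> sqrt (real CARD('n))" by (metis norm_ge_zero order_refl real_sqrt_unique)
qed

text \<open>The isometry \<open>h\<close> from \<open>conjugate_into_commutant\<close> need not lie
  in \<open>G\<close>, hence the hypothesis that conjugation by arbitrary isometries preserves
  \<open>G\<close>. The anti-involution and its conjugating elements are only required for the
  standard compact subgroup, the commutant of the form in \<open>G\<close>.\<close>

theorem multiplicity_free_of_anti_involution:
  fixes G :: "('a::star_field ^ 'n ^ 'n) set" and \<pi> :: "'a ^ 'n ^ 'n \<Rightarrow> 'v::complex_hilbert_space \<Rightarrow> 'v"
  assumes G: "G \<subseteq> isoms sg" "closed G" "mone \<in> G"
      "\<And>g h. g \<in> G \<Longrightarrow> h \<in> G \<Longrightarrow> g ** h \<in> G" "\<And>g. g \<in> G \<Longrightarrow> matrix_inv g \<in> G"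
    and norm: "\<And>h g. h \<in> isoms sg \<Longrightarrow> g \<in> G \<Longrightarrow> h ** g ** matrix_inv h \<in> G"
    and \<theta>: "\<And>g h. g \<in> G \<Longrightarrow> h \<in> G \<Longrightarrow> \<theta> (g ** h) = \<theta> h ** \<theta> g" "\<And>g. g \<in> G \<Longrightarrow> \<theta> g \<in> G"
      "\<And>g. g \<in> G \<Longrightarrow> \<theta> (\<theta> g) = g" "continuous_on UNIV \<theta>"
      "\<And>g. g \<in> G \<Longrightarrow> \<exists>k\<in>G. k ** diag_form sg = diag_form sg ** k \<and> k ** g = \<theta> g ** k"
    and K: "maximal_compact_subgroup G K"
    and \<pi>: "irreducible_hilbert_representation G \<pi>" "admissible K \<pi>"
  shows "multiplicity_free K \<pi>"
proof -
  let ?J = "diag_form sg :: 'a ^ 'n ^ 'n"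
  have inv: "m_inv (matrix_monoid G) g = matrix_inv g" if "g \<in> G" for g
    by (rule matrix_monoid_inv) (use that G isoms_inv in blast)+
  have sub: "subgroup K (matrix_monoid G)" and cK: "compact K"
    and maxK: "\<And>L. compact_subgroup G L \<Longrightarrow> K \<subseteq> L \<Longrightarrow> L = K"
    using K by (auto simp: maximal_compact_subgroup_def compact_subgroup_def)
  have KG: "K \<subseteq> G" using subgroup.subset[OF sub] by simp
  interpret compact_isometry_group K sg
  proof
    show "mone \<in> K" using subgroup.one_closed[OF sub] by simp
    show "a ** b \<in> K" if "a \<in> K" "b \<in> K" for a b using subgroup.m_closed[OF sub that] by simp
    show "\<exists>b\<in>K. a ** b = mone \<and> b ** a = mone" if a: "a \<in> K" for a
    proof -
      have "matrix_inv a \<in> K" using subgroup.m_inv_closed[OF sub a] inv a KG by auto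
      then show ?thesis using isoms_inv(2,3)[of a] a KG G(1) by blast
    qed
    show "K \<subseteq> isoms sg" using KG G(1) by blast
  qed (rule cK)
  obtain h where h: "h \<in> isoms sg"
    "\<And>k. k \<in> K \<Longrightarrow> (matrix_inv h ** k ** h) ** ?J = ?J ** (matrix_inv h ** k ** h)"
    using conjugate_into_commutant by blast
  note hc = isoms_inv_cancel[OF h(1)] isoms_inv(2,3)[OF h(1)]
  define C where "C x = h ** x ** matrix_inv h" for x
  define D where "D x = matrix_inv h ** x ** h" for x
  have CD: "C (D x) = x" "D (C x) = x" for x by (simp_all add: C_def D_def matrix_mul_assoc hc)
  have Cmul: "C (x ** y) = C x ** C y" for x y by (simp add: C_def matrix_mul_assoc hc)
  have Dmul: "D (x ** y) = D x ** D y" for x y by (simp add: D_def matrix_mul_assoc hc)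
  have CG: "C x \<in> G" if "x \<in> G" for x unfolding C_def by (rule norm[OF h(1) that])
  have DG: "D x \<in> G" if "x \<in> G" for x
    using norm[OF isoms_inv(4)[OF h(1)] that] by (simp add: D_def inv_inv[OF h(1)])
  define K\<^sub>0 where "K\<^sub>0 = {g \<in> G. g ** ?J = ?J ** g}"
  have "closed K\<^sub>0"
  proof -
    have "K\<^sub>0 = G \<inter> {g. g ** ?J = ?J ** g}" by (auto simp: K\<^sub>0_def)
    then show ?thesis by (auto intro!: closed_Int G(2) closed_Collect_eq continuous_intros)
  qed
  \<comment> \<open>An isometry that commutes with the form matrix is unitary, so its columns are
    unit vectors.\<close>
  moreover have "bounded K\<^sub>0"
    by (rule bounded_subset[OF bounded_commuting_isoms]) (use G(1) in \<open>auto simp: K\<^sub>0_def\<close>)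
  ultimately have cK0: "compact K\<^sub>0" by (simp add: compact_eq_bounded_closed)
  have cC: "continuous_on UNIV C" and cD: "continuous_on UNIV D" unfolding C_def D_def by (intro continuous_intros)+
  have "compact (C ` K\<^sub>0)" by (rule compact_continuous_image[OF continuous_on_subset[OF cC] cK0]) simp
  moreover have "subgroup (C ` K\<^sub>0) (matrix_monoid G)"
  proof
    show "C ` K\<^sub>0 \<subseteq> carrier (matrix_monoid G)" using CG by (auto simp: K\<^sub>0_def)
    show "one (matrix_monoid G) \<in> C ` K\<^sub>0"
      using G(3) hc by (auto simp: K\<^sub>0_def C_def intro!: image_eqI[of _ _ mone])
    show "monoid.mult (matrix_monoid G) x y \<in> C ` K\<^sub>0" if xy: "x \<in> C ` K\<^sub>0" "y \<in> C ` K\<^sub>0" for x y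
    proof -
      obtain a b where ab: "x = C a" "y = C b" "a \<in> K\<^sub>0" "b \<in> K\<^sub>0" using xy by blast
      have "a ** b ** ?J = a ** ?J ** b" using ab(4) by (simp add: K\<^sub>0_def flip: matrix_mul_assoc)
      also have "\<dots> = ?J ** (a ** b)" using ab(3) by (simp add: K\<^sub>0_def matrix_mul_assoc)
      finally have "a ** b \<in> K\<^sub>0" using ab G(4) by (simp add: K\<^sub>0_def)
      then show ?thesis using ab Cmul by (auto intro!: image_eqI[of _ _ "a ** b"])
    qed
    show "m_inv (matrix_monoid G) x \<in> C ` K\<^sub>0" if x: "x \<in> C ` K\<^sub>0" for x
    proof -
      obtain a where a: "x = C a" "a \<in> K\<^sub>0" using x by blast
      have aG: "a \<in> G" "a ** ?J = ?J ** a" using a by (auto simp: K\<^sub>0_def)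
      have aI: "a \<in> isoms sg" using aG G(1) by blast
      have "matrix_inv a ** (a ** ?J) ** matrix_inv a = matrix_inv a ** (?J ** a) ** matrix_inv a" using aG by simp
      then have "matrix_inv a ** ?J = ?J ** matrix_inv a"
        using isoms_inv_cancel[OF aI] isoms_inv(2,3)[OF aI] by (simp add: matrix_mul_assoc)
      then have ia: "matrix_inv a \<in> K\<^sub>0" using G(5) aG by (simp add: K\<^sub>0_def)
      have "matrix_inv (C a) = C (matrix_inv a)"
        by (rule matrix_inv_eqI) (simp_all add: isoms_inv(2,3)[OF aI] flip: Cmul, simp_all add: C_def hc)
      then show ?thesis using ia a inv[OF CG[OF aG(1)]] by auto
    qed
  qed
  ultimately have "compact_subgroup G (C ` K\<^sub>0)" by (simp add: compact_subgroup_def)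
  moreover have "K \<subseteq> C ` K\<^sub>0"
  proof
    fix k assume k: "k \<in> K"
    then have "D k \<in> K\<^sub>0" using h(2)[OF k] DG KG by (auto simp: K\<^sub>0_def D_def)
    then show "k \<in> C ` K\<^sub>0" using CD(1)[of k] by (metis image_eqI)
  qed
  ultimately have eqK: "C ` K\<^sub>0 = K" by (rule maxK)
  \<comment> \<open>The anti-involution is transported by \<open>C\<close>, which carries the
    standard compact subgroup to \<open>K\<close>.\<close>
  interpret strong_gelfand K G \<pi> "\<lambda>g. C (\<theta> (D g))"
  proof
    show "K \<subseteq> G" by (rule KG)
    show "g ** h \<in> G" if "g \<in> G" "h \<in> G" for g h using G(4) that .
    show "hilbert_representation G \<pi>" using \<pi>(1) by (simp add: irreducible_hilbert_representation_def)
    show "C (\<theta> (D (g ** h))) = C (\<theta> (D h)) ** C (\<theta> (D g))" if "g \<in> G" "h \<in> G" for g h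
      using that DG by (simp add: Dmul Cmul \<theta>(1))
    show "C (\<theta> (D g)) \<in> G" if "g \<in> G" for g using that by (intro CG \<theta> DG)
    show "C (\<theta> (D (C (\<theta> (D g))))) = g" if "g \<in> G" for g using that by (simp add: CD \<theta> DG)
    have "continuous_on UNIV (\<lambda>g. C (\<theta> (D g)))"
      by (intro continuous_on_compose2[OF cC] continuous_on_compose2[OF \<theta>(4)] cD) auto
    then show "continuous_on K (\<lambda>g. C (\<theta> (D g)))" by (rule continuous_on_subset) simp
    show "\<exists>k\<in>K. k ** g = C (\<theta> (D g)) ** k" if g: "g \<in> G" for g
    proof -
      obtain k where k: "k \<in> G" "k ** ?J = ?J ** k" "k ** D g = \<theta> (D g) ** k" using \<theta>(5)[OF DG[OF g]] by blast
      have "C k \<in> K" using k(1,2) eqK by (auto simp: K\<^sub>0_def)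
      moreover have "C k ** g = C (\<theta> (D g)) ** C k"
        using arg_cong[OF k(3), of C] by (simp add: Cmul CD)
      ultimately show ?thesis by blast
    qed
  qed
  show ?thesis by (rule multiplicity_freeI[OF \<pi>])
qed

end

subsection \<open>Determinants of isometries\<close>

lemma star_prod [simp]: "star (prod f A) = (\<Prod>i\<in>A. star (f i :: 'a::star_field))"
  by (induction A rule: infinite_finite_induct) auto

lemma det_mbar: "Determinants.det (mbar A) = star (Determinants.det (A :: 'a::star_field ^ 'n::finite ^ 'n))"
proof -
  have "star (of_int k) = (of_int k :: 'a)" for k using star_of_real[of "of_int k"] by simp
  then show ?thesis by (simp add: Determinants.det_def)
qed

lemma adj_transpose: "adj A = mbar (Finite_Cartesian_Product.transpose A)"
  by (simp add: cart_eq_iff Finite_Cartesian_Product.transpose_def)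

context signature
begin

lemma det_isom_nonzero:
  assumes "A \<in> isoms sg" shows "Determinants.det A \<noteq> 0" "Determinants.det (matrix_inv A) * Determinants.det A = 1"
proof -
  show "Determinants.det (matrix_inv A) * Determinants.det A = 1"
    using isoms_inv(3)[OF assms] by (metis Determinants.det_mul Determinants.det_I)
  then show "Determinants.det A \<noteq> 0" by auto
qed

lemma det_diag_form_sq: "Determinants.det (diag_form sg) * Determinants.det (diag_form sg) = (1 :: 'a::star_field)"
proof -
  have "Determinants.det (diag_form sg ** diag_form sg :: 'a ^ 'n ^ 'n) = 1" by (simp add: Determinants.det_I)
  then show ?thesis by (simp only: Determinants.det_mul)
qed

lemma norm_det_isom: assumes "A \<in> isoms sg" shows "norm (Determinants.det A) = 1"
proof -
  have "matrix_inv A = diag_form sg ** adj A ** diag_form sg" by (rule isoms_inv[OF assms])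
  then have "Determinants.det (matrix_inv A) = (Determinants.det (diag_form sg) * Determinants.det (diag_form sg)) * star (Determinants.det A)"
    by (simp add: Determinants.det_mul adj_transpose det_mbar Determinants.det_transpose mult_ac)
  then have "star (Determinants.det A) * Determinants.det A = 1"
    using det_isom_nonzero(2)[OF assms] by (simp add: det_diag_form_sq)
  then have "of_real ((norm (Determinants.det A))\<^sup>2) = (of_real 1 :: 'a)" by (simp only: star_mult_self of_real_1)
  then have "(norm (Determinants.det A))\<^sup>2 = 1" by (simp only: of_real_eq_iff)
  then show ?thesis using power2_eq_1_iff norm_ge_zero by (smt (verit))
qed

text \<open>On isometries this is the entrywise conjugate of the inverse. The formula through the
  transpose is linear and reverses products of all matrices, which makes continuity and the
  anti-involution property immediate.\<close>

definition inv_bar :: "'a::star_field ^ 'n ^ 'n \<Rightarrow> 'a ^ 'n ^ 'n" where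
  "inv_bar g = diag_form sg ** Finite_Cartesian_Product.transpose g ** diag_form sg"

lemma inv_bar_eq: "g \<in> isoms sg \<Longrightarrow> inv_bar g = mbar (matrix_inv g)"
  by (simp add: inv_bar_def isoms_inv(1) mbar_mul adj_transpose)

lemma inv_bar_mul: "inv_bar (g ** h) = inv_bar h ** inv_bar g"
  by (simp add: inv_bar_def matrix_transpose_mul matrix_mul_assoc)

lemma inv_bar_inv_bar [simp]: "inv_bar (inv_bar g) = g"
proof -
  have "Finite_Cartesian_Product.transpose (diag_form sg) = (diag_form sg :: 'a ^ 'n ^ 'n)"
    by (simp add: cart_eq_iff Finite_Cartesian_Product.transpose_def diag_form_def)
  then show ?thesis by (simp add: inv_bar_def matrix_transpose_mul matrix_mul_assoc transpose_transpose)
qed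

lemma inv_bar_isoms: "g \<in> isoms sg \<Longrightarrow> inv_bar g \<in> isoms sg"
  by (simp only: inv_bar_eq mbar_isoms isoms_inv(4))

lemma det_inv_bar: "Determinants.det (inv_bar g) = Determinants.det (g :: 'a::star_field ^ 'n ^ 'n)"
  using det_diag_form_sq[where ?'a = 'a] by (simp add: inv_bar_def Determinants.det_mul Determinants.det_transpose mult_ac)

lemma continuous_on_inv_bar: "continuous_on UNIV (inv_bar :: 'a::star_field ^ 'n ^ 'n \<Rightarrow> _)"
  unfolding inv_bar_def Finite_Cartesian_Product.transpose_def by (intro continuous_intros)

lemma reverses_conj:
  assumes "reverses M g" "g \<in> isoms sg"
  shows "mbar M ** g = inv_bar g ** mbar M"
proof -
  have "matrix_inv g ** (g ** M ** mbar g) = matrix_inv g ** M" using assms(1) by (simp add: reverses_def)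
  then have "M ** mbar g = matrix_inv g ** M" using isoms_inv(3)[OF assms(2)] by (simp add: matrix_mul_assoc)
  then have "mbar (M ** mbar g) = mbar (matrix_inv g ** M)" by simp
  then show ?thesis by (simp add: mbar_mul inv_bar_eq[OF assms(2)])
qed

end

section \<open>Signature (p,1)\<close>

definition sig :: "'p + 'q \<Rightarrow> real" where
  "sig i = (case i of Inl _ \<Rightarrow> 1 | Inr _ \<Rightarrow> -1)"

interpretation sig: signature sig
  by standard (auto simp: sig_def split: sum.splits)

lemma signature_form_eq: "signature_form = diag_form sig"
  by (auto simp: signature_form_def diag_form_def cart_eq_iff sig_def split: sum.splits)

lemma adjoint_matrix_eq: "adjoint_matrix A = adj A"
  by (simp add: adjoint_matrix_def adj_def)

lemma SU_eq: "SU = {A \<in> isoms sig. Determinants.det A = 1}"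
  by (simp add: SU_def isoms_def signature_form_eq adjoint_matrix_eq)

abbreviation pole :: "'a::star_field ^ ('p::finite + 1)" where
  "pole \<equiv> axis (Inr 1) 1"

lemma sig_simps [simp]: "sig (Inl i) = 1" "sig (Inr j) = -1"
  by (simp_all add: sig_def)

lemma form_pole: "form sig pole x = - x $ Inr 1"
  by (simp add: form_axis)

lemma sum_Plus_one: "(\<Sum>i\<in>(UNIV :: ('p::finite + 1) set). f i) = (\<Sum>i\<in>UNIV. f (Inl i)) + (f (Inr 1) :: 'b::comm_monoid_add)"
proof -
  have "(\<Sum>i\<in>(UNIV :: ('p + 1) set). f i) = (\<Sum>i\<in>UNIV <+> UNIV. f i)" by (simp only: UNIV_Plus_UNIV)
  also have "\<dots> = (\<Sum>i\<in>UNIV. f (Inl i)) + (\<Sum>i\<in>(UNIV :: 1 set). f (Inr i))"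
    by (simp add: sum.Plus)
  also have "(UNIV :: 1 set) = {1}" by auto
  finally show ?thesis by simp
qed

lemma form_self_one: "form sig x x = of_real ((\<Sum>i\<in>UNIV. (norm (x $ Inl i))\<^sup>2) - (norm (x $ Inr 1))\<^sup>2)"
  for x :: "'a::star_field ^ ('p::finite + 1)"
  by (simp add: form_def star_mult_self sum_Plus_one del: of_real_power)

lemma pole_aniso:
  fixes x :: "'a::star_field ^ ('p::finite + 1)"
  assumes "x \<in> sig.perp {pole}" "x \<noteq> 0"
  shows "\<exists>r>0. form sig x x = of_real r"
proof -
  have z: "x $ Inr 1 = 0" using assms(1) by (simp add: sig.perp_def form_pole)
  have "\<exists>i. x $ Inl i \<noteq> 0"
  proof (rule ccontr)
    assume "\<not> ?thesis"
    then have l: "x $ Inl i = 0" for i by simp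
    have "x $ i = 0" for i
    proof (cases i)
      case (Inr b)
      then have "i = Inr 1" by simp
      then show ?thesis using z by simp
    qed (simp add: l)
    then show False using assms(2) by (simp add: cart_eq_iff)
  qed
  then obtain i where "x $ Inl i \<noteq> 0" by blast
  then have "0 < (\<Sum>i\<in>UNIV. (norm (x $ Inl i))\<^sup>2)" by (intro sum_pos2[of _ i]) auto
  then show ?thesis using z by (auto simp: form_self_one)
qed

text \<open>The image of the pole has form -1, so the squared norm of its last coordinate is one
  plus the squared norms of the others.\<close>

lemma norm_pole_entry:
  assumes "g \<in> isoms sig"
  shows "norm (g $ Inr 1 $ Inr 1) \<ge> 1"
    "norm (g $ Inr 1 $ Inr 1) = 1 \<Longrightarrow> g *v pole = (g $ Inr 1 $ Inr 1 :: 'a::star_field) *s (pole :: 'a ^ ('p::finite + 1))"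
proof -
  define x where "x = g *v pole"
  have xi: "x $ i = g $ i $ Inr 1" for i by (simp add: x_def matrix_vec_axis column_def)
  have "form sig x x = -1" unfolding x_def form_isom[OF assms] by (simp add: form_axis)
  then have "of_real ((\<Sum>i\<in>UNIV. (norm (x $ Inl i))\<^sup>2) - (norm (x $ Inr 1))\<^sup>2) = (of_real (-1) :: 'a)"
    by (simp only: form_self_one of_real_minus of_real_1)
  then have eq: "(\<Sum>i\<in>UNIV. (norm (x $ Inl i))\<^sup>2) = (norm (x $ Inr 1))\<^sup>2 - 1" by (simp only: of_real_eq_iff)
  then have "(norm (x $ Inr 1))\<^sup>2 \<ge> 1\<^sup>2" using sum_nonneg[of UNIV "\<lambda>i. (norm (x $ Inl i))\<^sup>2"] by simp
  then show "norm (g $ Inr 1 $ Inr 1) \<ge> 1" unfolding xi by (rule power2_le_imp_le) simp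
  assume "norm (g $ Inr 1 $ Inr 1) = 1"
  then have "(\<Sum>i\<in>UNIV. (norm (x $ Inl i))\<^sup>2) = 0" using eq xi by simp
  then have z: "x $ Inl i = 0" for i by (subst (asm) sum_nonneg_eq_0_iff) auto
  have "x $ i = (g $ Inr 1 $ Inr 1 *s pole) $ i" for i
  proof (cases i)
    case (Inr b)
    then have "i = Inr 1" by simp
    then show ?thesis by (simp add: xi axis_def)
  qed (simp add: z axis_def)
  then show "g *v pole = g $ Inr 1 $ Inr 1 *s pole" by (simp add: x_def cart_eq_iff)
qed

lemma vbar_pole [simp]: "vbar pole = pole"
  by (simp add: cart_eq_iff axis_def)

lemma pole_fixed_commutes:
  fixes M :: "'a::star_field ^ ('p::finite + 1) ^ ('p + 1)"
  assumes M: "M \<in> isoms sig" "M *v pole = pole"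
  shows "M ** diag_form sig = diag_form sig ** M"
proof -
  have c: "M $ i $ Inr 1 = (if i = Inr 1 then 1 else 0)" for i
    using arg_cong[OF M(2)[unfolded matrix_vec_axis column_def], of "\<lambda>x. x $ i"] by (simp add: axis_def)
  have r: "M $ Inr 1 $ j = (if j = Inr 1 then 1 else 0)" for j
  proof -
    have "form sig pole (M *v axis j 1) = form sig pole (axis j 1)"
      using form_isom[OF M(1), of pole "axis j 1"] by (simp only: M(2))
    then show ?thesis unfolding form_pole matrix_vec_axis column_def by (simp add: axis_def)
  qed
  have "M $ i $ j * of_real (sig j) = of_real (sig i) * M $ i $ j" for i j
  proof (cases i; cases j)
    fix a b assume ij: "i = Inl a" "j = Inr b"
    then have "j = Inr 1" by simp
    with ij have "M $ i $ j = 0" using c[of i] by simp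
    then show ?thesis by simp
  next
    fix a b assume ij: "i = Inr a" "j = Inl b"
    then have "i = Inr 1" by simp
    with ij have "M $ i $ j = 0" using r[of j] by simp
    then show ?thesis by simp
  qed auto
  then show ?thesis by (simp add: cart_eq_iff diag_form_mul_left diag_form_mul_right)
qed

text \<open>The whole space is not anisotropic, so the first descent, at the pole, is done by hand:
  after rescaling \<open>g\<close> by a phase the parameter \<open>z\<close> is the norm of the pole
  entry minus one, which vanishes only if the pole is fixed. Afterwards \<open>reversal_ex\<close>
  applies to the positive definite complement.\<close>

lemma reversal_ex_pole:
  fixes g :: "'a::star_field ^ ('p::finite + 1) ^ ('p + 1)"
  assumes g: "g \<in> isoms sig"
  shows "\<exists>M\<in>isoms sig. reverses M g \<and> M *v pole = pole"
proof -
  define lam where "lam = of_real (norm (g $ Inr 1 $ Inr 1)) / g $ Inr 1 $ Inr 1"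
  have nz: "g $ Inr 1 $ Inr 1 \<noteq> 0" using norm_pole_entry(1)[OF g] by auto
  have nl: "norm lam = 1" using nz by (simp add: lam_def norm_divide)
  have l1: "star lam * lam = 1" "lam * star lam = 1" using star_mult_self[of lam] nl by (simp_all add: mult.commute)
  define f where "f = (\<chi> i j. lam * g $ i $ j)"
  have fv: "f *v x = lam *s (g *v x)" for x
    by (simp add: f_def cart_eq_iff matrix_vector_mult_def sum_distrib_left mult.assoc)
  have fI: "f \<in> isoms sig"
    by (rule isomsI) (simp add: fv form_linear form_isom[OF g] l1 flip: mult.assoc)
  have f1: "f $ Inr 1 $ Inr 1 = of_real (norm (g $ Inr 1 $ Inr 1))" using nz by (simp add: f_def lam_def)
  \<comment> \<open>The phase disappears since the second factor enters conjugated.\<close>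
  have rev: "reverses M g" if "reverses M f" for M
  proof -
    have fm: "f ** M ** mbar f = (\<chi> i j. lam * star lam * (g ** M ** mbar g) $ i $ j)"
      by (simp add: f_def cart_eq_iff matrix_matrix_mult_def sum_distrib_left sum_distrib_right mult_ac)
    show ?thesis using that unfolding reverses_def fm l1 by (simp add: cart_eq_iff)
  qed
  have aniso: "form sig x x \<noteq> 0" if "x \<in> sig.perp {pole}" "x \<noteq> 0" for x :: "'a ^ ('p + 1)"
    using pole_aniso[OF that] by auto
  have one: "mone *v vbar u = u" if "u \<in> {pole}" for u :: "'a ^ ('p + 1)" using that by simp
  define z where "z = form sig pole (pole :: 'a ^ ('p + 1)) - form sig pole (f *v pole)"
  have zeq: "z = of_real (norm (g $ Inr 1 $ Inr 1) - 1)"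
    unfolding z_def form_pole by (simp add: matrix_vec_axis column_def f1)
  show ?thesis
  proof (cases "norm (g $ Inr 1 $ Inr 1) = 1")
    case True
    then have "f *v pole = pole" using norm_pole_entry(2)[OF fI] f1 by simp
    then have ff: "f *v u = u" if "u \<in> {pole}" for u using that by simp
    have "0 \<in> sig.perp {pole :: 'a ^ ('p + 1)}" by (simp add: sig.perp_def form_def)
    from sig.reversal_ex[OF aniso isoms_one one fI ff this]
    obtain M where "M \<in> isoms sig" "reverses M f" "M *v vbar pole = pole" by auto
    then show ?thesis using rev by auto
  next
    case False
    have z: "z \<noteq> 0" using False unfolding zeq of_real_eq_0_iff by simp
    have pp: "form sig pole (pole :: 'a ^ ('p + 1)) \<noteq> 0" unfolding form_pole by (simp add: axis_def)
    define w where "w = pole - f *v pole"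
    note st = sig.reversal_step[OF fI pp z[unfolded z_def], folded z_def, folded w_def]
    let ?h = "quasi_refl sig w z ** f" and ?c = "z / form sig pole (pole :: 'a ^ ('p + 1))"
    have hf: "?h *v u = u" if "u \<in> {pole}" for u using that st(2) by simp
    have "star ?c *s (w - ?c *s pole) \<in> sig.perp {pole}"
      using st(5) by (simp only: sig.perp_def form_linear mem_Collect_eq ball_simps mult_zero_right)
    from sig.reversal_ex[OF aniso isoms_one one st(1) hf this]
    obtain M where M: "M \<in> isoms sig" "reverses M ?h" "M *v vbar pole = pole"
      "M *v vbar (star ?c *s (w - ?c *s pole)) = star ?c *s (w - ?c *s pole)" by blast
    have "M ** mbar ?h \<in> isoms sig" by (intro isoms_mul M mbar_isoms st(1))
    moreover have "reverses (M ** mbar ?h) f" by (rule st(6)[OF M])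
    moreover have "(M ** mbar ?h) *v vbar pole = pole" by (rule st(7)[OF M(3) st(2)])
    ultimately show ?thesis using rev by auto
  qed
qed

theorem SU_multiplicity_free:
  fixes \<pi> :: "complex ^ ('p::finite + 1) ^ ('p + 1) \<Rightarrow> 'v::complex_hilbert_space \<Rightarrow> 'v"
  assumes "maximal_compact_subgroup SU K" "irreducible_hilbert_representation SU \<pi>" "admissible K \<pi>"
  shows "multiplicity_free K \<pi>"
proof (rule sig.multiplicity_free_of_anti_involution[where \<theta> = sig.inv_bar, OF _ _ _ _ _ _ _ _ _ _ _ assms])
  show "SU \<subseteq> isoms sig" by (auto simp: SU_eq)
  show "closed (SU :: (complex ^ ('p + 1) ^ ('p + 1)) set)"
  proof -
    have "SU = isoms sig \<inter> {A :: complex ^ ('p + 1) ^ ('p + 1). Determinants.det A = 1}" by (auto simp: SU_eq)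
    moreover have "closed {A :: complex ^ ('p + 1) ^ ('p + 1). Determinants.det A = 1}"
      unfolding Determinants.det_def by (intro closed_Collect_eq continuous_intros)
    ultimately show ?thesis using closed_Int[OF closed_isoms] by metis
  qed
  show "mone \<in> SU" by (simp add: SU_eq)
  show "g ** h \<in> SU" if "g \<in> SU" "h \<in> SU" for g h :: "complex ^ ('p + 1) ^ ('p + 1)"
    using that by (simp add: SU_eq isoms_mul Determinants.det_mul)
  show "matrix_inv g \<in> SU" if "g \<in> SU" for g :: "complex ^ ('p + 1) ^ ('p + 1)"
    using that sig.isoms_inv(4) sig.det_isom_nonzero(2)[of g] by (auto simp: SU_eq)
  show "h ** g ** matrix_inv h \<in> SU" if "h \<in> isoms sig" "g \<in> SU" for g h :: "complex ^ ('p + 1) ^ ('p + 1)"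
    using that sig.det_isom_nonzero(2)[of h] sig.isoms_inv(4)[of h]
    by (auto simp: SU_eq Determinants.det_mul mult.commute intro!: isoms_mul)
  show "sig.inv_bar (g ** h) = sig.inv_bar h ** sig.inv_bar g" for g h :: "complex ^ ('p + 1) ^ ('p + 1)"
    by (rule sig.inv_bar_mul)
  show "sig.inv_bar g \<in> SU" if "g \<in> SU" for g :: "complex ^ ('p + 1) ^ ('p + 1)"
    using that by (simp add: SU_eq sig.inv_bar_isoms sig.det_inv_bar)
  show "sig.inv_bar (sig.inv_bar g) = g" for g :: "complex ^ ('p + 1) ^ ('p + 1)" by simp
  show "continuous_on UNIV (sig.inv_bar :: complex ^ ('p + 1) ^ ('p + 1) \<Rightarrow> _)" by (rule sig.continuous_on_inv_bar)
  fix g :: "complex ^ ('p + 1) ^ ('p + 1)" assume g: "g \<in> SU"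
  then have gI: "g \<in> isoms sig" by (simp add: SU_eq)
  obtain M where M: "M \<in> isoms sig" "reverses M g" "M *v pole = pole" using reversal_ex_pole[OF gI] by blast
  let ?k = "mbar M"
  have kI: "?k \<in> isoms sig" by (rule mbar_isoms[OF M(1)])
  have kp: "?k *v pole = pole" using mbar_vec[of M pole] M(3) by simp
  note com = pole_fixed_commutes[OF kI kp]
  let ?n = "CARD('p + 1)"
  have n0: "?n \<noteq> 0" by simp
  \<comment> \<open>A scalar matrix commutes with everything, so multiplying by a root of the
    inverse determinant makes the determinant one and affects neither conjugation relation. The root
    has norm one because determinants of isometries do.\<close>
  obtain \<mu> where \<mu>: "inverse (Determinants.det ?k) = \<mu> ^ ?n"
    by (rule exists_complex_root[OF n0])
  have "norm \<mu> ^ ?n = norm (inverse (Determinants.det ?k))" unfolding \<mu> by (rule norm_power[symmetric])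
  also have "\<dots> = 1" unfolding norm_inverse sig.norm_det_isom[OF kI] by simp
  finally have "norm \<mu> ^ ?n = 1" .
  then have n\<mu>: "norm \<mu> = 1" using power_eq_1_iff n0 by (metis real_norm_def abs_norm_cancel)
  define k where "k = (\<chi> i. \<mu> *s ?k $ i)"
  have kv: "k *v x = \<mu> *s (?k *v x)" for x
    by (simp add: k_def cart_eq_iff matrix_vector_mult_def sum_distrib_left mult.assoc)
  have "cnj \<mu> * \<mu> = 1" "\<mu> * cnj \<mu> = 1" using complex_norm_square[of \<mu>] n\<mu> by (simp_all add: mult.commute)
  then have "k \<in> isoms sig"
    by (intro isomsI) (simp add: kv form_linear form_isom[OF kI] flip: mult.assoc)
  moreover have "Determinants.det k = 1"
  proof -
    have "Determinants.det k = \<mu> ^ ?n * Determinants.det ?k"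
      unfolding k_def using Determinants.det_rows_mul[of "\<lambda>_. \<mu>" "\<lambda>i. ?k $ i"]
      by (simp only: prod_constant vec_lambda_eta)
    then show ?thesis unfolding \<mu>[symmetric] using sig.det_isom_nonzero(1)[OF kI] by simp
  qed
  moreover have mul: "k ** A = (\<chi> i j. \<mu> * (?k ** A) $ i $ j)" "A ** k = (\<chi> i j. \<mu> * (A ** ?k) $ i $ j)" for A
    by (simp_all add: k_def cart_eq_iff matrix_matrix_mult_def sum_distrib_left mult_ac)
  ultimately show "\<exists>k\<in>SU. k ** diag_form sig = diag_form sig ** k \<and> k ** g = sig.inv_bar g ** k"
    using com sig.reverses_conj[OF M(2) gI] by (intro bexI[of _ k]) (simp_all add: SU_eq)
qed

subsection \<open>The determinant of a reversing isometry\<close>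

lemma real_bar [simp]: "vbar (x :: real ^ 'n) = x" "mbar (A :: real ^ 'n ^ 'm) = A"
  by (simp_all add: cart_eq_iff)

context signature
begin

lemma dim_perp_insert:
  fixes b :: "real ^ 'n"
  assumes b: "b \<in> perp S" "form sg b b \<noteq> 0"
  shows "vec.dim (perp S) = Suc (vec.dim (perp (insert b S)))"
proof -
  have "x \<in> vec.span (insert b (perp (insert b S)))" if x: "x \<in> perp S" for x
  proof -
    define y where "y = x - (form sg b x / form sg b b) *s b"
    have "y \<in> perp (insert b S)" using x b by (simp add: y_def perp_insert perp_def form_linear)
    then have "y + (form sg b x / form sg b b) *s b \<in> vec.span (insert b (perp (insert b S)))"
      by (intro vec.span_add vec.span_scale) (auto intro: vec.span_base)
    then show ?thesis by (simp add: y_def)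
  qed
  then have "vec.dim (perp S) \<le> vec.dim (insert b (perp (insert b S)))"
    by (intro vec.dim_subset[of _ "vec.span _", unfolded vec.dim_span]) blast
  also have "\<dots> \<le> Suc (vec.dim (perp (insert b S)))" by (simp add: vec.dim_insert)
  finally show ?thesis using dim_perp_insert_less[OF b] by simp
qed

lemma quasi_refl_involution:
  fixes w :: "real ^ 'n"
  assumes "z \<noteq> 0" "form sg w w = 2 * z"
  shows "quasi_refl sg w z ** quasi_refl sg w z = mone"
proof (unfold matrix_eq, intro allI)
  fix x
  show "(quasi_refl sg w z ** quasi_refl sg w z) *v x = mone *v x"
    using assms by (simp add: quasi_refl_vec form_linear cart_eq_iff field_simps flip: matrix_vector_mul_assoc)
qed

text \<open>Over the reals the quasi-reflection is a true reflection, hence an involution of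
  determinant -1: every descent flips the sign of the determinant.\<close>

lemma real_descent:
  fixes g :: "real ^ 'n ^ 'n"
  assumes g: "g \<in> isoms sg" and b: "form sg b b \<noteq> 0"
  defines "w \<equiv> b - g *v b" and "z \<equiv> form sg b b - form sg b (g *v b)"
  assumes z: "z \<noteq> 0"
  defines "h \<equiv> quasi_refl sg w z ** g"
  shows "h \<in> isoms sg" "h *v b = b" "\<And>u. g *v u = u \<Longrightarrow> form sg w u = 0 \<Longrightarrow> h *v u = u"
    "form sg w w = 2 * z" "Determinants.det h = - Determinants.det g" "g = quasi_refl sg w z ** h"
    "form sg b (w - (z / form sg b b) *s b) = 0"
    "\<And>M. M \<in> isoms sg \<Longrightarrow> reverses M h \<Longrightarrow> M *v b = b \<Longrightarrow> M *v w = w \<Longrightarrow> reverses (M ** h) g"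
    "\<And>M u. M *v u = u \<Longrightarrow> h *v u = u \<Longrightarrow> (M ** h) *v u = u"
proof -
  note st = reversal_step[OF g b z[unfolded z_def], folded z_def, folded w_def, folded h_def]
  show "h \<in> isoms sg" "h *v b = b" "\<And>u. g *v u = u \<Longrightarrow> form sg w u = 0 \<Longrightarrow> h *v u = u"
    by (fact st)+
  show ww: "form sg w w = 2 * z" using st(4) by simp
  show "Determinants.det h = - Determinants.det g"
    using z by (simp add: h_def Determinants.det_mul det_quasi_refl ww)
  show "g = quasi_refl sg w z ** h"
    by (simp add: h_def matrix_mul_assoc quasi_refl_involution[OF z ww])
  show "form sg b (w - (z / form sg b b) *s b) = 0" by (rule st(5))
  show "reverses (M ** h) g" if "M \<in> isoms sg" "reverses M h" "M *v b = b" "M *v w = w" for M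
    using st(6)[of M] that by (simp add: vector_scalar_commute matrix_vector_mult_diff_distrib)
  show "(M ** h) *v u = u" if "M *v u = u" "h *v u = u" for M u using st(7)[of M u] that by simp
qed

lemma real_descent_aniso:
  fixes g :: "real ^ 'n ^ 'n"
  assumes aniso: "\<forall>x\<in>perp S. x \<noteq> 0 \<longrightarrow> form sg x x \<noteq> 0"
    and g: "g \<in> isoms sg" "\<forall>u\<in>S. g *v u = u" and b: "b \<in> perp S" "g *v b \<noteq> b"
  shows "form sg b b \<noteq> 0" "form sg b b - form sg b (g *v b) \<noteq> 0" "b - g *v b \<in> perp S" "b - g *v b \<noteq> 0"
    "\<And>u. u \<in> S \<Longrightarrow> form sg (b - g *v b) u = 0"
proof -
  have "b \<noteq> 0" using b(2) by auto
  then show "form sg b b \<noteq> 0" using aniso b(1) by blast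
  show w: "b - g *v b \<in> perp S" using g(2) by (intro isom_diff_perp[OF g(1)]) blast
  show w0: "b - g *v b \<noteq> 0" using b(2) by simp
  have "form sg (b - g *v b) (b - g *v b) \<noteq> 0" using aniso w w0 by blast
  moreover have "form sg (b - g *v b) (b - g *v b) = 2 * (form sg b b - form sg b (g *v b))"
    using form_star[of sg b "g *v b"] by (simp add: form_linear form_isom[OF g(1)])
  ultimately show "form sg b b - form sg b (g *v b) \<noteq> 0" by auto
  show "form sg (b - g *v b) u = 0" if "u \<in> S" for u
    using w that form_commute_0 by (auto simp: perp_def)
qed

text \<open>The parity statement behind the Cartan-Dieudonne theorem. A descent lowers the dimension
  of \<open>perp S\<close> by exactly one, flips the determinant, and creates no fixed vector in the
  smaller complement.\<close>

lemma det_no_fixed_vector: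
  fixes g :: "real ^ 'n ^ 'n"
  assumes "\<And>x. x \<in> perp S \<Longrightarrow> x \<noteq> 0 \<Longrightarrow> form sg x x \<noteq> 0"
    and "g \<in> isoms sg" "\<And>u. u \<in> S \<Longrightarrow> g *v u = u" "\<And>x. x \<in> perp S \<Longrightarrow> g *v x = x \<Longrightarrow> x = 0"
  shows "Determinants.det g = (-1) ^ vec.dim (perp S)"
  using assms
proof (induction "vec.dim (perp S)" arbitrary: S g rule: less_induct)
  case less
  note aniso = less.prems(1) and g = less.prems(2,3) and nf = less.prems(4)
  have z0: "0 \<in> perp S" by (simp add: perp_def form_def)
  show ?case
  proof (cases "perp S = {0}")
    case True
    have "g = mone" by (rule perp_0_imp_one[OF g True])
    moreover have d0: "vec.dim (perp S) = 0" unfolding True by simp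
    ultimately show ?thesis unfolding d0 by (simp add: Determinants.det_I)
  next
    case False
    then obtain b where b: "b \<in> perp S" "b \<noteq> 0" using z0 by blast
    then have gb: "g *v b \<noteq> b" using nf by blast
    have ao: "\<forall>x\<in>perp S. x \<noteq> 0 \<longrightarrow> form sg x x \<noteq> 0" and go: "\<forall>u\<in>S. g *v u = u"
      using aniso g(2) by blast+
    note A = real_descent_aniso[OF ao g(1) go b(1) gb]
    note D = real_descent[OF g(1) A(1,2)]
    define w where "w = b - g *v b"
    define z where "z = form sg b b - form sg b (g *v b)"
    note D = D[folded z_def, folded w_def] and A = A[folded z_def, folded w_def]
    let ?h = "quasi_refl sg w z ** g"
    have hf: "?h *v u = u" if "u \<in> insert b S" for u
    proof (cases "u = b")
      case True
      then show ?thesis using D(2) by simp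
    next
      case False
      then have "u \<in> S" using that by simp
      then show ?thesis by (intro D(3) g(2) A(5))
    qed
    have dim: "vec.dim (perp S) = Suc (vec.dim (perp (insert b S)))" by (rule dim_perp_insert[OF b(1) A(1)])
    \<comment> \<open>A vector \<open>x\<close> fixed by the descended map satisfies
      \<open>g *v x = x - c *s w\<close>; as \<open>w\<close> is \<open>b - g *v b\<close>, the
      vector \<open>x - c *s b\<close> is fixed by \<open>g\<close>.\<close>
    have nf': "x = 0" if x: "x \<in> perp (insert b S)" "?h *v x = x" for x
    proof -
      define c where "c = form sg w x / z"
      have "g *v x = quasi_refl sg w z *v (?h *v x)" using D(6) by (metis matrix_vector_mul_assoc)
      then have gx: "g *v x = x - c *s w" unfolding x(2) by (simp add: quasi_refl_vec c_def)
      have "g *v (x - c *s b) = x - c *s b"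
        unfolding matrix_vector_mult_diff_distrib vector_scalar_commute gx
        by (simp add: w_def cart_eq_iff algebra_simps)
      moreover have "x - c *s b \<in> perp S" using x(1) b(1) by (simp add: perp_insert perp_def form_linear)
      ultimately have "x - c *s b = 0" using nf by blast
      then have xc: "x = c *s b" by simp
      have "form sg b x = 0" using x(1) by (simp add: perp_insert)
      then have "c = 0" using A(1) by (simp add: xc form_linear)
      then show ?thesis using xc by simp
    qed
    have "Determinants.det ?h = (-1) ^ vec.dim (perp (insert b S))"
    proof (rule less.hyps[OF _ _ D(1) hf nf'])
      show "vec.dim (perp (insert b S)) < vec.dim (perp S)" using dim by simp
      show "form sg x x \<noteq> 0" if "x \<in> perp (insert b S)" "x \<noteq> 0" for x
        using aniso that by (simp add: perp_insert)
    qed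
    then show ?thesis using D(5) dim by simp
  qed
qed

text \<open>Closed form, for signs \<open>s\<close>, of the recursion
  \<open>rev_det (Suc d) s = rev_det d (- s) * (- s)\<close> with start
  \<open>rev_det 0 s = s\<close>. One descent multiplies the reversal by a map of determinant
  \<open>- s\<close>.\<close>

definition rev_det :: "nat \<Rightarrow> real \<Rightarrow> real" where
  "rev_det d s = (-1) ^ (d div 2) * (if even d then s else 1)"

lemma rev_det_Suc:
  assumes "s = 1 \<or> s = -1" shows "rev_det d (- s) * (- s) = rev_det (Suc d) s"
  using assms by (cases "even d") (auto simp: rev_det_def elim!: evenE oddE)

lemma det_cases: "g \<in> isoms sg \<Longrightarrow> Determinants.det g = 1 \<or> Determinants.det g = (-1 :: real)"
  using norm_det_isom[of g] by auto

text \<open>The values at \<open>Suc d\<close> and \<open>d\<close> differ only if \<open>s\<close>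
  is not the parity sign of \<open>d\<close>. By \<open>det_no_fixed_vector\<close>,
  \<open>g\<close> then fixes a nonzero \<open>x\<close> in \<open>perp S\<close>; the reflection in
  \<open>x\<close> commutes with \<open>g\<close>, and composing with it corrects the determinant of
  a reversal.\<close>

lemma reversal_det_flip:
  fixes g :: "real ^ 'n ^ 'n"
  assumes aniso: "\<And>x. x \<in> perp S \<Longrightarrow> x \<noteq> 0 \<Longrightarrow> form sg x x \<noteq> 0"
    and g: "g \<in> isoms sg" "\<And>u. u \<in> S \<Longrightarrow> g *v u = u"
    and claim: "\<And>v. v \<in> perp S \<Longrightarrow> v \<noteq> 0 \<Longrightarrow> \<exists>M\<in>isoms sg. reverses M g \<and> (\<forall>u\<in>insert v S. M *v u = u) \<and>
       Determinants.det M = rev_det (vec.dim (perp S)) (Determinants.det g)"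
  shows "\<exists>M\<in>isoms sg. reverses M g \<and> (\<forall>u\<in>S. M *v u = u) \<and>
       Determinants.det M = rev_det (Suc (vec.dim (perp S))) (Determinants.det g)"
proof -
  let ?d = "vec.dim (perp S)" and ?s = "Determinants.det g"
  have z0: "0 \<in> perp S" by (simp add: perp_def form_def)
  have s: "?s = 1 \<or> ?s = -1" by (rule det_cases[OF g(1)])
  show ?thesis
  proof (cases "perp S = {0}")
    case True
    have "g = mone" by (rule perp_0_imp_one[OF g True])
    then show ?thesis using True
      by (intro bexI[of _ mone]) (auto simp: reverses_def Determinants.det_I rev_det_def)
  next
    case False
    then obtain a where a: "a \<in> perp S" "a \<noteq> 0" using z0 by blast
    show ?thesis
    proof (cases "\<exists>x\<in>perp S. g *v x = x \<and> x \<noteq> 0")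
      case False
      then have "?s = (-1) ^ ?d" by (intro det_no_fixed_vector[OF aniso g]) auto
      then have "rev_det (Suc ?d) ?s = rev_det ?d ?s"
        by (cases "even ?d") (auto simp: rev_det_def elim!: evenE oddE)
      then show ?thesis using claim[OF a] by auto
    next
      case True
      then obtain x where x: "x \<in> perp S" "g *v x = x" "x \<noteq> 0" by blast
      obtain M where M: "M \<in> isoms sg" "reverses M g" "\<And>u. u \<in> insert x S \<Longrightarrow> M *v u = u"
        "Determinants.det M = rev_det ?d ?s" using claim[OF x(1,3)] by blast
      show ?thesis
      proof (cases "rev_det (Suc ?d) ?s = rev_det ?d ?s")
        case True
        then show ?thesis using M by auto
      next
        case False
        then have neg: "rev_det (Suc ?d) ?s = - rev_det ?d ?s"
          using s by (cases "even ?d") (auto simp: rev_det_def elim!: evenE oddE)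
        have fx: "form sg x x \<noteq> 0" using aniso x by blast
        let ?R = "quasi_refl sg x (form sg x x / 2)"
        have R: "?R \<in> isoms sg" using fx by (intro quasi_refl_isom) auto
        have comm: "g ** ?R = ?R ** g"
        proof (unfold matrix_eq, intro allI)
          fix y
          have "form sg x (g *v y) = form sg x y" using form_isom[OF g(1), of x y] x(2) by simp
          then show "(g ** ?R) *v y = (?R ** g) *v y"
            by (simp add: quasi_refl_vec matrix_vector_mult_diff_distrib vector_scalar_commute x(2) flip: matrix_vector_mul_assoc)
        qed
        have "g ** (M ** ?R) ** g = g ** M ** (?R ** g)" by (simp add: matrix_mul_assoc)
        also have "\<dots> = (g ** M ** g) ** ?R" unfolding comm[symmetric] by (simp add: matrix_mul_assoc)
        also have "\<dots> = M ** ?R" using M(2) by (simp add: reverses_def)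
        finally have "reverses (M ** ?R) g" by (simp add: reverses_def)
        moreover have "(M ** ?R) *v u = u" if "u \<in> S" for u
        proof -
          have "form sg x u = 0" using x(1) that form_commute_0 by (auto simp: perp_def)
          then show ?thesis using M(3) that by (simp add: quasi_refl_vec flip: matrix_vector_mul_assoc)
        qed
        moreover have "Determinants.det (M ** ?R) = rev_det (Suc ?d) ?s"
          using fx M(4) neg by (simp add: Determinants.det_mul det_quasi_refl)
        ultimately show ?thesis using isoms_mul[OF M(1) R] by blast
      qed
    qed
  qed
qed

text \<open>The induction of \<open>reversal_ex\<close> with the determinant tracked. If
  \<open>g\<close> fixes \<open>v\<close>, the dimension drops without a descent and
  \<open>reversal_det_flip\<close> makes up for it; otherwise the descent changes the determinant as
  in \<open>rev_det_Suc\<close>. A nonzero \<open>v\<close> is what makes the dimension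
  drop.\<close>

lemma reversal_det_ex:
  fixes g :: "real ^ 'n ^ 'n"
  assumes "\<And>x. x \<in> perp S \<Longrightarrow> x \<noteq> 0 \<Longrightarrow> form sg x x \<noteq> 0"
    and "g \<in> isoms sg" "\<And>u. u \<in> S \<Longrightarrow> g *v u = u" "v \<in> perp S" "v \<noteq> 0"
  shows "\<exists>M\<in>isoms sg. reverses M g \<and> (\<forall>u\<in>insert v S. M *v u = u) \<and>
    Determinants.det M = rev_det (vec.dim (perp S)) (Determinants.det g)"
  using assms
proof (induction "vec.dim (perp S)" arbitrary: S g v rule: less_induct)
  case less
  note aniso = less.prems(1) and g = less.prems(2,3) and v = less.prems(4,5)
  have fv: "form sg v v \<noteq> 0" using aniso v by blast
  let ?S = "insert v S" and ?s = "Determinants.det g"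
  have dim: "vec.dim (perp S) = Suc (vec.dim (perp ?S))" by (rule dim_perp_insert[OF v(1) fv])
  then have lt: "vec.dim (perp ?S) < vec.dim (perp S)" by simp
  have aniso': "form sg x x \<noteq> 0" if "x \<in> perp ?S" "x \<noteq> 0" for x using aniso that by (simp add: perp_insert)
  show ?case
  proof (cases "g *v v = v")
    case True
    then have gf: "g *v u = u" if "u \<in> ?S" for u using that g(2) by auto
    have "\<exists>M\<in>isoms sg. reverses M g \<and> (\<forall>u\<in>?S. M *v u = u) \<and>
       Determinants.det M = rev_det (Suc (vec.dim (perp ?S))) ?s"
      using less.hyps[OF lt aniso' g(1) gf] by (intro reversal_det_flip[OF aniso' g(1) gf]) blast+
    then show ?thesis unfolding dim .
  next
    case False
    have ao: "\<forall>x\<in>perp S. x \<noteq> 0 \<longrightarrow> form sg x x \<noteq> 0" and go: "\<forall>u\<in>S. g *v u = u"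
      using aniso g(2) by blast+
    note A = real_descent_aniso[OF ao g(1) go v(1) False]
    note D = real_descent[OF g(1) A(1,2)]
    define w where "w = v - g *v v"
    define z where "z = form sg v v - form sg v (g *v v)"
    note D = D[folded z_def, folded w_def] and A = A[folded z_def, folded w_def]
    let ?h = "quasi_refl sg w z ** g"
    define c where "c = z / form sg v v"
    have hf: "?h *v u = u" if "u \<in> ?S" for u
    proof (cases "u = v")
      case True
      then show ?thesis using D(2) by simp
    next
      case False
      then have "u \<in> S" using that by simp
      then show ?thesis by (intro D(3) g(2) A(5))
    qed
    have wp: "w - c *s v \<in> perp ?S"
      using D(7) A(3) v(1) by (simp add: c_def perp_insert perp_def form_linear)
    have fin: ?thesis if M: "M \<in> isoms sg" "reverses M ?h" "\<And>u. u \<in> ?S \<Longrightarrow> M *v u = u" "M *v w = w"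
      "Determinants.det M = rev_det (vec.dim (perp ?S)) (- ?s)" for M
    proof (intro bexI[of _ "M ** ?h"] conjI ballI)
      show "M ** ?h \<in> isoms sg" by (intro isoms_mul M D(1))
      show "reverses (M ** ?h) g" by (intro D(8) M) auto
      show "(M ** ?h) *v u = u" if "u \<in> ?S" for u by (rule D(9)[OF M(3) hf]) (rule that)+
      have "Determinants.det (M ** ?h) = rev_det (vec.dim (perp ?S)) (- ?s) * (- ?s)"
        using M(5) D(5) by (simp add: Determinants.det_mul)
      then show "Determinants.det (M ** ?h) = rev_det (vec.dim (perp S)) ?s"
        unfolding dim rev_det_Suc[OF det_cases[OF g(1)]] .
    qed
    have ex: ?thesis if x: "x \<in> perp ?S" "x \<noteq> 0" and xw: "w - c *s v = 0 \<or> x = w - c *s v" for x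
    proof -
      obtain M where M: "M \<in> isoms sg" "reverses M ?h" "\<And>u. u \<in> insert x ?S \<Longrightarrow> M *v u = u"
        "Determinants.det M = rev_det (vec.dim (perp ?S)) (Determinants.det ?h)"
        using less.hyps[OF lt aniso' D(1) hf x] by blast
      have "M *v (w - c *s v) = w - c *s v" using xw M(3)[of x] by auto
      then have "M *v w = w"
        using M(3)[of v] by (simp add: matrix_vector_mult_diff_distrib vector_scalar_commute)
      then show ?thesis using fin[of M] M D(5) by auto
    qed
    show ?thesis
    proof (cases "w - c *s v = 0")
      case False
      then show ?thesis using ex wp by blast
    next
      case w0: True
      show ?thesis
      proof (cases "perp ?S = {0}")
        case False
        moreover have "0 \<in> perp ?S" by (simp add: perp_def form_def)
        ultimately show ?thesis using ex w0 by blast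
      next
        case True
        \<comment> \<open>No room is left for a further nonzero vector; here \<open>g\<close> is the
          reflection itself, and the identity reverses the descended map with
          \<open>rev_det 0 1 = 1\<close>.\<close>
        have h1: "?h = mone" by (rule perp_0_imp_one[OF D(1) hf True])
        then have "?s = -1" using D(5) by (simp add: Determinants.det_I)
        then show ?thesis using True h1 by (intro fin[of mone]) (auto simp: reverses_def Determinants.det_I rev_det_def)
      qed
    qed
  qed
qed

end

subsection \<open>The identity component\<close>

lemma SO_eq: "(SO :: (real ^ ('p::finite + 'q::finite) ^ ('p + 'q)) set) = {A \<in> isoms sig. Determinants.det A = 1}"
proof -
  have "adj A = Finite_Cartesian_Product.transpose A" for A :: "real ^ ('p + 'q) ^ ('p + 'q)"
    by (simp add: cart_eq_iff Finite_Cartesian_Product.transpose_def)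
  then show ?thesis by (simp add: SO_def isoms_def signature_form_eq)
qed

lemma mone_SO: "mone \<in> SO"
  by (simp add: SO_eq Determinants.det_I)

lemma closed_SO: "closed (SO :: (real ^ ('p::finite + 'q::finite) ^ ('p + 'q)) set)"
proof -
  have "SO = isoms sig \<inter> {A :: real ^ ('p + 'q) ^ ('p + 'q). Determinants.det A = 1}" by (auto simp: SO_eq)
  moreover have "closed {A :: real ^ ('p + 'q) ^ ('p + 'q). Determinants.det A = 1}"
    unfolding Determinants.det_def by (intro closed_Collect_eq continuous_intros)
  ultimately show ?thesis using closed_Int[OF closed_isoms] by metis
qed

lemma SO0_subset: "SO0 \<subseteq> SO"
  unfolding SO0_def by (rule connected_component_subset)

lemma SO0_isoms: "g \<in> SO0 \<Longrightarrow> g \<in> isoms sig" "g \<in> SO0 \<Longrightarrow> Determinants.det g = 1"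
  using SO0_subset by (auto simp: SO_eq)

lemma mone_SO0: "mone \<in> SO0"
  unfolding SO0_def using mone_SO by (simp add: connected_component_refl)

lemma connected_SO0: "connected SO0"
  unfolding SO0_def by (rule connected_connected_component)

lemma closed_SO0: "closed SO0"
  unfolding SO0_def by (rule closed_connected_component[OF closed_SO])

lemma SO0I:
  assumes "connected T" "T \<subseteq> SO" "a \<in> T" "a \<in> SO0" "x \<in> T"
  shows "x \<in> SO0"
proof -
  have "connected_component_set SO a = SO0"
    using assms(4) unfolding SO0_def using connected_component_eq by blast
  then show ?thesis using connected_component_maximal[OF assms(3,1,2)] assms(5) by blast
qed

lemma SO0_image:
  assumes "continuous_on UNIV f" "\<And>g. g \<in> SO \<Longrightarrow> f g \<in> SO" "f mone \<in> SO0" "g \<in> SO0"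
  shows "f g \<in> SO0"
proof (rule SO0I[of "f ` SO0" "f mone"])
  show "connected (f ` SO0)"
    by (rule connected_continuous_image[OF continuous_on_subset[OF assms(1)] connected_SO0]) simp
qed (use assms SO0_subset mone_SO0 in auto)

lemma SO_mul: "g \<in> SO \<Longrightarrow> h \<in> SO \<Longrightarrow> g ** h \<in> SO"
  by (simp add: SO_eq isoms_mul Determinants.det_mul)

lemma SO0_mul: assumes "g \<in> SO0" "h \<in> SO0" shows "g ** h \<in> SO0"
proof (rule SO0_image[where f = "\<lambda>x. g ** x", OF _ _ _ assms(2)])
  show "g ** x \<in> SO" if "x \<in> SO" for x using SO_mul[OF subsetD[OF SO0_subset assms(1)] that] .
  show "g ** mone \<in> SO0" using assms(1) by simp
qed (intro continuous_intros)

lemma SO0_inv_bar: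
  fixes g :: "real ^ ('p::finite + 'q::finite) ^ ('p + 'q)"
  assumes "g \<in> SO0" shows "sig.inv_bar g \<in> SO0"
proof (rule SO0_image[OF sig.continuous_on_inv_bar _ _ assms])
  show "sig.inv_bar h \<in> SO" if "h \<in> SO" for h :: "real ^ ('p + 'q) ^ ('p + 'q)"
    using that by (simp add: SO_eq sig.inv_bar_isoms sig.det_inv_bar)
  have "sig.inv_bar mone = matrix_inv (mone :: real ^ ('p + 'q) ^ ('p + 'q))" by (simp add: sig.inv_bar_eq)
  also have "\<dots> = mone" by (rule matrix_inv_eqI) simp_all
  finally show "sig.inv_bar mone \<in> (SO0 :: (real ^ ('p + 'q) ^ ('p + 'q)) set)" using mone_SO0 by simp
qed

lemma inv_bar_real: "g \<in> isoms sig \<Longrightarrow> sig.inv_bar g = matrix_inv (g :: real ^ ('p::finite + 'q::finite) ^ ('p + 'q))"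
  by (simp add: sig.inv_bar_eq)

lemma SO0_inv: "g \<in> SO0 \<Longrightarrow> matrix_inv g \<in> SO0"
  using SO0_inv_bar inv_bar_real SO0_isoms(1) by metis

text \<open>Conjugation is continuous and fixes the identity, so it preserves the identity component
  even when \<open>h\<close> lies outside it.\<close>

lemma SO0_conj:
  fixes g :: "real ^ ('p::finite + 'q::finite) ^ ('p + 'q)"
  assumes h: "h \<in> isoms sig" and g: "g \<in> SO0" shows "h ** g ** matrix_inv h \<in> SO0"
proof (rule SO0_image[where f = "\<lambda>g. h ** g ** matrix_inv h", OF _ _ _ g])
  show "h ** g ** matrix_inv h \<in> SO" if "g \<in> SO" for g :: "real ^ ('p + 'q) ^ ('p + 'q)"
    using that h sig.det_isom_nonzero(2)[OF h] sig.isoms_inv(4)[OF h]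
    by (auto simp: SO_eq Determinants.det_mul mult.commute intro!: isoms_mul)
  show "h ** mone ** matrix_inv h \<in> SO0" using mone_SO0 by (simp add: sig.isoms_inv(2)[OF h])
qed (intro continuous_intros)

text \<open>The twist by the involution \<open>e\<close> serves reversing isometries
  \<open>M\<close> outside the identity component: \<open>e ** M\<close> may lie inside and then
  conjugates \<open>g\<close> to its image under the twisted anti-involution.\<close>

theorem SO0_multiplicity_freeI:
  fixes \<pi> :: "real ^ ('p::finite + 'q::finite) ^ ('p + 'q) \<Rightarrow> 'v::complex_hilbert_space \<Rightarrow> 'v"
    and e :: "real ^ ('p + 'q) ^ ('p + 'q)"
  assumes K: "maximal_compact_subgroup SO0 K" "irreducible_hilbert_representation SO0 \<pi>" "admissible K \<pi>"
    and e: "e \<in> isoms sig" "e ** e = mone"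
    and conj: "\<And>g. g \<in> SO0 \<Longrightarrow> \<exists>k\<in>SO0. k ** diag_form sig = diag_form sig ** k \<and> k ** g = e ** sig.inv_bar g ** e ** k"
  shows "multiplicity_free K \<pi>"
proof (rule sig.multiplicity_free_of_anti_involution[where \<theta> = "\<lambda>g. e ** sig.inv_bar g ** e", OF _ _ _ _ _ _ _ _ _ _ conj K])
  have ie: "matrix_inv e = e" by (rule matrix_inv_eqI[OF e(2,2)])
  have be: "sig.inv_bar e = e" using inv_bar_real[OF e(1)] ie by simp
  have ee: "e ** (e ** A) = A" "A ** e ** e = A" for A
    using e(2) by (simp_all add: matrix_mul_assoc) (simp flip: matrix_mul_assoc)
  show "SO0 \<subseteq> isoms sig" using SO0_isoms by blast
  show "closed (SO0 :: (real ^ ('p + 'q) ^ ('p + 'q)) set)" by (rule closed_SO0)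
  show "e ** sig.inv_bar (g ** h) ** e = e ** sig.inv_bar h ** e ** (e ** sig.inv_bar g ** e)" for g h
    by (simp add: sig.inv_bar_mul matrix_mul_assoc ee)
  show "e ** sig.inv_bar g ** e \<in> SO0" if "g \<in> SO0" for g
    using SO0_conj[OF e(1) SO0_inv_bar[OF that]] ie by simp
  show "e ** sig.inv_bar (e ** sig.inv_bar g ** e) ** e = g" for g
    by (simp add: sig.inv_bar_mul be matrix_mul_assoc ee e(2))
  show "continuous_on UNIV (\<lambda>g. e ** sig.inv_bar g ** e)"
    by (intro continuous_intros sig.continuous_on_inv_bar)
qed (use SO0_mul SO0_inv SO0_conj mone_SO0 in auto)

subsection \<open>The rotations fixing the pole\<close>

definition reflection :: "real ^ ('p::finite + 'q::finite) \<Rightarrow> real ^ ('p + 'q) ^ ('p + 'q)" where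
  "reflection u = quasi_refl sig u (form sig u u / 2)"

lemma reflection_props:
  assumes "form sig u u \<noteq> 0"
  shows "reflection u \<in> isoms sig" "Determinants.det (reflection u) = -1" "reflection u ** reflection u = mone"
  unfolding reflection_def using assms
  by (auto intro!: quasi_refl_isom sig.quasi_refl_involution simp: det_quasi_refl)

lemma reflection_uminus: "reflection (- u) = reflection u"
proof -
  have "form sig (- u) (- u) = form sig u u" by (simp add: form_def)
  then show ?thesis by (simp add: reflection_def quasi_refl_def)
qed

lemma perp_pole_pos:
  fixes x :: "real ^ ('p::finite + 1)"
  assumes "x \<in> sig.perp {pole}" "x \<noteq> 0" shows "form sig x x > 0"
  using pole_aniso[OF assms] by auto

text \<open>Moving one vector to the other along a segment of nonzero vectors orthogonal to the pole
  deforms the product to the square of a reflection, the identity.\<close>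

lemma reflection_mul_SO0:
  fixes u v :: "real ^ ('p::finite + 1)"
  assumes u: "u \<in> sig.perp {pole}" "u \<noteq> 0" and v: "v \<in> sig.perp {pole}" "v \<noteq> 0"
  shows "reflection u ** reflection v \<in> SO0"
proof -
  \<comment> \<open>The sign, which does not change the reflection, keeps the segment away from the
    origin.\<close>
  define v' where "v' = (if inner u v \<ge> 0 then v else - v)"
  have v': "reflection v' = reflection v" "inner u v' \<ge> 0" "v' \<noteq> 0" "v' \<in> sig.perp {pole}"
    using v by (auto simp: v'_def reflection_uminus sig.perp_def form_def sum_negf)
  have seg: "x \<in> sig.perp {pole} \<and> x \<noteq> 0" if xs: "x \<in> closed_segment v' u" for x
  proof -
    obtain t where t: "0 \<le> t" "t \<le> 1" "x = (1 - t) *\<^sub>R v' + t *\<^sub>R u"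
      using xs by (auto simp: closed_segment_def)
    have "x = (1 - t) *s v' + t *s u" using t(3) by (simp add: cart_eq_iff algebra_simps)
    then have "x \<in> sig.perp {pole}" using u(1) v'(4) by (simp add: sig.perp_def form_linear)
    moreover have "x \<noteq> 0"
    proof (cases "t = 0")
      case False
      have "inner u x = (1 - t) * inner u v' + t * inner u u" by (simp add: t(3) inner_add_right)
      moreover have "t * inner u u > 0" using False t(1) u(2) by simp
      moreover have "(1 - t) * inner u v' \<ge> 0" using t(2) v'(2) by simp
      ultimately show ?thesis by auto
    qed (use t(3) v'(3) in simp)
    ultimately show ?thesis by blast
  qed
  have nz: "form sig x x \<noteq> 0" if "x \<in> closed_segment v' u" for x
    using perp_pole_pos seg[OF that] by force
  let ?T = "(\<lambda>x. reflection x ** reflection v') ` closed_segment v' u"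
  have "reflection u ** reflection v' \<in> SO0"
  proof (rule SO0I[of ?T mone])
    have "continuous_on (closed_segment v' u) (\<lambda>x. reflection x ** reflection v')"
      unfolding reflection_def quasi_refl_def form_def[abs_def]
      by (intro continuous_intros) (use nz in \<open>auto simp: form_def\<close>)
    then show "connected ?T" by (intro connected_continuous_image) auto
    show "?T \<subseteq> SO"
      using reflection_props nz by (auto simp: SO_eq Determinants.det_mul intro!: isoms_mul)
    have "reflection v' ** reflection v' = mone" using nz reflection_props(3) by auto
    then show "mone \<in> ?T" by (intro image_eqI[of _ _ v']) auto
  qed (auto simp: mone_SO0)
  then show ?thesis using v'(1) by simp
qed

text \<open>Connectedness of SO(p) as the stabilizer of the pole. Determinant -1 is carried along in
  the induction, relative to the fixed reflection in \<open>a\<close>, because each descent changes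
  the sign; products of two reflections are handled by \<open>reflection_mul_SO0\<close>.\<close>

lemma isotropy_SO0:
  fixes g :: "real ^ ('p::finite + 1) ^ ('p + 1)"
  assumes a: "a \<in> sig.perp {pole}" "a \<noteq> 0"
    and "pole \<in> S" "g \<in> isoms sig" "\<And>u. u \<in> S \<Longrightarrow> g *v u = u"
  shows "(Determinants.det g = 1 \<longrightarrow> g \<in> SO0) \<and> (Determinants.det g = -1 \<longrightarrow> reflection a ** g \<in> SO0)"
  using assms(3-)
proof (induction "vec.dim (sig.perp S)" arbitrary: S g rule: less_induct)
  case less
  note p = less.prems(1) and g = less.prems(2,3)
  have sub: "sig.perp S \<subseteq> sig.perp {pole}" using p by (auto simp: sig.perp_def)
  have pos: "form sig x x > 0" if "x \<in> sig.perp S" "x \<noteq> 0" for x using perp_pole_pos sub that by blast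
  then have aniso: "form sig x x \<noteq> 0" if "x \<in> sig.perp S" "x \<noteq> 0" for x using that by force
  have z0: "0 \<in> sig.perp S" by (simp add: sig.perp_def form_def)
  show ?case
  proof (cases "sig.perp S = {0}")
    case True
    have "g = mone" by (rule sig.perp_0_imp_one[OF g True])
    then show ?thesis by (simp add: mone_SO0 Determinants.det_I)
  next
    case False
    then obtain b where b: "b \<in> sig.perp S" "b \<noteq> 0" using z0 by blast
    have fb: "form sig b b \<noteq> 0" using aniso b by blast
    have lt: "vec.dim (sig.perp (insert b S)) < vec.dim (sig.perp S)" by (rule sig.dim_perp_insert_less[OF b(1) fb])
    show ?thesis
    proof (cases "g *v b = b")
      case True
      then show ?thesis using less.hyps[OF lt _ g(1)] g(2) p by auto
    next
      case False
      have ao: "\<forall>x\<in>sig.perp S. x \<noteq> 0 \<longrightarrow> form sig x x \<noteq> 0" and go: "\<forall>u\<in>S. g *v u = u"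
        using aniso g(2) by blast+
      note A = sig.real_descent_aniso[OF ao g(1) go b(1) False]
      note D = sig.real_descent[OF g(1) A(1,2)]
      define w where "w = b - g *v b"
      define z where "z = form sig b b - form sig b (g *v b)"
      note D = D[folded z_def, folded w_def] and A = A[folded z_def, folded w_def]
      let ?h = "quasi_refl sig w z ** g"
      have hf: "?h *v u = u" if "u \<in> insert b S" for u
    proof (cases "u = b")
      case True
      then show ?thesis using D(2) by simp
    next
      case False
      then have "u \<in> S" using that by simp
      then show ?thesis by (intro D(3) g(2) A(5))
    qed
      have R: "quasi_refl sig w z = reflection w" using D(4) by (simp add: reflection_def)
      have w: "w \<in> sig.perp {pole}" "w \<noteq> 0" using A(3,4) sub by auto
      have IH: "(Determinants.det ?h = 1 \<longrightarrow> ?h \<in> SO0) \<and> (Determinants.det ?h = -1 \<longrightarrow> reflection a ** ?h \<in> SO0)"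
        using less.hyps[OF lt _ D(1) hf] p by auto
      have aa: "reflection a ** reflection a = mone" using perp_pole_pos[OF a] by (intro reflection_props) simp
      show ?thesis
      proof (intro conjI impI)
        assume "Determinants.det g = 1"
        then have rah: "reflection a ** ?h \<in> SO0" using IH D(5) by simp
        have "reflection w ** reflection a ** (reflection a ** ?h) \<in> SO0" by (rule SO0_mul[OF reflection_mul_SO0[OF w a] rah])
        also have "reflection w ** reflection a ** (reflection a ** ?h) = reflection w ** (reflection a ** reflection a) ** ?h"
          by (simp only: matrix_mul_assoc)
        also have "\<dots> = g" using D(6) by (simp add: aa R)
        finally show "g \<in> SO0" .
      next
        assume "Determinants.det g = -1"
        then have rah: "?h \<in> SO0" using IH D(5) by simp
        have "reflection a ** reflection w ** ?h \<in> SO0" by (rule SO0_mul[OF reflection_mul_SO0[OF a w] rah])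
        also have "reflection a ** reflection w ** ?h = reflection a ** g" using D(6) by (simp add: R flip: matrix_mul_assoc)
        finally show "reflection a ** g \<in> SO0" .
      qed
    qed
  qed
qed

text \<open>The entry has absolute value at least one for every isometry, so on a connected set
  containing the identity it cannot change sign.\<close>

lemma SO0_pole_entry:
  fixes g :: "real ^ ('p::finite + 1) ^ ('p + 1)"
  assumes "g \<in> SO0" shows "g $ Inr 1 $ Inr 1 \<ge> 1"
proof (rule ccontr)
  assume "\<not> ?thesis"
  then have neg: "g $ Inr 1 $ Inr 1 < 0" using norm_pole_entry(1)[OF SO0_isoms(1)[OF assms]] by auto
  let ?f = "\<lambda>g :: real ^ ('p + 1) ^ ('p + 1). g $ Inr 1 $ Inr 1"
  have "connected (?f ` SO0)" by (intro connected_continuous_image connected_SO0 continuous_intros)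
  moreover have "?f g \<in> ?f ` SO0" using assms by blast
  moreover have "1 \<in> ?f ` SO0"
    using mone_SO0 by (intro image_eqI[of _ _ mone]) (simp_all add: Finite_Cartesian_Product.mat_def)
  ultimately have "0 \<in> ?f ` SO0" using neg by (meson connectedD_interval less_imp_le zero_le_one)
  then obtain x :: "real ^ ('p + 1) ^ ('p + 1)" where "x \<in> SO0" "x $ Inr 1 $ Inr 1 = 0" by auto
  then show False using norm_pole_entry(1)[OF SO0_isoms(1), of x] by simp
qed

text \<open>The point is that the determinant does not depend on \<open>g\<close>, so that one twist
  \<open>e\<close> serves the whole group.\<close>

lemma SO0_reversal_det:
  fixes g :: "real ^ ('p::finite + 1) ^ ('p + 1)"
  assumes g: "g \<in> SO0"
  shows "\<exists>M\<in>isoms sig. reverses M g \<and> M *v pole = pole \<and>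
    Determinants.det M = sig.rev_det (Suc (vec.dim (sig.perp {pole :: real ^ ('p + 1)}))) 1"
proof -
  let ?d = "vec.dim (sig.perp {pole :: real ^ ('p + 1)})"
  have gI: "g \<in> isoms sig" and dg: "Determinants.det g = 1" using SO0_isoms g by auto
  have aniso: "form sig x x \<noteq> 0" if "x \<in> sig.perp {pole}" "x \<noteq> 0" for x :: "real ^ ('p + 1)"
    using perp_pole_pos[OF that] by simp
  show ?thesis
  proof (cases "g *v pole = pole")
    case True
    then have gf: "g *v u = u" if "u \<in> {pole}" for u using that by simp
    have "\<exists>M\<in>isoms sig. reverses M g \<and> (\<forall>u\<in>{pole}. M *v u = u) \<and> Determinants.det M = sig.rev_det (Suc ?d) (Determinants.det g)"
      by (intro sig.reversal_det_flip[OF aniso gI gf] sig.reversal_det_ex[OF aniso gI gf])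
    then show ?thesis by (auto simp: dg)
  next
    case False
    define w where "w = pole - g *v pole"
    define z where "z = form sig pole (pole :: real ^ ('p + 1)) - form sig pole (g *v pole)"
    have pp: "form sig pole (pole :: real ^ ('p + 1)) = -1" unfolding form_pole by (simp add: axis_def)
    have zeq: "z = g $ Inr 1 $ Inr 1 - 1"
      unfolding z_def pp unfolding form_pole matrix_vec_axis column_def by simp
    have g1: "g $ Inr 1 $ Inr 1 \<noteq> 1" using False norm_pole_entry(2)[OF gI] by auto
    then have z0: "z \<noteq> 0" using zeq by simp
    have pp0: "form sig pole (pole :: real ^ ('p + 1)) \<noteq> 0" using pp by simp
    note D = sig.real_descent[OF gI pp0 z0[unfolded z_def], folded z_def, folded w_def]
    let ?h = "quasi_refl sig w z ** g"
    define x where "x = w - (z / form sig pole (pole :: real ^ ('p + 1))) *s pole"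
    have xp: "x \<in> sig.perp {pole}" using D(7) by (simp add: x_def sig.perp_def)
    have hf: "?h *v u = u" if "u \<in> {pole}" for u using that D(2) by simp
    \<comment> \<open>\<open>reversal_det_ex\<close> needs a nonzero vector. If \<open>x\<close>
      vanished, \<open>g\<close> would map the pole to a multiple of itself by 1 or -1,
      contradicting that its pole entry is at least one and different from one.\<close>
    have "x \<noteq> 0"
    proof
      assume "x = 0"
      then have "g *v pole = (g $ Inr 1 $ Inr 1) *s pole"
        unfolding x_def w_def pp zeq by (simp add: cart_eq_iff algebra_simps)
      then have "form sig (g *v pole) (g *v pole) = (g $ Inr 1 $ Inr 1) * (g $ Inr 1 $ Inr 1) * form sig pole (pole :: real ^ ('p + 1))"
        by (simp add: form_linear)
      then have "(g $ Inr 1 $ Inr 1) * (g $ Inr 1 $ Inr 1) = 1" unfolding form_isom[OF gI] pp by simp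
      then show False using SO0_pole_entry[OF g] g1 by (metis abs_of_nonneg abs_square_eq_1 order_trans power2_eq_square zero_le_one)
    qed
    from sig.reversal_det_ex[OF aniso D(1) hf xp this]
    obtain M where M: "M \<in> isoms sig" "reverses M ?h" "M *v x = x" "M *v pole = pole"
      "Determinants.det M = sig.rev_det ?d (Determinants.det ?h)" by auto
    have "M *v w = w"
      using M(3,4) by (simp add: x_def matrix_vector_mult_diff_distrib vector_scalar_commute)
    then have "reverses (M ** ?h) g" by (intro D(8) M)
    moreover have "(M ** ?h) *v pole = pole" by (rule D(9)[OF M(4) D(2)])
    moreover have "Determinants.det (M ** ?h) = sig.rev_det (Suc ?d) 1"
      using M(5) D(5) dg sig.rev_det_Suc[of 1 ?d] by (simp add: Determinants.det_mul)
    moreover have "M ** ?h \<in> isoms sig" by (intro isoms_mul M D(1))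
    ultimately show ?thesis by blast
  qed
qed

theorem SO0_one_multiplicity_free:
  fixes \<pi> :: "real ^ ('p::finite + 1) ^ ('p + 1) \<Rightarrow> 'v::complex_hilbert_space \<Rightarrow> 'v"
  assumes K: "maximal_compact_subgroup SO0 K" "irreducible_hilbert_representation SO0 \<pi>" "admissible K \<pi>"
  shows "multiplicity_free K \<pi>"
proof -
  define t where "t = sig.rev_det (Suc (vec.dim (sig.perp {pole :: real ^ ('p + 1)}))) 1"
  have t: "t = 1 \<or> t = -1" by (auto simp: t_def sig.rev_det_def minus_one_power_iff)
  define a :: "real ^ ('p + 1)" where "a = axis (Inl undefined) 1"
  have a1: "a $ Inr 1 = 0" "a $ Inl undefined = 1" by (simp_all add: a_def axis_def)
  then have a: "a \<in> sig.perp {pole}" "a \<noteq> 0"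
    by (auto simp: sig.perp_def form_pole)
  note ra = reflection_props[OF perp_pole_pos[OF a, THEN less_imp_neq, symmetric]]
  \<comment> \<open>Chosen with determinant \<open>t\<close>, the common determinant of the
    reversing isometries, so that \<open>e ** M\<close> has determinant one.\<close>
  define e where "e = (if t = 1 then mone else reflection a)"
  have e: "e \<in> isoms sig" "e ** e = mone" "Determinants.det e = t"
    using t ra by (auto simp: e_def Determinants.det_I)
  have "form sig a pole = 0" using a(1) sig.form_commute_0 by (auto simp: sig.perp_def)
  then have ep: "e *v pole = pole" by (simp add: e_def reflection_def quasi_refl_vec)
  show ?thesis
  proof (rule SO0_multiplicity_freeI[OF K e(1,2)])
    fix g :: "real ^ ('p + 1) ^ ('p + 1)" assume g: "g \<in> SO0"
    obtain M where M: "M \<in> isoms sig" "reverses M g" "M *v pole = pole" "Determinants.det M = t"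
      using SO0_reversal_det[OF g] t_def by blast
    let ?k = "e ** M"
    have kI: "?k \<in> isoms sig" by (intro isoms_mul e M)
    have kp: "?k *v pole = pole" using M(3) ep by (simp flip: matrix_vector_mul_assoc)
    have "Determinants.det ?k = 1" using e(3) M(4) t by (auto simp: Determinants.det_mul)
    moreover have kf: "?k *v u = u" if "u \<in> {pole}" for u using that kp by simp
    ultimately have "?k \<in> SO0" using isotropy_SO0[OF a _ kI kf] by blast
    moreover have "?k ** g = e ** sig.inv_bar g ** e ** ?k"
    proof -
      have "M ** g = sig.inv_bar g ** M" using sig.reverses_conj[OF M(2) SO0_isoms(1)[OF g]] by simp
      moreover have "e ** sig.inv_bar g ** e ** ?k = e ** sig.inv_bar g ** (e ** e) ** M" by (simp only: matrix_mul_assoc)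
      ultimately show ?thesis using e(2) by (simp flip: matrix_mul_assoc)
    qed
    ultimately show "\<exists>k\<in>SO0. k ** diag_form sig = diag_form sig ** k \<and> k ** g = e ** sig.inv_bar g ** e ** k"
      using pole_fixed_commutes[OF kI kp] by blast
  qed
qed

section \<open>Signature (2,2)\<close>

lemma all_22: "(\<forall>i :: 2 + 2. P i) \<longleftrightarrow> P (Inl 1) \<and> P (Inl 2) \<and> P (Inr 1) \<and> P (Inr 2)"
  by (simp add: split_sum_all forall_2)

lemma sum_22: "(\<Sum>i\<in>(UNIV :: (2 + 2) set). f i) = f (Inl 1) + f (Inl 2) + f (Inr 1) + (f (Inr 2) :: 'b::comm_monoid_add)"
proof -
  have "(\<Sum>i\<in>(UNIV :: (2 + 2) set). f i) = (\<Sum>i\<in>UNIV <+> UNIV. f i)" by (simp only: UNIV_Plus_UNIV)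
  also have "\<dots> = (\<Sum>i\<in>UNIV. f (Inl i)) + (\<Sum>i\<in>UNIV. f (Inr i))" unfolding sum.Plus[OF finite finite] o_def ..
  finally show ?thesis by (simp add: sum_2 add.assoc)
qed

text \<open>The matrix of multiplication by \<open>u\<close> on the plane of complex
  numbers.\<close>

definition rot :: "complex \<Rightarrow> 2 \<Rightarrow> 2 \<Rightarrow> real" where
  "rot u i j = (if i = j then Re u else if i = 1 then - Im u else Im u)"

definition rot2 :: "complex \<Rightarrow> complex \<Rightarrow> real ^ (2 + 2) ^ (2 + 2)" where
  "rot2 u v = (\<chi> i j. case i of
     Inl i' \<Rightarrow> (case j of Inl j' \<Rightarrow> rot u i' j' | Inr _ \<Rightarrow> 0)
   | Inr i' \<Rightarrow> (case j of Inl _ \<Rightarrow> 0 | Inr j' \<Rightarrow> rot v i' j'))"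

lemma rot2_nth [simp]:
  "rot2 u v $ Inl i $ Inl j = rot u i j" "rot2 u v $ Inl i $ Inr j = 0"
  "rot2 u v $ Inr i $ Inl j = 0" "rot2 u v $ Inr i $ Inr j = rot v i j"
  by (simp_all add: rot2_def)

lemma rot_simps [simp]: "rot u 1 1 = Re u" "rot u 1 2 = - Im u" "rot u 2 1 = Im u" "rot u 2 2 = Re u"
  by (simp_all add: rot_def)

lemma rot2_mul: "rot2 u v ** rot2 u' v' = rot2 (u * u') (v * v')"
  by (simp add: cart_eq_iff all_22 matrix_matrix_mult_def sum_22 algebra_simps)

lemma rot2_one: "rot2 1 1 = mone"
  by (simp add: cart_eq_iff all_22 Finite_Cartesian_Product.mat_def)

lemma rot2_commutes: "rot2 u v ** diag_form sig = diag_form sig ** rot2 u v"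
  by (simp add: cart_eq_iff all_22 diag_form_mul_left diag_form_mul_right)

lemma rot2_SO:
  assumes "norm u = 1" "norm v = 1"
  shows "rot2 u v \<in> SO"
proof -
  have isom: "rot2 u v \<in> isoms sig" if "norm u = 1" "norm v = 1" for u v
  proof -
    have n: "Re u * Re u + Im u * Im u = 1" "Re v * Re v + Im v * Im v = 1"
      using that by (simp_all add: cmod_def flip: power2_eq_square)
    show ?thesis unfolding isoms_iff form_def column_def
      using n by (simp add: all_22 sum_22)
  qed
  \<comment> \<open>Being the square of an isometry, whose determinant is 1 or -1, the matrix has
    determinant one.\<close>
  have "rot2 u v = rot2 (csqrt u) (csqrt v) ** rot2 (csqrt u) (csqrt v)"
    by (simp add: rot2_mul flip: power2_eq_square)
  then have "Determinants.det (rot2 u v) = (Determinants.det (rot2 (csqrt u) (csqrt v)))\<^sup>2"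
    by (simp add: Determinants.det_mul power2_eq_square)
  moreover have "rot2 (csqrt u) (csqrt v) \<in> isoms sig" using assms by (intro isom) simp_all
  then have "(Determinants.det (rot2 (csqrt u) (csqrt v)))\<^sup>2 = 1" using sig.det_cases by fastforce
  ultimately show ?thesis using isom[OF assms] by (simp add: SO_eq)
qed

lemma rot2_SO0:
  assumes "norm u = 1" "norm v = 1"
  shows "rot2 u v \<in> SO0"
proof -
  let ?f = "\<lambda>p. rot2 (cis (fst p)) (cis (snd p))"
  have cis: "cis (Arg w) = w" if w: "norm w = 1" for w
  proof -
    have "w \<noteq> 0" using w by auto
    then show ?thesis using cis_Arg[of w] w by (simp add: sgn_eq)
  qed
  have mem: "rot2 u v \<in> range ?f"
    using assms by (intro range_eqI[of _ _ "(Arg u, Arg v)"]) (simp add: cis)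
  show ?thesis
  proof (rule SO0I[of "range ?f" mone])
    have "continuous_on UNIV (\<lambda>p :: real \<times> real. ?f p $ i $ j)" for i j
    proof -
      have rc: "continuous_on UNIV (\<lambda>p. rot (cis (h p)) k l)" if h: "continuous_on UNIV h" for h :: "real \<times> real \<Rightarrow> real" and k l
      proof -
        have eq: "(\<lambda>p. rot (cis (h p)) k l) =
            (if k = l then (\<lambda>p. cos (h p)) else if k = 1 then (\<lambda>p. - sin (h p)) else (\<lambda>p. sin (h p)))"
          by (simp add: rot_def)
        show ?thesis unfolding eq using h by (auto intro!: continuous_intros)
      qed
      show ?thesis
        using rc[OF continuous_on_fst[OF continuous_on_id]] rc[OF continuous_on_snd[OF continuous_on_id]]
        by (cases i; cases j) auto
    qed
    then have "continuous_on UNIV (\<lambda>p. \<chi> i j. ?f p $ i $ j)" by (intro continuous_on_vec_lambda)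
    then have "continuous_on UNIV ?f" by (simp only: vec_lambda_eta)
    then show "connected (range ?f)" by (intro connected_continuous_image) auto
    show "range ?f \<subseteq> SO" by (auto intro!: rot2_SO)
    show "mone \<in> range ?f" by (intro range_eqI[of _ _ "(0, 0)"]) (simp add: rot2_one)
  qed (rule mone_SO0 mem)+
qed

text \<open>
  Real-linear maps of the plane are written \<open>z \<mapsto> lin * z + alin * cnj z\<close>. For the blocks
  \<open>(a, a')\<close>, \<open>(b, b')\<close>, \<open>(c, c')\<close>, \<open>(d, d')\<close> of an isometry, the rotations by \<open>u\<close> and \<open>v\<close>
  conjugate it to its image under the anti-involution iff they solve the equations below.
\<close>

lemma ex_phases:
  fixes a a' b b' c c' d d' :: complex
  assumes r: "a * cnj a' = c * cnj c'" "b * cnj b' = d * cnj d'" "a * a' = b * b'" "c * c' = d * d'"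
    and n: "norm b = norm c" "norm b' = norm c'" and nz: "a \<noteq> 0" "d \<noteq> 0"
  shows "\<exists>u v. norm u = 1 \<and> norm v = 1 \<and> u * b + c * v = 0 \<and> u * b' + cnj (c' * v) = 0 \<and>
    Im (u * a') = 0 \<and> Im (v * d') = 0"
proof -
  \<comment> \<open>For phases the first two equations demand u / v = \<open>\<beta>\<close> and u v
    = \<open>\<alpha>\<close>, hence the square root for \<open>u\<close> below and then
    \<open>v = \<alpha> / u\<close>. If \<open>b\<close> or \<open>b'\<close> is zero, so is its
    partner by equality of norms, the equation is void, and 1 is an arbitrary phase.\<close>
  define \<beta> where "\<beta> = (if b = 0 then 1 else - c / b)"
  define \<alpha> where "\<alpha> = (if b' = 0 then 1 else - cnj c' / b')"
  have na: "norm \<alpha> = 1" and nb: "norm \<beta> = 1" using n by (auto simp: \<alpha>_def \<beta>_def norm_divide)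
  have ab0: "\<alpha> \<noteq> 0" "\<beta> \<noteq> 0" using na nb by auto
  have eb: "\<beta> * b + c = 0" using n(1) by (auto simp: \<beta>_def)
  have ea: "\<alpha> * b' + cnj c' = 0" using n(2) by (auto simp: \<alpha>_def)
  define u where "u = csqrt (\<alpha> * \<beta>)"
  define v where "v = \<alpha> / u"
  have uu: "u * u = \<alpha> * \<beta>" unfolding u_def by (metis power2_csqrt power2_eq_square)
  have u0: "u \<noteq> 0" using uu ab0 by auto
  have nu: "norm u = 1"
  proof -
    have "(norm u)\<^sup>2 = 1" using arg_cong[OF uu, of norm] na nb by (simp add: norm_mult power2_eq_square)
    then show ?thesis using norm_ge_zero[of u] by (simp add: power2_eq_1_iff)
  qed
  have nv: "norm v = 1" using na nu by (simp add: v_def norm_divide)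
  have v0: "v \<noteq> 0" using nv by auto
  have cu: "cnj u = 1 / u" using nu u0 complex_norm_square[of u] by (simp add: field_simps)
  have cv: "cnj v = 1 / v" using nv v0 complex_norm_square[of v] by (simp add: field_simps)
  have "u * (u * b + c * v) = \<alpha> * (\<beta> * b + c)"
    using u0 uu by (simp add: v_def distrib_left mult.assoc[symmetric])
  then have 1: "u * b + c * v = 0" using u0 eb by simp
  have av: "\<alpha> * cnj v = u" by (subst cv) (simp add: v_def u0 ab0)
  have "\<alpha> * (u * b' + cnj (c' * v)) = u * (\<alpha> * b') + (\<alpha> * cnj v) * cnj c'"
    by (simp add: algebra_simps)
  also have "\<dots> = u * (\<alpha> * b' + cnj c')" unfolding av by (simp add: algebra_simps)
  finally have 2: "u * b' + cnj (c' * v) = 0" using ab0 ea by simp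
  \<comment> \<open>For a phase \<open>w\<close>, the number \<open>w * x\<close> is real as soon as
    it equals its conjugate; multiplied by \<open>w\<close> this only involves the square of the
    phase.\<close>
  have real_if: "Im (w * x) = 0" if "w * w * x = cnj x" "cnj w = 1 / w" "w \<noteq> 0" for w x :: complex
  proof -
    have "cnj (w * x) = (1 / w) * (w * w * x)" by (simp only: complex_cnj_mult that(1,2))
    then have "cnj (w * x) = w * x" using that(3) by simp
    from arg_cong[OF this, of Im] show ?thesis by (simp only: cnj.simps)
  qed
  have zero: "a' = 0 \<and> d' = 0" if "b = 0 \<or> b' = 0"
  proof -
    have "b * b' = 0" "c * c' = 0" using that n by auto
    then show ?thesis using r(3,4) nz by auto
  qed
  \<comment> \<open>The square of \<open>u\<close> is \<open>\<alpha> * \<beta>\<close>, so this is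
    the realness of \<open>u * a'\<close>. Multiplied by \<open>a * (b * b')\<close> it becomes a
    consequence of the product relations.\<close>
  have A: "\<alpha> * \<beta> * a' = cnj a'"
  proof (cases "b = 0 \<or> b' = 0")
    case False
    then have ne: "b \<noteq> 0" "b' \<noteq> 0" by auto
    have "a * (b * b') * (\<alpha> * \<beta> * a') = a * a' * (c * cnj c')" using ne by (simp add: \<alpha>_def \<beta>_def)
    also have "\<dots> = a * (b * b') * cnj a'" using r(1)[symmetric] r(3) by (simp add: mult_ac)
    finally show ?thesis using ne nz by simp
  qed (use zero in auto)
  have D: "v * v * d' = cnj d'"
  proof (cases "b = 0 \<or> b' = 0")
    case False
    then have ne: "b \<noteq> 0" "b' \<noteq> 0" "c \<noteq> 0" using n by auto
    have vv: "v * v * \<beta> = \<alpha>" using u0 uu ab0 by (simp add: v_def field_simps)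
    have "d * (v * v * \<beta> * d') * b' * b = - (cnj c' * (d * d') * b)"
      unfolding vv using ne by (simp add: \<alpha>_def mult_ac)
    also have "\<dots> = - ((c' * cnj c') * c * b)" unfolding r(4)[symmetric] by (simp add: mult_ac)
    also have "c' * cnj c' = b' * cnj b'" using n(2) by (simp flip: complex_norm_square)
    also have "- (b' * cnj b' * c * b) = - (b * cnj b') * b' * c" by (simp add: mult_ac)
    also have "\<dots> = d * (\<beta> * cnj d') * b' * b" unfolding r(2) using ne by (simp add: \<beta>_def)
    finally show ?thesis using ne nz ab0 by (simp add: mult_ac)
  qed (use zero in auto)
  have "Im (u * a') = 0" using real_if[of u a'] A uu cu u0 by simp
  moreover have "Im (v * d') = 0" using real_if[of v d'] D cv v0 by simp
  ultimately show ?thesis using nu nv 1 2 by blast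
qed

section \<open>Block relations in signature (2,2)\<close>

definition "upper_left (g :: real ^ (2 + 2) ^ (2 + 2)) i j = g $ Inl i $ Inl j"
definition "upper_right (g :: real ^ (2 + 2) ^ (2 + 2)) i j = g $ Inl i $ Inr j"
definition "lower_left (g :: real ^ (2 + 2) ^ (2 + 2)) i j = g $ Inr i $ Inl j"
definition "lower_right (g :: real ^ (2 + 2) ^ (2 + 2)) i j = g $ Inr i $ Inr j"

lemmas block_entries =
  upper_left_def[symmetric] upper_right_def[symmetric] lower_left_def[symmetric] lower_right_def[symmetric]

context
  fixes g :: "real ^ (2 + 2) ^ (2 + 2)"
  assumes g: "g \<in> SO0"
begin

private abbreviation "A \<equiv> upper_left g"
private abbreviation "B \<equiv> upper_right g"
private abbreviation "C \<equiv> lower_left g"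
private abbreviation "D \<equiv> lower_right g"

lemma column_relations:
  "A 1 i * A 1 j + A 2 i * A 2 j - C 1 i * C 1 j - C 2 i * C 2 j = (if i = j then 1 else 0)"
  "B 1 i * B 1 j + B 2 i * B 2 j - D 1 i * D 1 j - D 2 i * D 2 j = (if i = j then -1 else 0)"
  "A 1 i * B 1 j + A 2 i * B 2 j - C 1 i * D 1 j - C 2 i * D 2 j = 0"
proof -
  have rel: "form sig (column p g) (column q g) = (if p = q then sig p else 0)" for p q
    using SO0_isoms(1)[OF g] by (simp add: isoms_iff)
  show "A 1 i * A 1 j + A 2 i * A 2 j - C 1 i * C 1 j - C 2 i * C 2 j = (if i = j then 1 else 0)"
    using rel[of "Inl i" "Inl j"] by (simp add: form_def column_def sum_22 block_entries)
  show "B 1 i * B 1 j + B 2 i * B 2 j - D 1 i * D 1 j - D 2 i * D 2 j = (if i = j then -1 else 0)"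
    using rel[of "Inr i" "Inr j"] by (simp add: form_def column_def sum_22 block_entries)
  show "A 1 i * B 1 j + A 2 i * B 2 j - C 1 i * D 1 j - C 2 i * D 2 j = 0"
    using rel[of "Inl i" "Inr j"] by (simp add: form_def column_def sum_22 block_entries)
qed

lemma row_relations:
  "A i 1 * A j 1 + A i 2 * A j 2 - B i 1 * B j 1 - B i 2 * B j 2 = (if i = j then 1 else 0)"
  "C i 1 * C j 1 + C i 2 * C j 2 - D i 1 * D j 1 - D i 2 * D j 2 = (if i = j then -1 else 0)"
proof -
  have rel: "form sig (column p (adj g)) (column q (adj g)) = (if p = q then sig p else 0)" for p q
    using sig.isoms_inv(5)[OF SO0_isoms(1)[OF g]] by (simp add: isoms_iff)
  show "A i 1 * A j 1 + A i 2 * A j 2 - B i 1 * B j 1 - B i 2 * B j 2 = (if i = j then 1 else 0)"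
    using rel[of "Inl i" "Inl j"] by (simp add: form_def column_def sum_22 block_entries)
  show "C i 1 * C j 1 + C i 2 * C j 2 - D i 1 * D j 1 - D i 2 * D j 2 = (if i = j then -1 else 0)"
    using rel[of "Inr i" "Inr j"] by (simp add: form_def column_def sum_22 block_entries)
qed

text \<open>With t for transpose, the isometry relations read tA A = 1 + tC C, A tA = 1 + B tB and
  tD D = 1 + tB B; each line is the determinant of one of them, expanded by the Lagrange identity.
  The last two show that the diagonal blocks have equal squared determinant.\<close>

lemma det_block_sq:
  "(A 1 1 * A 2 2 - A 1 2 * A 2 1)\<^sup>2 = 1 + (C 1 1)\<^sup>2 + (C 2 1)\<^sup>2 + (C 1 2)\<^sup>2 + (C 2 2)\<^sup>2 + (C 1 1 * C 2 2 - C 1 2 * C 2 1)\<^sup>2"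
  "(A 1 1 * A 2 2 - A 1 2 * A 2 1)\<^sup>2 = 1 + (B 1 1)\<^sup>2 + (B 2 1)\<^sup>2 + (B 1 2)\<^sup>2 + (B 2 2)\<^sup>2 + (B 1 1 * B 2 2 - B 1 2 * B 2 1)\<^sup>2"
  "(D 1 1 * D 2 2 - D 1 2 * D 2 1)\<^sup>2 = 1 + (B 1 1)\<^sup>2 + (B 2 1)\<^sup>2 + (B 1 2)\<^sup>2 + (B 2 2)\<^sup>2 + (B 1 1 * B 2 2 - B 1 2 * B 2 1)\<^sup>2"
proof -
  have lagrange: "(x * w - y * z)\<^sup>2 = (x * x + z * z) * (y * y + w * w) - (x * y + z * w)\<^sup>2" for x y z w :: real
    by (simp add: power2_eq_square algebra_simps)
  have lagrange': "(x * w - y * z)\<^sup>2 = (x * x + y * y) * (z * z + w * w) - (x * z + y * w)\<^sup>2" for x y z w :: real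
    by (simp add: power2_eq_square algebra_simps)
  have a: "A 1 1 * A 1 1 + A 2 1 * A 2 1 = 1 + (C 1 1 * C 1 1 + C 2 1 * C 2 1)"
    "A 1 2 * A 1 2 + A 2 2 * A 2 2 = 1 + (C 1 2 * C 1 2 + C 2 2 * C 2 2)"
    "A 1 1 * A 1 2 + A 2 1 * A 2 2 = C 1 1 * C 1 2 + C 2 1 * C 2 2"
    using column_relations(1)[of 1 1] column_relations(1)[of 2 2] column_relations(1)[of 1 2] by simp_all
  show "(A 1 1 * A 2 2 - A 1 2 * A 2 1)\<^sup>2 = 1 + (C 1 1)\<^sup>2 + (C 2 1)\<^sup>2 + (C 1 2)\<^sup>2 + (C 2 2)\<^sup>2 + (C 1 1 * C 2 2 - C 1 2 * C 2 1)\<^sup>2"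
    unfolding lagrange a by (simp add: power2_eq_square algebra_simps)
  have d: "D 1 1 * D 1 1 + D 2 1 * D 2 1 = 1 + (B 1 1 * B 1 1 + B 2 1 * B 2 1)"
    "D 1 2 * D 1 2 + D 2 2 * D 2 2 = 1 + (B 1 2 * B 1 2 + B 2 2 * B 2 2)"
    "D 1 1 * D 1 2 + D 2 1 * D 2 2 = B 1 1 * B 1 2 + B 2 1 * B 2 2"
    using column_relations(2)[of 1 1] column_relations(2)[of 2 2] column_relations(2)[of 1 2] by simp_all
  show "(D 1 1 * D 2 2 - D 1 2 * D 2 1)\<^sup>2 = 1 + (B 1 1)\<^sup>2 + (B 2 1)\<^sup>2 + (B 1 2)\<^sup>2 + (B 2 2)\<^sup>2 + (B 1 1 * B 2 2 - B 1 2 * B 2 1)\<^sup>2"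
    unfolding lagrange d by (simp add: power2_eq_square algebra_simps)
  have a': "A 1 1 * A 1 1 + A 1 2 * A 1 2 = 1 + (B 1 1 * B 1 1 + B 1 2 * B 1 2)"
    "A 2 1 * A 2 1 + A 2 2 * A 2 2 = 1 + (B 2 1 * B 2 1 + B 2 2 * B 2 2)"
    "A 1 1 * A 2 1 + A 1 2 * A 2 2 = B 1 1 * B 2 1 + B 1 2 * B 2 2"
    using row_relations(1)[of 1 1] row_relations(1)[of 2 2] row_relations(1)[of 1 2] by simp_all
  show "(A 1 1 * A 2 2 - A 1 2 * A 2 1)\<^sup>2 = 1 + (B 1 1)\<^sup>2 + (B 2 1)\<^sup>2 + (B 1 2)\<^sup>2 + (B 2 2)\<^sup>2 + (B 1 1 * B 2 2 - B 1 2 * B 2 1)\<^sup>2"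
    unfolding lagrange' a' by (simp add: power2_eq_square algebra_simps)
qed

lemma block_det_nonzero:
  "g $ Inl 1 $ Inl 1 * g $ Inl 2 $ Inl 2 - g $ Inl 1 $ Inl 2 * g $ Inl 2 $ Inl 1 \<noteq> 0"
  "g $ Inr 1 $ Inr 1 * g $ Inr 2 $ Inr 2 - g $ Inr 1 $ Inr 2 * g $ Inr 2 $ Inr 1 \<noteq> 0"
proof -
  have pos: "(1::real) + x1\<^sup>2 + x2\<^sup>2 + x3\<^sup>2 + x4\<^sup>2 + x5\<^sup>2 > 0" for x1 x2 x3 x4 x5
    by (intro add_pos_nonneg) auto
  show "g $ Inl 1 $ Inl 1 * g $ Inl 2 $ Inl 2 - g $ Inl 1 $ Inl 2 * g $ Inl 2 $ Inl 1 \<noteq> 0"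
    using det_block_sq(1) pos[of "C 1 1" "C 2 1" "C 1 2" "C 2 2" "C 1 1 * C 2 2 - C 1 2 * C 2 1"]
    unfolding block_entries by (metis less_irrefl zero_power2)
  show "g $ Inr 1 $ Inr 1 * g $ Inr 2 $ Inr 2 - g $ Inr 1 $ Inr 2 * g $ Inr 2 $ Inr 1 \<noteq> 0"
    using det_block_sq(3) pos[of "B 1 1" "B 2 1" "B 1 2" "B 2 2" "B 1 1 * B 2 2 - B 1 2 * B 2 1"]
    unfolding block_entries by (metis less_irrefl zero_power2)
qed

end

lemma positive_on_SO0:
  fixes f :: "real ^ (2 + 2) ^ (2 + 2) \<Rightarrow> real"
  assumes "continuous_on UNIV f" "\<And>g. g \<in> SO0 \<Longrightarrow> f g \<noteq> 0" "f mone > 0" "g \<in> SO0"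
  shows "f g > 0"
proof (rule ccontr)
  assume "\<not> ?thesis"
  then have neg: "f g \<le> 0" by simp
  have "connected (f ` SO0)"
    by (rule connected_continuous_image[OF continuous_on_subset[OF assms(1)] connected_SO0]) simp
  then have "0 \<in> f ` SO0"
    using connectedD_interval[of "f ` SO0" "f g" "f mone" 0] assms(3,4) mone_SO0 neg by auto
  then show False using assms(2) by force
qed

lemma block_det_pos:
  assumes "g \<in> SO0"
  shows "g $ Inl 1 $ Inl 1 * g $ Inl 2 $ Inl 2 - g $ Inl 1 $ Inl 2 * g $ Inl 2 $ Inl (1::2) > (0::real)"
    "g $ Inr 1 $ Inr 1 * g $ Inr 2 $ Inr 2 - g $ Inr 1 $ Inr 2 * g $ Inr 2 $ Inr (1::2) > (0::real)"
proof -
  show "g $ Inl 1 $ Inl 1 * g $ Inl 2 $ Inl 2 - g $ Inl 1 $ Inl 2 * g $ Inl 2 $ Inl 1 > 0"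
    by (rule positive_on_SO0[OF _ _ _ assms, of "\<lambda>g. g $ Inl 1 $ Inl 1 * g $ Inl 2 $ Inl 2 - g $ Inl 1 $ Inl 2 * g $ Inl 2 $ Inl 1"])
      (intro continuous_intros, erule block_det_nonzero, simp add: Finite_Cartesian_Product.mat_def)
  show "g $ Inr 1 $ Inr 1 * g $ Inr 2 $ Inr 2 - g $ Inr 1 $ Inr 2 * g $ Inr 2 $ Inr 1 > 0"
    by (rule positive_on_SO0[OF _ _ _ assms, of "\<lambda>g. g $ Inr 1 $ Inr 1 * g $ Inr 2 $ Inr 2 - g $ Inr 1 $ Inr 2 * g $ Inr 2 $ Inr 1"])
      (intro continuous_intros, erule block_det_nonzero, simp add: Finite_Cartesian_Product.mat_def)
qed

definition lin_part :: "real \<Rightarrow> real \<Rightarrow> real \<Rightarrow> real \<Rightarrow> complex" where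
  "lin_part x y z w = Complex ((x + w) / 2) ((z - y) / 2)"

definition alin_part :: "real \<Rightarrow> real \<Rightarrow> real \<Rightarrow> real \<Rightarrow> complex" where
  "alin_part x y z w = Complex ((x - w) / 2) ((z + y) / 2)"

text \<open>The product with the conjugate depends only on the Gram matrix of the columns, the plain
  product only on that of the rows. So the isometry relations between blocks become equations
  between these products.\<close>

lemma parts_mul:
  "lin_part x y z w * cnj (alin_part x y z w) =
     Complex (((x * x + z * z) - (y * y + w * w)) / 4) (- (x * y + z * w) / 2)"
  "lin_part x y z w * alin_part x y z w =
     Complex (((x * x + y * y) - (z * z + w * w)) / 4) ((x * z + y * w) / 2)"
  by (simp_all add: lin_part_def alin_part_def complex_eq_iff field_simps)

text \<open>A quarter of the squared Frobenius norm plus or minus twice the determinant. Equal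
  Frobenius norms and determinants of two blocks thus give equal norms of both parts.\<close>

lemma parts_norm:
  "(norm (lin_part x y z w))\<^sup>2 = (x * x + y * y + z * z + w * w + 2 * (x * w - y * z)) / 4"
  "(norm (alin_part x y z w))\<^sup>2 = (x * x + y * y + z * z + w * w - 2 * (x * w - y * z)) / 4"
  unfolding cmod_power2 by (simp_all add: lin_part_def alin_part_def power2_eq_square field_simps)

text \<open>Complex conjugation in both planes. Conjugating by it turns the inverse of a rotation
  back into the rotation, so that the resulting anti-involution fixes every \<open>rot2 u v\<close>
  with unimodular parameters.\<close>

definition flip_sign :: "2 + 2 \<Rightarrow> real" where
  "flip_sign i = (case i of Inl j \<Rightarrow> if j = 1 then 1 else -1 | Inr j \<Rightarrow> if j = 1 then 1 else -1)"

lemma flip_sign_simps [simp]: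
  "flip_sign (Inl 1) = 1" "flip_sign (Inl 2) = -1" "flip_sign (Inr 1) = 1" "flip_sign (Inr 2) = -1"
  by (simp_all add: flip_sign_def)

lemma reversal_22:
  fixes g :: "real ^ (2 + 2) ^ (2 + 2)"
  assumes g: "g \<in> SO0"
  shows "\<exists>k\<in>SO0. k ** diag_form sig = diag_form sig ** k \<and>
    k ** g = diag_form flip_sign ** sig.inv_bar g ** diag_form flip_sign ** k"
proof -
  define A where "A = upper_left g"
  define B where "B = upper_right g"
  define C where "C = lower_left g"
  define D where "D = lower_right g"
  note fold = A_def[symmetric] B_def[symmetric] C_def[symmetric] D_def[symmetric]
  note entries = block_entries[of g, unfolded fold]
  note col = column_relations[OF g, unfolded fold]
  note row = row_relations[OF g, unfolded fold]
  note sq = det_block_sq[OF g, unfolded fold]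
  note pos = block_det_pos[OF g, unfolded entries]
  define a where "a = lin_part (A 1 1) (A 1 2) (A 2 1) (A 2 2)"
  define a' where "a' = alin_part (A 1 1) (A 1 2) (A 2 1) (A 2 2)"
  define b where "b = lin_part (B 1 1) (B 1 2) (B 2 1) (B 2 2)"
  define b' where "b' = alin_part (B 1 1) (B 1 2) (B 2 1) (B 2 2)"
  define c where "c = lin_part (C 1 1) (C 1 2) (C 2 1) (C 2 2)"
  define c' where "c' = alin_part (C 1 1) (C 1 2) (C 2 1) (C 2 2)"
  define d where "d = lin_part (D 1 1) (D 1 2) (D 2 1) (D 2 2)"
  define d' where "d' = alin_part (D 1 1) (D 1 2) (D 2 1) (D 2 2)"
  note defs = a_def a'_def b_def b'_def c_def c'_def d_def d'_def
  have r1: "a * cnj a' = c * cnj c'"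
    unfolding defs parts_mul using col(1)[of 1 1] col(1)[of 2 2] col(1)[of 1 2] by (simp add: complex_eq_iff)
  have r2: "b * cnj b' = d * cnj d'"
    unfolding defs parts_mul using col(2)[of 1 1] col(2)[of 2 2] col(2)[of 1 2] by (simp add: complex_eq_iff)
  have r3: "a * a' = b * b'"
    unfolding defs parts_mul using row(1)[of 1 1] row(1)[of 2 2] row(1)[of 1 2] by (simp add: complex_eq_iff)
  have r4: "c * c' = d * d'"
    unfolding defs parts_mul using row(2)[of 1 1] row(2)[of 2 2] row(2)[of 1 2] by (simp add: complex_eq_iff)
  define dA where "dA = A 1 1 * A 2 2 - A 1 2 * A 2 1"
  define dB where "dB = B 1 1 * B 2 2 - B 1 2 * B 2 1"
  define dC where "dC = C 1 1 * C 2 2 - C 1 2 * C 2 1"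
  define dD where "dD = D 1 1 * D 2 2 - D 1 2 * D 2 1"
  have pA: "dA > 0" and pD: "dD > 0" using pos by (simp_all add: dA_def dD_def)
  have "dA\<^sup>2 = dD\<^sup>2" using sq(2,3) by (simp add: dA_def dD_def)
  then have AD: "dA = dD" using pA pD by (simp add: power2_eq_iff_nonneg)
  have "A 1 i * B 1 j + A 2 i * B 2 j = C 1 i * D 1 j + C 2 i * D 2 j" for i j
    using col(3)[of i j] by simp
  then have m: "A 1 1 * B 1 1 + A 2 1 * B 2 1 = C 1 1 * D 1 1 + C 2 1 * D 2 1"
    "A 1 1 * B 1 2 + A 2 1 * B 2 2 = C 1 1 * D 1 2 + C 2 1 * D 2 2"
    "A 1 2 * B 1 1 + A 2 2 * B 2 1 = C 1 2 * D 1 1 + C 2 2 * D 2 1"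
    "A 1 2 * B 1 2 + A 2 2 * B 2 2 = C 1 2 * D 1 2 + C 2 2 * D 2 2" by blast+
  \<comment> \<open>The determinant of tA B = tC D, with t for transpose. As the diagonal blocks
    have equal positive determinant, the off-diagonal ones have equal determinant.\<close>
  have "dA * dB = (A 1 1 * B 1 1 + A 2 1 * B 2 1) * (A 1 2 * B 1 2 + A 2 2 * B 2 2)
      - (A 1 1 * B 1 2 + A 2 1 * B 2 2) * (A 1 2 * B 1 1 + A 2 2 * B 2 1)"
    by (simp add: dA_def dB_def algebra_simps)
  also have "\<dots> = dC * dD" unfolding m by (simp add: dC_def dD_def algebra_simps)
  finally have BC: "dB = dC" using AD pA by simp
  \<comment> \<open>Summing the column relations and the row relations computes the squared
    Frobenius norm of the upper left block in two ways.\<close>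
  have fro: "B 1 1 * B 1 1 + B 1 2 * B 1 2 + B 2 1 * B 2 1 + B 2 2 * B 2 2 = C 1 1 * C 1 1 + C 1 2 * C 1 2 + C 2 1 * C 2 1 + C 2 2 * C 2 2"
    using col(1)[of 1 1] col(1)[of 2 2] row(1)[of 1 1] row(1)[of 2 2] by simp
  have "(norm b)\<^sup>2 = (norm c)\<^sup>2" "(norm b')\<^sup>2 = (norm c')\<^sup>2"
    unfolding defs parts_norm using fro BC by (simp_all add: dB_def dC_def)
  then have n: "norm b = norm c" "norm b' = norm c'" by (simp_all add: power2_eq_iff_nonneg)
  have "(norm a)\<^sup>2 - (norm a')\<^sup>2 = dA" "(norm d)\<^sup>2 - (norm d')\<^sup>2 = dD"
    unfolding defs parts_norm by (simp_all add: dA_def dD_def field_simps)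
  then have "(norm a)\<^sup>2 > 0" "(norm d)\<^sup>2 > 0"
    using pA pD zero_le_power2[of "norm a'"] zero_le_power2[of "norm d'"] by linarith+
  then have nz: "a \<noteq> 0" "d \<noteq> 0" by auto
  obtain u v where uv: "norm u = 1" "norm v = 1" "u * b + c * v = 0" "u * b' + cnj (c' * v) = 0"
    "Im (u * a') = 0" "Im (v * d') = 0" using ex_phases[OF r1 r2 r3 r4 n nz] by blast
  let ?J = "diag_form sig :: real ^ (2 + 2) ^ (2 + 2)" and ?E = "diag_form flip_sign :: real ^ (2 + 2) ^ (2 + 2)"
  have th: "(?E ** sig.inv_bar g ** ?E) $ i $ j = flip_sign i * sig i * g $ j $ i * sig j * flip_sign j" for i j
    by (simp add: sig.inv_bar_def diag_form_mul_left diag_form_mul_right Finite_Cartesian_Product.transpose_def mult_ac)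
  \<comment> \<open>Real forms of the phase equations. The diagonal blocks contribute only their
    antisymmetric entry, the off-diagonal blocks a linear and an antilinear complex
    equation.\<close>
  have eqs:
    "Re u * (A 2 1 + A 1 2) + Im u * (A 1 1 - A 2 2) = 0"
    "Re v * (D 2 1 + D 1 2) + Im v * (D 1 1 - D 2 2) = 0"
    using uv(5,6) by (simp_all add: defs alin_part_def field_simps)
  have eqs2:
    "Re u * (B 1 1 + B 2 2) - Im u * (B 2 1 - B 1 2) + (C 1 1 + C 2 2) * Re v - (C 2 1 - C 1 2) * Im v = 0"
    "Re u * (B 2 1 - B 1 2) + Im u * (B 1 1 + B 2 2) + (C 1 1 + C 2 2) * Im v + (C 2 1 - C 1 2) * Re v = 0"
    "Re u * (B 1 1 - B 2 2) - Im u * (B 2 1 + B 1 2) + (C 1 1 - C 2 2) * Re v - (C 2 1 + C 1 2) * Im v = 0"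
    "Re u * (B 2 1 + B 1 2) + Im u * (B 1 1 - B 2 2) - (C 1 1 - C 2 2) * Im v - (C 2 1 + C 1 2) * Re v = 0"
    using uv(3,4) by (simp_all add: defs lin_part_def alin_part_def complex_eq_iff field_simps)
  have "rot2 u v ** g = ?E ** sig.inv_bar g ** ?E ** rot2 u v"
    unfolding cart_eq_iff all_22
    using eqs eqs2
    by (simp add: matrix_matrix_mult_def[of "rot2 u v"] matrix_matrix_mult_def[of "?E ** sig.inv_bar g ** ?E"] sum_22 th entries algebra_simps)
  then show ?thesis
    using rot2_SO0[OF uv(1,2)] rot2_commutes by blast
qed

theorem SO0_22_multiplicity_free:
  fixes \<pi> :: "real ^ (2 + 2) ^ (2 + 2) \<Rightarrow> 'v::complex_hilbert_space \<Rightarrow> 'v"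
  assumes K: "maximal_compact_subgroup SO0 K" "irreducible_hilbert_representation SO0 \<pi>" "admissible K \<pi>"
  shows "multiplicity_free K \<pi>"
proof (rule SO0_multiplicity_freeI[OF K])
  let ?E = "diag_form flip_sign :: real ^ (2 + 2) ^ (2 + 2)"
  have f: "flip_sign i * flip_sign i = 1" for i by (auto simp: flip_sign_def split: sum.splits)
  then show EE: "?E ** ?E = mone"
    by (simp add: cart_eq_iff diag_form_mul_left Finite_Cartesian_Product.mat_def) (simp add: diag_form_def)
  show "?E \<in> isoms sig"
    unfolding isoms_def using f
    by (simp add: cart_eq_iff diag_form_mul_left diag_form_mul_right) (simp add: diag_form_def)
qed (rule reversal_22)

theorem corollary5p15:
  shows
    "(\<forall>K (\<pi> :: complex ^ ('p::finite + 1) ^ ('p + 1) \<Rightarrow> 'v::complex_hilbert_space \<Rightarrow> 'v).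
        maximal_compact_subgroup SU K \<and> irreducible_hilbert_representation SU \<pi> \<and> admissible K \<pi>
        \<longrightarrow> multiplicity_free K \<pi>) \<and>
     (\<forall>K (\<pi> :: real ^ ('p + 1) ^ ('p + 1) \<Rightarrow> 'v \<Rightarrow> 'v).
        maximal_compact_subgroup SO0 K \<and> irreducible_hilbert_representation SO0 \<pi> \<and> admissible K \<pi>
        \<longrightarrow> multiplicity_free K \<pi>) \<and>
     (\<forall>K (\<pi> :: real ^ (2 + 2) ^ (2 + 2) \<Rightarrow> 'v \<Rightarrow> 'v).
        maximal_compact_subgroup SO0 K \<and> irreducible_hilbert_representation SO0 \<pi> \<and> admissible K \<pi>
        \<longrightarrow> multiplicity_free K \<pi>)"
  by (intro conjI allI impI; elim conjE)
    (rule SU_multiplicity_free SO0_one_multiplicity_free SO0_22_multiplicity_free; assumption)+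

end
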